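(* For any $0<\eta<1/2$ there exists $K>0$ such that for all sufficiently large $d$, every $(n,d,\lambda)$-graph $G$ with $d\geq K\lambda$ contains a $K_{(1-5\eta)d}$-immersion.
   Context: An $(n,d,\lambda)$-graph is an $n$-vertex $d$-regular graph all of whose adjacency eigenvalues except the largest one are at most $\lambda$ in absolute value. A graph $G$ contains an $H$-immersion if there is an injective map $\phi:V(H)\to V(G)$ and, for every edge $uv\in E(H)$, a path $P_{uv}$ in $G$ from $\phi(u)$ to $\phi(v)$, such that the paths $P_{uv}$ ($uv\in E(H)$) are pairwise edge-disjoint. Floors are omitted ($K_{(1-5\eta)d}$ means $K_{\lfloor(1-5\eta)d\rfloor}$). *)

theory Defs
  imports "Jordan_Normal_Form.Matrix" "Jordan_Normal_Form.Char_Poly"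
    "HOL-Computational_Algebra.Fundamental_Theorem_Algebra"
begin

definition simple_graph :: "nat \<Rightarrow> (nat \<Rightarrow> nat \<Rightarrow> bool) \<Rightarrow> bool" where
  "simple_graph n E \<longleftrightarrow>
     (\<forall>x y. E x y \<longrightarrow> x < n \<and> y < n) \<and> (\<forall>x y. E x y \<longrightarrow> E y x) \<and> (\<forall>x. \<not> E x x)"

definition regular :: "nat \<Rightarrow> (nat \<Rightarrow> nat \<Rightarrow> bool) \<Rightarrow> nat \<Rightarrow> bool" where
  "regular n E d \<longleftrightarrow> (\<forall>x<n. card {y. y < n \<and> E x y} = d)"

definition adj_matrix :: "nat \<Rightarrow> (nat \<Rightarrow> nat \<Rightarrow> bool) \<Rightarrow> complex mat" where
  "adj_matrix n E = mat n n (\<lambda>(i, j). if E i j then 1 else 0)"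

definition adj_eigenvalues :: "nat \<Rightarrow> (nat \<Rightarrow> nat \<Rightarrow> bool) \<Rightarrow> complex multiset" where
  "adj_eigenvalues n E = proots (char_poly (adj_matrix n E))"

definition ndl_graph :: "nat \<Rightarrow> nat \<Rightarrow> real \<Rightarrow> (nat \<Rightarrow> nat \<Rightarrow> bool) \<Rightarrow> bool" where
  "ndl_graph n d lam E \<longleftrightarrow> simple_graph n E \<and> regular n E d \<and>
     (\<exists>\<mu>0 \<in># adj_eigenvalues n E.
        (\<forall>\<mu> \<in># adj_eigenvalues n E. Re \<mu> \<le> Re \<mu>0) \<and>
        (\<forall>\<mu> \<in># adj_eigenvalues n E - {#\<mu>0#}. cmod \<mu> \<le> lam))"

definition is_path :: "(nat \<Rightarrow> nat \<Rightarrow> bool) \<Rightarrow> nat list \<Rightarrow> nat \<Rightarrow> nat \<Rightarrow> bool" where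
  "is_path E p u v \<longleftrightarrow> p \<noteq> [] \<and> hd p = u \<and> last p = v \<and> distinct p \<and>
     (\<forall>i. Suc i < length p \<longrightarrow> E (p ! i) (p ! Suc i))"

definition path_edges :: "nat list \<Rightarrow> nat set set" where
  "path_edges p = {{p ! i, p ! Suc i} | i. Suc i < length p}"

definition has_complete_immersion :: "nat \<Rightarrow> (nat \<Rightarrow> nat \<Rightarrow> bool) \<Rightarrow> nat \<Rightarrow> bool" where
  "has_complete_immersion n E m \<longleftrightarrow>
     (\<exists>\<phi> P. inj_on \<phi> {0..<m} \<and> \<phi> ` {0..<m} \<subseteq> {0..<n} \<and>
        (\<forall>a b. a < b \<and> b < m \<longrightarrow> is_path E (P a b) (\<phi> a) (\<phi> b)) \<and>
        (\<forall>a b a' b'. a < b \<and> b < m \<and> a' < b' \<and> b' < m \<and> (a, b) \<noteq> (a', b') \<longrightarrow>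
            path_edges (P a b) \<inter> path_edges (P a' b') = {}))"

end

theory Submission
  imports Defs "Jordan_Normal_Form.Schur_Decomposition"
begin

text \<open>
  Let \<open>p = d / n\<close>. All that is used of the spectrum is that
  \<open>(\<Sum>w. (card (N w \<inter> T) - p * card T)\<^sup>2) \<le> lam\<^sup>2 * card T\<close> for every vertex set \<open>T\<close>;
  this follows from the trace of high powers of the adjacency matrix together with the log-convexity
  of \<open>k \<mapsto> \<parallel>A\<^sup>k f\<parallel>\<^sup>2\<close> for \<open>f\<close> orthogonal to the constants.

  If \<open>n / d\<close> is large, the branch vertices are chosen so that their stars hardly overlap, and the pairs
  are joined greedily by shortest paths of unused edges. Vertices that have lost many edges, together
  with those having many neighbours among them, form a small set that is avoided; a branch vertex is
  discarded only if this set covers many of its neighbours. When \<open>n\<close> is exponential in \<open>d\<close> the paths are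
  too long for that count, and they are instead cut out of binary trees grown in the style of Friedman and
  Pippenger, where unneeded branches can be removed without spoiling extendability.

  If \<open>n / d\<close> is bounded, almost all non-adjacent pairs of branch vertices must be joined by paths of
  length two. The hubs are processed one at a time, each taking an almost perfect matching among the
  still unserved pairs in its neighbourhood. Such a matching exists as long as the graph of unserved pairs is
  nearly regular, and it stays nearly regular because every branch vertex loses about one unserved
  pair per adjacent hub; the total irregularity is controlled by a discrete Gronwall estimate.
  The few remaining pairs are routed greedily as before: a branch vertex of degree \<open>d\<close> in a clique on
  fewer than \<open>d\<close> vertices always keeps enough free edges.
\<close>


section \<open>Hall's theorem with deficiency\<close>

text \<open>About \<open>d\<^sup>2 / 2\<close> pairs compete for \<open>n * d / 2\<close> edges, so
  an average path can have at most about \<open>n / d\<close> edges; and nearly every edge at a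
  branch vertex must start one of its paths, so that only a small multiple of
  \<open>\<eta> * d\<close> edges may be wasted there. With \<open>2 ^ k\<close> about
  \<open>n / d\<close>, greedy paths have length about \<open>l = 2 * k + 5\<close> and occupy of
  order \<open>d\<^sup>2 * l\<close> edges, which is affordable once \<open>2 ^ k\<close> dominates
  \<open>l\<close>. They spoil of order \<open>d * l\<close> vertices; if no vertex lies in more
  than \<open>t\<close> stars, this costs of order \<open>t * l\<close> branch vertices, tolerable
  while \<open>t * l\<close> is a small multiple of \<open>d\<close>. For \<open>l\<close> beyond
  the order of \<open>d\<close> this fails even for disjoint stars, which forces the vertex-disjoint
  tree construction. For bounded \<open>n / d\<close>, the Gronwall factor is exponential in
  \<open>n / D0\<close>, where the residual degree \<open>D0\<close> is a small multiple of
  \<open>d\<close>. It is beaten by \<open>K\<close>, chosen after the bound on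
  \<open>n / d\<close>. Hence the sparse case fixes the threshold \<open>k0\<close>, and the dense
  constants come afterwards.\<close>

lemma hall_marriage:
  fixes R :: "'a \<Rightarrow> 'b set"
  assumes "finite X" "\<And>x. x \<in> X \<Longrightarrow> finite (R x)"
    and "\<And>A. A \<subseteq> X \<Longrightarrow> card A \<le> card (\<Union>(R ` A))"
  shows "\<exists>f. inj_on f X \<and> (\<forall>x\<in>X. f x \<in> R x)"
  using assms
proof (induction "card X" arbitrary: X R rule: less_induct)
  case less
  note fX = less.prems(1) and fR = less.prems(2) and hall = less.prems(3)
  show ?case
  proof (cases "X = {}")
    case True
    then show ?thesis by auto
  next
    case False
    then obtain x0 where x0: "x0 \<in> X" by auto
    \<comment> \<open>Halmos-Vaughan dichotomy: a tight proper subset splits the problem into two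
      independent ones; without one, every nonempty proper subset has an element to spare, so any
      single pair may be matched and removed.\<close>
    show ?thesis
    proof (cases "\<exists>A. A \<subseteq> X \<and> A \<noteq> {} \<and> A \<noteq> X \<and> card (\<Union>(R ` A)) = card A")
      case True
      then obtain A where A: "A \<subseteq> X" "A \<noteq> {}" "A \<noteq> X" and tight: "card (\<Union>(R ` A)) = card A"
        by auto
      have fA: "finite A" using A fX finite_subset by auto
      have cA: "card A < card X" using A fX by (simp add: psubset_card_mono psubset_eq)
      obtain f where f: "inj_on f A" "\<forall>x\<in>A. f x \<in> R x"
      proof -
        have "\<exists>f. inj_on f A \<and> (\<forall>x\<in>A. f x \<in> R x)"
          by (rule less.hyps[OF cA fA]) (use A in \<open>auto intro!: fR hall\<close>)
        then show ?thesis using that by blast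
      qed
      define R' where "R' x = R x - \<Union>(R ` A)" for x
      have cX: "card (X - A) < card X"
        using A fX by (intro psubset_card_mono) auto
      have "\<exists>g. inj_on g (X - A) \<and> (\<forall>x\<in>X - A. g x \<in> R' x)"
      proof (rule less.hyps[OF cX])
        fix C assume C: "C \<subseteq> X - A"
        then have fC: "finite C" using fX finite_subset by auto
        have fU: "finite (\<Union>(R ` D))" if "D \<subseteq> X" for D
          using that fR fX finite_subset[of D X] by auto
        have eq: "\<Union>(R ` (A \<union> C)) = \<Union>(R ` A) \<union> \<Union>(R' ` C)" by (auto simp: R'_def)
        have "card A + card C = card (A \<union> C)"
          using C fA fC by (subst card_Un_disjoint) auto
        also have "\<dots> \<le> card (\<Union>(R ` (A \<union> C)))" using C A by (intro hall) auto
        also have "\<dots> = card (\<Union>(R ` A)) + card (\<Union>(R' ` C))"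
          unfolding eq
        proof (rule card_Un_disjoint)
          show "finite (\<Union>(R ` A))" by (rule fU[OF A(1)])
          show "finite (\<Union>(R' ` C))"
            by (rule finite_subset[OF _ fU[of C]]) (use C in \<open>auto simp: R'_def\<close>)
          show "\<Union>(R ` A) \<inter> \<Union>(R' ` C) = {}" by (auto simp: R'_def)
        qed
        finally show "card C \<le> card (\<Union>(R' ` C))" using tight by simp
      qed (use fX fR in \<open>auto simp: R'_def\<close>)
      then obtain g where g: "inj_on g (X - A)" "\<forall>x\<in>X - A. g x \<in> R' x" by auto
      define h where "h x = (if x \<in> A then f x else g x)" for x
      have "inj_on h X"
      proof (rule inj_onI)
        fix x y assume xy: "x \<in> X" "y \<in> X" "h x = h y"
        have "x \<in> A \<longleftrightarrow> y \<in> A"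
        proof (rule ccontr)
          assume "\<not> ?thesis"
          then consider "x \<in> A" "y \<notin> A" | "x \<notin> A" "y \<in> A" by auto
          then show False
          proof cases
            case 1
            have "g y \<in> R' y" "f x \<in> R x" using 1 xy f g by auto
            then show False using 1 xy(3) by (auto simp: h_def R'_def)
          next
            case 2
            have "g x \<in> R' x" "f y \<in> R y" using 2 xy f g by auto
            then show False using 2 xy(3) by (auto simp: h_def R'_def)
          qed
        qed
        then show "x = y"
          using xy f(1) g(1) by (cases "x \<in> A") (auto simp: h_def dest: inj_onD)
      qed
      moreover have "\<forall>x\<in>X. h x \<in> R x" using f g by (auto simp: h_def R'_def)
      ultimately show ?thesis by auto
    next
      case False
      then have strict: "card A < card (\<Union>(R ` A))" if "A \<subseteq> X" "A \<noteq> {}" "A \<noteq> X" for A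
        using hall[OF that(1)] that by (metis le_neq_implies_less)
      have "card {x0} \<le> card (R x0)" using hall[of "{x0}"] x0 by auto
      then obtain y0 where y0: "y0 \<in> R x0" by fastforce
      define R' where "R' x = R x - {y0}" for x
      have cX: "card (X - {x0}) < card X" using fX x0 by (rule card_Diff1_less)
      have "\<exists>g. inj_on g (X - {x0}) \<and> (\<forall>x\<in>X - {x0}. g x \<in> R' x)"
      proof (rule less.hyps[OF cX])
        fix C assume C: "C \<subseteq> X - {x0}"
        show "card C \<le> card (\<Union>(R' ` C))"
        proof (cases "C = {}")
          case False
          have eq: "\<Union>(R' ` C) = \<Union>(R ` C) - {y0}" by (auto simp: R'_def)
          have "card C < card (\<Union>(R ` C))" using C False x0 by (intro strict) auto
          also have "card (\<Union>(R ` C)) \<le> Suc (card (\<Union>(R ` C) - {y0}))"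
            by (simp add: card_Diff_singleton_if) arith
          finally show ?thesis by (simp add: eq)
        qed simp
      qed (use fX fR in \<open>auto simp: R'_def\<close>)
      then obtain g where g: "inj_on g (X - {x0})" "\<forall>x\<in>X - {x0}. g x \<in> R' x" by auto
      define h where "h x = (if x = x0 then y0 else g x)" for x
      have "inj_on h X"
        unfolding inj_on_def h_def using g by (auto simp: R'_def dest: inj_onD)
      moreover have "\<forall>x\<in>X. h x \<in> R x" using g y0 by (auto simp: h_def R'_def)
      ultimately show ?thesis by auto
    qed
  qed
qed

text \<open>Adding \<open>k\<close> dummy elements, the \<open>Inr\<close> part, to every
  \<open>R x\<close> restores Hall's condition, and at most \<open>k\<close> elements of
  \<open>X\<close> are then matched to dummies.\<close>

lemma hall_deficiency:
  fixes R :: "'a \<Rightarrow> 'b set"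
  assumes X: "finite X" and R: "\<And>x. x \<in> X \<Longrightarrow> finite (R x)"
    and hall: "\<And>A. A \<subseteq> X \<Longrightarrow> card A \<le> card (\<Union>(R ` A)) + k"
  shows "\<exists>X' f. X' \<subseteq> X \<and> card X \<le> card X' + k \<and> inj_on f X' \<and> (\<forall>x\<in>X'. f x \<in> R x)"
proof -
  define R' :: "'a \<Rightarrow> ('b + nat) set" where "R' x = Inl ` R x \<union> Inr ` {..<k}" for x
  have "\<exists>g. inj_on g X \<and> (\<forall>x\<in>X. g x \<in> R' x)"
  proof (rule hall_marriage[OF X])
    fix A assume A: "A \<subseteq> X"
    then have fA: "finite A" using X finite_subset by auto
    show "card A \<le> card (\<Union>(R' ` A))"
    proof (cases "A = {}")
      case False
      then have eq: "\<Union>(R' ` A) = Inl ` \<Union>(R ` A) \<union> Inr ` {..<k}"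
        by (auto simp: R'_def)
      have "finite (\<Union>(R ` A))" using A R fA by auto
      then have "card (\<Union>(R' ` A)) = card (\<Union>(R ` A)) + k"
        unfolding eq by (subst card_Un_disjoint) (auto simp: card_image)
      then show ?thesis using hall[OF A] by simp
    qed simp
  qed (use R in \<open>auto simp: R'_def\<close>)
  then obtain g where g: "inj_on g X" "\<forall>x\<in>X. g x \<in> R' x" by auto
  define X' where "X' = {x\<in>X. g x \<in> range Inl}"
  define f where "f x = (case g x of Inl y \<Rightarrow> y)" for x
  have rest: "card (X - X') \<le> k"
  proof -
    have "g ` (X - X') \<subseteq> Inr ` {..<k}" using g(2) by (auto simp: X'_def R'_def)
    then have "card (g ` (X - X')) \<le> card (Inr ` {..<k} :: ('b + nat) set)"
      by (intro card_mono) auto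
    moreover have "card (g ` (X - X')) = card (X - X')"
      using g(1) by (intro card_image) (auto intro: inj_on_subset)
    ultimately show ?thesis by (simp add: card_image)
  qed
  have "card X = card X' + card (X - X')"
    using X by (subst card_Un_disjoint[symmetric]) (auto simp: X'_def intro: arg_cong[where f = card])
  moreover have "inj_on f X'"
  proof (rule inj_onI)
    fix x y assume *: "x \<in> X'" "y \<in> X'" "f x = f y"
    then obtain a b where "g x = Inl a" "g y = Inl b" by (auto simp: X'_def)
    then have "g x = g y" using *(3) by (simp add: f_def)
    moreover have "x \<in> X" "y \<in> X" using * by (auto simp: X'_def)
    ultimately show "x = y" using g(1) by (auto dest: inj_onD)
  qed
  moreover have "\<forall>x\<in>X'. f x \<in> R x"
    using g(2) by (auto simp: X'_def f_def R'_def)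
  ultimately show ?thesis using rest by (intro exI[of _ X'] exI[of _ f]) (auto simp: X'_def)
qed

section \<open>Paths and immersions\<close>

text \<open>Trades indices for vertices: listing \<open>B\<close> increasingly turns
  \<open>a < b\<close> into \<open>u < v\<close>, so paths have to be supplied for increasing pairs
  only. If \<open>B\<close> is larger than required, the first \<open>m\<close> entries
  serve.\<close>

lemma complete_immersionI:
  assumes B: "B \<subseteq> {..<n}" and m: "m \<le> card B"
    and path: "\<And>u v. u \<in> B \<Longrightarrow> v \<in> B \<Longrightarrow> u < v \<Longrightarrow> is_path E (P u v) u v"
    and disj: "\<And>u v u' v'. \<lbrakk>u \<in> B; v \<in> B; u < v; u' \<in> B; v' \<in> B; u' < v'; (u, v) \<noteq> (u', v')\<rbrakk>
      \<Longrightarrow> path_edges (P u v) \<inter> path_edges (P u' v') = {}"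
  shows "has_complete_immersion n E m"
proof -
  have fB: "finite B" using B finite_subset by blast
  define l where "l = sorted_list_of_set B"
  have l: "set l = B" "length l = card B" "sorted l" "distinct l"
    unfolding l_def using fB by (auto simp: length_sorted_list_of_set)
  define \<phi> where "\<phi> i = l ! i" for i
  have mono: "\<phi> a < \<phi> b" if "a < b" "b < m" for a b
    unfolding \<phi>_def using that l m strict_sorted_iff[of l] sorted_wrt_nth_less[of "(<)" l a b] by auto
  have inB: "\<phi> a \<in> B" if "a < m" for a
    using that l m unfolding \<phi>_def by (metis nth_mem order_less_le_trans)
  have inj: "inj_on \<phi> {0..<m}"
    unfolding inj_on_def \<phi>_def using l m by (auto simp: nth_eq_iff_index_eq)
  show ?thesis
    unfolding has_complete_immersion_def
  proof (intro exI[of _ \<phi>] exI[of _ "\<lambda>a b. P (\<phi> a) (\<phi> b)"] conjI allI impI)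
    show "inj_on \<phi> {0..<m}" by (rule inj)
    show "\<phi> ` {0..<m} \<subseteq> {0..<n}" using inB B by fastforce
    fix a b assume "a < b \<and> b < m"
    then show "is_path E (P (\<phi> a) (\<phi> b)) (\<phi> a) (\<phi> b)"
      using inB mono by (intro path) auto
  next
    fix a b a' b' assume *: "a < b \<and> b < m \<and> a' < b' \<and> b' < m \<and> (a, b) \<noteq> (a', b')"
    have "(\<phi> a, \<phi> b) \<noteq> (\<phi> a', \<phi> b')"
      using * inj by (auto simp: inj_on_def)
    then show "path_edges (P (\<phi> a) (\<phi> b)) \<inter> path_edges (P (\<phi> a') (\<phi> b')) = {}"
      using * inB mono by (intro disj) auto
  qed
qed

lemma is_path_iff_successively:
  "is_path E q u v \<longleftrightarrow> q \<noteq> [] \<and> hd q = u \<and> last q = v \<and> distinct q \<and> successively E q"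
  by (auto simp: is_path_def successively_conv_nth)

lemma path_edges_Nil [simp]: "path_edges [] = {}"
  and path_edges_single [simp]: "path_edges [x] = {}"
  by (auto simp: path_edges_def)

lemma path_edges_Cons:
  "q \<noteq> [] \<Longrightarrow> path_edges (x # q) = insert {x, hd q} (path_edges q)"
proof -
  assume q: "q \<noteq> []"
  have "path_edges (x # q) = {{(x # q) ! i, q ! i} | i. i < length q}"
    by (auto simp: path_edges_def)
  also have "\<dots> = insert {x, hd q} {{q ! i, q ! Suc i} | i. Suc i < length q}"
  proof (rule equalityI; rule subsetI)
    fix e assume "e \<in> {{(x # q) ! i, q ! i} | i. i < length q}"
    then obtain i where "i < length q" "e = {(x # q) ! i, q ! i}" by auto
    then show "e \<in> insert {x, hd q} {{q ! i, q ! Suc i} | i. Suc i < length q}"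
      using q by (cases i) (auto simp: hd_conv_nth)
  next
    fix e assume "e \<in> insert {x, hd q} {{q ! i, q ! Suc i} | i. Suc i < length q}"
    then consider "e = {x, hd q}" | i where "Suc i < length q" "e = {q ! i, q ! Suc i}" by auto
    then show "e \<in> {{(x # q) ! i, q ! i} | i. i < length q}"
    proof cases
      case 1
      then show ?thesis using q by (auto simp: hd_conv_nth intro!: exI[of _ 0])
    next
      case 2
      then show ?thesis by (auto intro!: exI[of _ "Suc i"])
    qed
  qed
  finally show ?thesis by (simp add: path_edges_def)
qed

lemma path_edges_append:
  "xs \<noteq> [] \<Longrightarrow> ys \<noteq> [] \<Longrightarrow>
    path_edges (xs @ ys) = path_edges xs \<union> {{last xs, hd ys}} \<union> path_edges ys"
proof (induction xs rule: list_nonempty_induct)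
  case (single x)
  then show ?case by (auto simp: path_edges_Cons)
next
  case (cons x xs)
  then show ?case by (auto simp: path_edges_Cons)
qed

lemma path_edges_sub: "e \<in> path_edges q \<Longrightarrow> e \<subseteq> set q"
  by (auto simp: path_edges_def)

lemma finite_path_edges [simp]: "finite (path_edges q)"
  by (induction q rule: induct_list012) (auto simp: path_edges_Cons)

lemma card_path_edges: "card (path_edges q) \<le> length q"
proof (induction q rule: induct_list012)
  case (3 x y zs)
  have "path_edges (x # y # zs) = insert {x, y} (path_edges (y # zs))"
    by (simp add: path_edges_Cons[of "y # zs" x])
  then show ?case using 3 by (simp add: card_insert_if)
qed auto

lemma path_edges_successively:
  assumes "successively P q" "e \<in> path_edges q"
  obtains x y where "e = {x, y}" "P x y" "x \<in> set q" "y \<in> set q"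
proof -
  obtain i where i: "Suc i < length q" "e = {q ! i, q ! Suc i}"
    using assms(2) by (auto simp: path_edges_def)
  moreover have "P (q ! i) (q ! Suc i)" using assms(1) i(1) by (rule successively_nth)
  ultimately show ?thesis using that[of "q ! i" "q ! Suc i"] by simp
qed

lemma distinct_path_of_walk:
  assumes "q \<noteq> []" "successively P q"
  shows "\<exists>q'. q' \<noteq> [] \<and> hd q' = hd q \<and> last q' = last q \<and> successively P q' \<and> distinct q'
     \<and> length q' \<le> length q \<and> set q' \<subseteq> set q"
  using assms
proof (induction "length q" arbitrary: q rule: less_induct)
  case less
  show ?case
  proof (cases "distinct q")
    case True
    then show ?thesis using less.prems by auto
  next
    case False
    then obtain xs ys zs y where q: "q = xs @ [y] @ ys @ [y] @ zs"
      using not_distinct_decomp by blast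
    let ?r = "xs @ [y] @ zs"
    have "successively P ?r"
      using less.prems(2) unfolding q by (auto simp: successively_append_iff successively_Cons split: if_splits)
    moreover have "hd ?r = hd q" "last ?r = last q" "length ?r < length q" "?r \<noteq> []" "set ?r \<subseteq> set q"
      unfolding q by (auto simp: hd_append)
    ultimately show ?thesis
      using less.hyps[of ?r] by fastforce
  qed
qed

section \<open>Pseudorandom graphs\<close>

definition nbrs :: "(nat \<Rightarrow> nat \<Rightarrow> bool) \<Rightarrow> nat \<Rightarrow> nat set" where
  "nbrs E x = {y. E x y}"

text \<open>Cauchy-Schwarz, from expanding the nonnegative sum of
  \<open>(c * f x - b * g x)\<^sup>2\<close> to \<open>c * (a * c - b\<^sup>2)\<close>.\<close>

lemma sum_product_sq_le:
  fixes f g :: "'a \<Rightarrow> real"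
  assumes "finite A"
  shows "(\<Sum>x\<in>A. f x * g x)\<^sup>2 \<le> (\<Sum>x\<in>A. (f x)\<^sup>2) * (\<Sum>x\<in>A. (g x)\<^sup>2)"
proof -
  define a b c where "a = (\<Sum>x\<in>A. (f x)\<^sup>2)" and "b = (\<Sum>x\<in>A. f x * g x)" and "c = (\<Sum>x\<in>A. (g x)\<^sup>2)"
  have "0 \<le> (\<Sum>x\<in>A. (c * f x - b * g x)\<^sup>2)"
    by (intro sum_nonneg) auto
  also have "\<dots> = (\<Sum>x\<in>A. c\<^sup>2 * (f x)\<^sup>2 - 2 * c * b * (f x * g x) + b\<^sup>2 * (g x)\<^sup>2)"
    by (rule sum.cong) (auto simp: power2_eq_square algebra_simps)
  also have "\<dots> = c\<^sup>2 * a - 2 * c * b * b + b\<^sup>2 * c"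
    by (simp add: sum.distrib sum_subtractf sum_distrib_left[symmetric] a_def b_def c_def)
  also have "\<dots> = c * (a * c - b\<^sup>2)"
    by (simp add: power2_eq_square algebra_simps)
  finally have *: "0 \<le> c * (a * c - b\<^sup>2)" .
  have "0 \<le> c" by (auto simp: c_def intro: sum_nonneg)
  show ?thesis
  proof (cases "c = 0")
    case True
    then have "\<forall>x\<in>A. g x = 0" using assms by (simp add: c_def sum_nonneg_eq_0_iff)
    then show ?thesis by simp
  next
    case False
    with \<open>0 \<le> c\<close> have "0 < c" by simp
    with * have "0 \<le> a * c - b\<^sup>2" by (simp add: zero_le_mult_iff)
    then show ?thesis by (simp add: a_def b_def c_def)
  qed
qed

lemma sum_abs_le_sqrt:
  fixes f :: "'a \<Rightarrow> real"
  assumes "finite A" and "(\<Sum>x\<in>A. (f x)\<^sup>2) \<le> c"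
  shows "(\<Sum>x\<in>A. \<bar>f x\<bar>) \<le> sqrt (real (card A) * c)"
proof (rule real_le_rsqrt)
  have "(\<Sum>x\<in>A. \<bar>f x\<bar>)\<^sup>2 \<le> real (card A) * (\<Sum>x\<in>A. (f x)\<^sup>2)"
    using sum_product_sq_le[OF assms(1), of "\<lambda>_. 1" "\<lambda>x. \<bar>f x\<bar>"] by simp
  also have "\<dots> \<le> real (card A) * c"
    using assms(2) by (intro mult_left_mono) auto
  finally show "(\<Sum>x\<in>A. \<bar>f x\<bar>)\<^sup>2 \<le> real (card A) * c" .
qed

text \<open>The left side of \<open>spread\<close> is the squared norm of the adjacency operator
  applied to the indicator of \<open>T\<close> minus its mean. Since \<open>lam\<close> may be zero,
  \<open>K\<close> enters through \<open>K * lam \<le> d\<close>, and estimates multiply by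
  \<open>K\<^sup>2\<close> instead of dividing by \<open>lam\<close>.\<close>

locale quasirandom =
  fixes n d :: nat and lam K :: real and E :: "nat \<Rightarrow> nat \<Rightarrow> bool"
  assumes graph: "simple_graph n E" and reg: "regular n E d"
    and n_pos: "0 < n" and d_pos: "0 < d" and K_pos: "0 < K"
    and lam_nonneg: "0 \<le> lam" and lam_le: "K * lam \<le> real d"
    and spread: "T \<subseteq> {..<n} \<Longrightarrow>
      (\<Sum>w<n. (real (card (nbrs E w \<inter> T)) - real d / real n * real (card T))\<^sup>2) \<le> lam\<^sup>2 * real (card T)"
begin

abbreviation "N \<equiv> nbrs E"
abbreviation "V \<equiv> {..<n}"
abbreviation "p \<equiv> real d / real n"

lemma N_sub: "N x \<subseteq> V" and N_sym: "y \<in> N x \<longleftrightarrow> x \<in> N y" and N_irrefl: "x \<notin> N x"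
  using graph by (auto simp: simple_graph_def nbrs_def)

lemma in_N: "y \<in> N x \<longleftrightarrow> E x y"
  by (simp add: nbrs_def)

lemma fin_N [simp]: "finite (N x)"
  using N_sub finite_subset by blast

lemma fin_sub: "A \<subseteq> V \<Longrightarrow> finite A"
  using finite_subset by blast

lemma card_N: "x \<in> V \<Longrightarrow> card (N x) = d"
proof -
  assume x: "x \<in> V"
  have "N x = {y. y < n \<and> E x y}"
    using N_sub by (auto simp: nbrs_def)
  then show ?thesis using x reg by (auto simp: regular_def)
qed

lemma d_less_n: "d < n"
proof -
  have "N 0 \<subseteq> V - {0}" using N_sub N_irrefl by auto
  then have "card (N 0) \<le> card (V - {0})" by (intro card_mono) auto
  then show ?thesis using n_pos card_N[of 0] by auto
qed

lemma card_sub: "A \<subseteq> V \<Longrightarrow> card A \<le> n"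
  using card_mono[of V A] by auto

lemma K_lam_sq: "K\<^sup>2 * lam\<^sup>2 \<le> (real d)\<^sup>2"
proof -
  have "(K * lam)\<^sup>2 \<le> (real d)\<^sup>2"
    using lam_le lam_nonneg K_pos by (intro power_mono) auto
  then show ?thesis by (simp add: power_mult_distrib)
qed

section \<open>Chebyshev-type consequences of \<open>spread\<close>\<close>

lemma few_deviant:
  assumes "A \<subseteq> V" "T \<subseteq> V" "0 \<le> g"
    and dev: "\<And>a. a \<in> A \<Longrightarrow> g \<le> \<bar>real (card (N a \<inter> T)) - p * real (card T)\<bar>"
  shows "real (card A) * g\<^sup>2 \<le> lam\<^sup>2 * real (card T)"
proof -
  have "real (card A) * g\<^sup>2 = (\<Sum>a\<in>A. g\<^sup>2)" by simp
  also have "\<dots> \<le> (\<Sum>a\<in>A. (real (card (N a \<inter> T)) - p * real (card T))\<^sup>2)"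
  proof (rule sum_mono)
    fix a assume "a \<in> A"
    from dev[OF this] have "g\<^sup>2 \<le> \<bar>real (card (N a \<inter> T)) - p * real (card T)\<bar>\<^sup>2"
      using assms(3) by (intro power_mono)
    then show "g\<^sup>2 \<le> (real (card (N a \<inter> T)) - p * real (card T))\<^sup>2" by simp
  qed
  also have "\<dots> \<le> (\<Sum>a<n. (real (card (N a \<inter> T)) - p * real (card T))\<^sup>2)"
    using assms(1) by (intro sum_mono2) auto
  also have "\<dots> \<le> lam\<^sup>2 * real (card T)"
    using spread[OF assms(2)] .
  finally show ?thesis .
qed

lemma few_deviant_K:
  assumes "A \<subseteq> V" "T \<subseteq> V" "0 \<le> g"
    and dev: "\<And>a. a \<in> A \<Longrightarrow> g * real d \<le> \<bar>real (card (N a \<inter> T)) - p * real (card T)\<bar>"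
  shows "real (card A) * (g * K)\<^sup>2 \<le> real (card T)"
proof -
  have "real (card A) * (g * real d)\<^sup>2 \<le> lam\<^sup>2 * real (card T)"
    using assms by (intro few_deviant) auto
  then have "K\<^sup>2 * (real (card A) * (g * real d)\<^sup>2) \<le> K\<^sup>2 * (lam\<^sup>2 * real (card T))"
    by (intro mult_left_mono) auto
  also have "\<dots> = (K\<^sup>2 * lam\<^sup>2) * real (card T)" by simp
  also have "\<dots> \<le> (real d)\<^sup>2 * real (card T)"
    using K_lam_sq by (intro mult_right_mono) auto
  finally have "(real d)\<^sup>2 * (real (card A) * (g * K)\<^sup>2) \<le> (real d)\<^sup>2 * real (card T)"
    by (simp add: power_mult_distrib algebra_simps)
  then show ?thesis using d_pos by (subst (asm) mult_le_cancel_left_pos) auto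
qed

text \<open>Cauchy-Schwarz with both set sizes bounded by \<open>n\<close>. This is wasteful for
  small sets, but it serves the dense case, where \<open>n / d\<close> is bounded and
  \<open>lam * n\<close> is a small multiple of \<open>d\<^sup>2\<close> once \<open>K\<close> is
  large.\<close>

lemma abs_deviation_sum:
  assumes "A \<subseteq> V" "T \<subseteq> V"
  shows "(\<Sum>a\<in>A. \<bar>real (card (N a \<inter> T)) - p * real (card T)\<bar>) \<le> lam * real n"
proof -
  have "(\<Sum>a\<in>A. \<bar>real (card (N a \<inter> T)) - p * real (card T)\<bar>)
    \<le> sqrt (real (card A) * (lam\<^sup>2 * real (card T)))"
  proof (rule sum_abs_le_sqrt)
    have "(\<Sum>a\<in>A. (real (card (N a \<inter> T)) - p * real (card T))\<^sup>2)
      \<le> (\<Sum>a<n. (real (card (N a \<inter> T)) - p * real (card T))\<^sup>2)"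
      using assms(1) by (intro sum_mono2) auto
    then show "(\<Sum>a\<in>A. (real (card (N a \<inter> T)) - p * real (card T))\<^sup>2) \<le> lam\<^sup>2 * real (card T)"
      using spread[OF assms(2)] by linarith
  qed (use assms fin_sub in auto)
  also have "\<dots> \<le> sqrt (real n * (lam\<^sup>2 * real n))"
    using card_sub[OF assms(1)] card_sub[OF assms(2)]
    by (intro real_sqrt_le_mono mult_mono mult_left_mono) auto
  also have "\<dots> = lam * real n"
  proof -
    have "real n * (lam\<^sup>2 * real n) = (lam * real n)\<^sup>2" by (simp add: power2_eq_square)
    then show ?thesis using lam_nonneg by simp
  qed
  finally show ?thesis .
qed

text \<open>A set \<open>T\<close> of density at most \<open>g / 2\<close> accounts for only
  \<open>g * d / 2\<close> neighbours of a typical vertex, so each \<open>a\<close> in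
  \<open>S\<close> deviates by at least that much, and few vertices can. Read backwards, confining
  many neighbours of \<open>S\<close> to a small \<open>T\<close> forces \<open>T\<close> to exceed
  \<open>S\<close> by the factor \<open>(g * K / 2)\<^sup>2\<close>.\<close>

lemma expansion:
  assumes "S \<subseteq> V" "T \<subseteq> V" "0 < g"
    and deg: "\<And>a. a \<in> S \<Longrightarrow> g * real d \<le> real (card (N a \<inter> T))"
    and small: "real (card T) \<le> g * real n / 2"
  shows "real (card S) * (g * K / 2)\<^sup>2 \<le> real (card T)"
proof -
  have "p * real (card T) \<le> p * (g * real n / 2)"
    using small by (intro mult_left_mono) auto
  also have "\<dots> = g / 2 * real d" using n_pos by simp
  finally have *: "p * real (card T) \<le> g / 2 * real d" .
  have "real (card S) * (g / 2 * K)\<^sup>2 \<le> real (card T)"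
  proof (rule few_deviant_K)
    fix a assume "a \<in> S"
    from deg[OF this] * have "g / 2 * real d \<le> real (card (N a \<inter> T)) - p * real (card T)"
      by simp
    then show "g / 2 * real d \<le> \<bar>real (card (N a \<inter> T)) - p * real (card T)\<bar>"
      by linarith
  qed (use assms in auto)
  then show ?thesis by (simp add: mult.commute)
qed

text \<open>The lower-tail companion of \<open>expansion\<close>: density predicts at least
  \<open>s * d\<close> neighbours in \<open>X\<close>, and a poor vertex has at most half of
  them.\<close>

lemma few_poor:
  assumes "A \<subseteq> V" "X \<subseteq> V" "0 < s" and X: "s * real n \<le> real (card X)"
    and poor: "\<And>a. a \<in> A \<Longrightarrow> real (card (N a \<inter> X)) \<le> s * real d / 2"
  shows "real (card A) * (s * K / 2)\<^sup>2 \<le> real n"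
proof -
  have "p * (s * real n) \<le> p * real (card X)"
    using X by (intro mult_left_mono) auto
  moreover have "p * (s * real n) = s * real d" using n_pos by (simp add: field_simps)
  ultimately have *: "s * real d \<le> p * real (card X)" by simp
  have "real (card A) * (s / 2 * K)\<^sup>2 \<le> real (card X)"
  proof (rule few_deviant_K)
    fix a assume "a \<in> A"
    from poor[OF this] * have "s / 2 * real d \<le> p * real (card X) - real (card (N a \<inter> X))"
      by linarith
    then show "s / 2 * real d \<le> \<bar>real (card (N a \<inter> X)) - p * real (card X)\<bar>"
      by linarith
  qed (use assms in auto)
  then show ?thesis using card_sub[OF assms(2)] by (simp add: mult.commute)
qed

text \<open>Vertices with at least \<open>g * d\<close> neighbours in the current set are added to
  \<open>base\<close>. Expansion by a factor of two limits the added part \<open>A\<close>, because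
  it yields \<open>2 * card A \<le> card base + card A\<close>.\<close>

lemma small_closure:
  assumes base: "base \<subseteq> V" and g: "0 < g" and K: "2 \<le> (g * K / 2)\<^sup>2"
    and small: "2 * real (card base) + 1 \<le> g * real n / 2"
  shows "\<exists>Z. base \<subseteq> Z \<and> Z \<subseteq> V \<and> card Z \<le> 2 * card base \<and>
    (\<forall>w\<in>V - Z. real (card (N w \<inter> Z)) < g * real d)"
proof -
  \<comment> \<open>The bound \<open>card base + 1\<close> leaves room for one vertex more than
    expansion permits, so that a further eligible \<open>w\<close> produces a larger good set and
    contradicts maximality.\<close>
  define good where "good A \<longleftrightarrow> A \<subseteq> V - base \<and> card A \<le> card base + 1 \<and>
      (\<forall>a\<in>A. g * real d \<le> real (card (N a \<inter> (base \<union> A))))" for A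
  have fb: "finite base" using base fin_sub by auto
  have "good {}" by (simp add: good_def)
  moreover have "\<forall>A. good A \<longrightarrow> card A < card base + 2" by (simp add: good_def)
  ultimately obtain A where A: "good A" and max: "\<And>A'. good A' \<Longrightarrow> card A' \<le> card A"
    using ex_has_greatest_nat[of good "{}" card "card base + 2"] by blast
  have AV: "A \<subseteq> V - base" and fA: "finite A" using A fin_sub unfolding good_def by auto
  define Z where "Z = base \<union> A"
  have ZV: "Z \<subseteq> V" using base AV by (auto simp: Z_def)
  have cZ: "card Z = card base + card A"
    unfolding Z_def using fb fA AV by (intro card_Un_disjoint) auto
  have cA: "card A \<le> card base"
  proof -
    have "real (card A) * (g * K / 2)\<^sup>2 \<le> real (card Z)"
    proof (rule expansion)
      show "real (card Z) \<le> g * real n / 2"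
        using small cZ A by (simp add: good_def)
    qed (use A AV ZV g in \<open>auto simp: good_def Z_def\<close>)
    moreover have "real (card A) * 2 \<le> real (card A) * (g * K / 2)\<^sup>2"
      using K by (intro mult_left_mono) auto
    ultimately show ?thesis using cZ by simp
  qed
  have "real (card (N w \<inter> Z)) < g * real d" if w: "w \<in> V - Z" for w
  proof (rule ccontr)
    assume *: "\<not> ?thesis"
    have "good (insert w A)"
      unfolding good_def
    proof (intro conjI ballI)
      show "insert w A \<subseteq> V - base" using w AV by (auto simp: Z_def)
      show "card (insert w A) \<le> card base + 1" using cA fA w by (simp add: card_insert_if)
      fix a assume a: "a \<in> insert w A"
      have "g * real d \<le> real (card (N a \<inter> Z))"
        using a * A by (auto simp: good_def Z_def)
      also have "\<dots> \<le> real (card (N a \<inter> (base \<union> insert w A)))"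
        unfolding of_nat_le_iff by (rule card_mono) (auto simp: Z_def)
      finally show "g * real d \<le> real (card (N a \<inter> (base \<union> insert w A)))" .
    qed
    from max[OF this] show False using fA w by (auto simp: Z_def)
  qed
  then show ?thesis using ZV cZ cA by (intro exI[of _ Z]) (auto simp: Z_def)
qed

end

section \<open>From eigenvalues to edge distribution\<close>

definition adj :: "(nat \<Rightarrow> nat \<Rightarrow> bool) \<Rightarrow> nat \<Rightarrow> nat \<Rightarrow> real" where
  "adj E i j = (if E i j then 1 else 0)"

primrec walks :: "nat \<Rightarrow> (nat \<Rightarrow> nat \<Rightarrow> bool) \<Rightarrow> nat \<Rightarrow> nat \<Rightarrow> nat \<Rightarrow> real" where
  "walks n E 0 i j = (if i = j then 1 else 0)"
| "walks n E (Suc k) i j = (\<Sum>l<n. walks n E k i l * adj E l j)"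

lemma walks_add:
  "i < n \<Longrightarrow> j < n \<Longrightarrow> walks n E (k + m) i j = (\<Sum>l<n. walks n E k i l * walks n E m l j)"
proof (induction m arbitrary: j)
  case 0
  have "(\<Sum>l<n. walks n E k i l * (if l = j then 1 else 0)) = (\<Sum>l<n. if l = j then walks n E k i l else 0)"
    by (rule sum.cong) auto
  then show ?case using 0 by simp
next
  case (Suc m)
  have "walks n E (k + Suc m) i j = (\<Sum>s<n. (\<Sum>l<n. walks n E k i l * walks n E m l s) * adj E s j)"
    using Suc by simp
  also have "\<dots> = (\<Sum>s<n. \<Sum>l<n. walks n E k i l * (walks n E m l s * adj E s j))"
    by (simp add: sum_distrib_right mult.assoc)
  also have "\<dots> = (\<Sum>l<n. walks n E k i l * (\<Sum>s<n. walks n E m l s * adj E s j))"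
    by (subst sum.swap) (simp add: sum_distrib_left)
  finally show ?case by simp
qed

lemma walks_1: "i < n \<Longrightarrow> walks n E (Suc 0) i j = adj E i j"
proof -
  assume "i < n"
  have "(\<Sum>l<n. (if i = l then 1 else 0) * adj E l j) = (\<Sum>l<n. if i = l then adj E l j else 0)"
    by (rule sum.cong) auto
  then show ?thesis using \<open>i < n\<close> by simp
qed

lemma walks_Suc_left:
  assumes "i < n" "j < n"
  shows "walks n E (Suc k) i j = (\<Sum>l<n. adj E i l * walks n E k l j)"
  using walks_add[OF assms, of E "Suc 0" k] assms(1) by (simp add: walks_1 del: walks.simps)

lemma walks_sym:
  assumes "\<And>x y. E x y = E y x"
  shows "i < n \<Longrightarrow> j < n \<Longrightarrow> walks n E k i j = walks n E k j i"
proof (induction k arbitrary: i j)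
  case (Suc k)
  have "walks n E (Suc k) i j = (\<Sum>l<n. adj E i l * walks n E k l j)"
    using Suc.prems by (rule walks_Suc_left)
  also have "\<dots> = (\<Sum>l<n. walks n E k j l * adj E l i)"
    using Suc assms by (intro sum.cong) (auto simp: adj_def)
  finally show ?case by simp
qed simp

lemma sum_adj:
  assumes "simple_graph n E" "regular n E d" "i < n"
  shows "(\<Sum>j<n. adj E i j) = real d"
proof -
  have "(\<Sum>j<n. adj E i j) = real (card {j. j < n \<and> E i j})"
    by (simp add: adj_def sum.If_cases Int_def lessThan_def)
  then show ?thesis using assms by (simp add: regular_def)
qed

lemma walks_row_sum:
  assumes "simple_graph n E" "regular n E d"
  shows "i < n \<Longrightarrow> (\<Sum>j<n. walks n E k i j) = real d ^ k"
proof (induction k)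
  case (Suc k)
  have "(\<Sum>j<n. walks n E (Suc k) i j) = (\<Sum>l<n. walks n E k i l * (\<Sum>j<n. adj E l j))"
    by (simp add: sum_distrib_left) (rule sum.swap)
  also have "\<dots> = (\<Sum>l<n. walks n E k i l * real d)"
    using sum_adj[OF assms] by (intro sum.cong) auto
  also have "\<dots> = (\<Sum>l<n. walks n E k i l) * real d"
    by (simp add: sum_distrib_right)
  finally show ?case using Suc by simp
qed simp

lemma adj_matrix_pow:
  "i < n \<Longrightarrow> j < n \<Longrightarrow> (adj_matrix n E ^\<^sub>m k) $$ (i, j) = complex_of_real (walks n E k i j)"
proof (induction k arbitrary: j)
  case 0
  then show ?case by (simp add: adj_matrix_def)
next
  case (Suc k)
  have c: "adj_matrix n E \<in> carrier_mat n n" by (simp add: adj_matrix_def)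
  then have ck: "adj_matrix n E ^\<^sub>m k \<in> carrier_mat n n" by simp
  have "(adj_matrix n E ^\<^sub>m Suc k) $$ (i, j) =
     (\<Sum>l\<in>{0..<n}. (adj_matrix n E ^\<^sub>m k) $$ (i, l) * adj_matrix n E $$ (l, j))"
    using Suc.prems c ck by (simp add: scalar_prod_def)
  also have "\<dots> = (\<Sum>l\<in>{0..<n}. complex_of_real (walks n E k i l * adj E l j))"
    using Suc by (intro sum.cong) (auto simp: adj_matrix_def adj_def)
  finally show ?case by (simp add: lessThan_atLeast0)
qed

lemma trace_mult_comm:
  fixes A B :: "'a :: comm_ring_1 mat"
  assumes A: "A \<in> carrier_mat n n" and B: "B \<in> carrier_mat n n"
  shows "(\<Sum>i<n. (A * B) $$ (i, i)) = (\<Sum>i<n. (B * A) $$ (i, i))"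
proof -
  have AB: "(\<Sum>i<n. (A * B) $$ (i, i)) = (\<Sum>i<n. \<Sum>l<n. A $$ (i, l) * B $$ (l, i))"
    if "A \<in> carrier_mat n n" "B \<in> carrier_mat n n" for A B :: "'a mat"
    using that by (intro sum.cong) (auto simp: scalar_prod_def lessThan_atLeast0)
  show ?thesis
    unfolding AB[OF A B] AB[OF B A] by (subst sum.swap) (simp add: mult.commute)
qed

lemma upper_triangular_pow_entries:
  fixes B :: "'a :: comm_ring_1 mat"
  assumes B: "B \<in> carrier_mat n n" and u: "upper_triangular B" and i: "i < n"
  shows "j < i \<Longrightarrow> (B ^\<^sub>m k) $$ (i, j) = 0" and "(B ^\<^sub>m k) $$ (i, i) = (B $$ (i, i)) ^ k"
proof -
  have z: "B $$ (l, j) = 0" if "j < l" "l < n" for l j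
    using u that B unfolding upper_triangular_def by auto
  have ck: "B ^\<^sub>m k \<in> carrier_mat n n" for k using B by simp
  have step: "(B ^\<^sub>m Suc k) $$ (i, j) = (\<Sum>l\<in>{0..<n}. (B ^\<^sub>m k) $$ (i, l) * B $$ (l, j))"
    if "j < n" for k j
    using i that B ck[of k] by (simp add: scalar_prod_def)
  have *: "(\<forall>j<i. (B ^\<^sub>m k) $$ (i, j) = 0) \<and> (B ^\<^sub>m k) $$ (i, i) = (B $$ (i, i)) ^ k"
  proof (induction k)
    case 0
    then show ?case using B i by auto
  next
    case (Suc k)
    have "(B ^\<^sub>m Suc k) $$ (i, j) = 0" if j: "j < i" for j
    proof -
      have "j < n" using j i by simp
      have "(B ^\<^sub>m k) $$ (i, l) * B $$ (l, j) = 0" if "l \<in> {0..<n}" for l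
        using Suc z[of j l] j that by (cases "l < i") auto
      then show ?thesis unfolding step[OF \<open>j < n\<close>] by (intro sum.neutral) blast
    qed
    moreover have "(B ^\<^sub>m Suc k) $$ (i, i) = (B $$ (i, i)) ^ Suc k"
    proof -
      have "(\<Sum>l\<in>{0..<n}. (B ^\<^sub>m k) $$ (i, l) * B $$ (l, i)) = (\<Sum>l\<in>{0..<n}. if l = i then (B $$ (i, i)) ^ Suc k else 0)"
      proof (rule sum.cong)
        fix l assume l: "l \<in> {0..<n}"
        consider "l < i" | "l = i" | "i < l" by linarith
        then show "(B ^\<^sub>m k) $$ (i, l) * B $$ (l, i) = (if l = i then (B $$ (i, i)) ^ Suc k else 0)"
          by cases (use Suc z[of i l] l in auto)
      qed simp
      then show ?thesis unfolding step[OF i] using i by simp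
    qed
    ultimately show ?case by blast
  qed
  from * show "j < i \<Longrightarrow> (B ^\<^sub>m k) $$ (i, j) = 0" and "(B ^\<^sub>m k) $$ (i, i) = (B $$ (i, i)) ^ k"
    by blast+
qed

text \<open>Schur triangularisation: the adjacency matrix is similar to an upper triangular
  \<open>B\<close> whose diagonal lists the eigenvalues with multiplicity. The diagonal of
  \<open>B ^\<^sub>m k\<close> lists their powers, and the trace is invariant under
  similarity.\<close>

lemma adj_eigenvalues_trace:
  "size (adj_eigenvalues n E) = n"
  "complex_of_real (\<Sum>i<n. walks n E k i i) = (\<Sum>\<mu>\<in>#adj_eigenvalues n E. \<mu> ^ k)"
proof -
  define A where "A = adj_matrix n E"
  have A: "A \<in> carrier_mat n n" by (simp add: A_def adj_matrix_def)
  obtain es where es: "char_poly A = (\<Prod>a\<leftarrow>es. [:- a, 1:])" "length es = n"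
    using char_poly_factorized[OF A] by auto
  have "proots (char_poly A) = sum_list (map proots (map (\<lambda>a. [:- a, 1:]) es))"
  proof -
    have nz: "[:- a, 1:] \<noteq> (0 :: complex poly)" for a by simp
    have "0 \<notin> set (map (\<lambda>a. [:- a, 1 :: complex:]) es)"
    proof
      assume "0 \<in> set (map (\<lambda>a. [:- a, 1 :: complex:]) es)"
      then obtain a where "(0 :: complex poly) = [:- a, 1:]" unfolding set_map by (elim imageE)
      from this[symmetric] show False using nz by (rule notE[rotated])
    qed
    from proots_prod_list[OF this] show ?thesis unfolding es(1) by simp
  qed
  also have "\<dots> = mset es" by (induction es) auto
  finally have mes: "adj_eigenvalues n E = mset es" by (simp add: adj_eigenvalues_def A_def)
  then show "size (adj_eigenvalues n E) = n" using es by simp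
  obtain B P Q where S: "schur_decomposition A es = (B, P, Q)" by (cases "schur_decomposition A es") auto
  from schur_decomposition[OF A es(1) S]
  have wit: "similar_mat_wit A B P Q" and u: "upper_triangular B" and dg: "diag_mat B = es" by auto
  have dimn: "n = dim_row A" using A by simp
  have n: "n = dim_row (A ^\<^sub>m k)" using A by simp
  note w = similar_mat_witD[OF n similar_mat_wit_pow[OF wit, of k]]
  have B: "B \<in> carrier_mat n n" using similar_mat_witD[OF dimn wit] by simp
  have "complex_of_real (\<Sum>i<n. walks n E k i i) = (\<Sum>i<n. (A ^\<^sub>m k) $$ (i, i))"
    by (simp add: A_def adj_matrix_pow)
  also have "\<dots> = (\<Sum>i<n. (P * (B ^\<^sub>m k * Q)) $$ (i, i))"
    unfolding w(3) using assoc_mult_mat[OF w(6) w(5) w(7)] by simp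
  also have "\<dots> = (\<Sum>i<n. ((B ^\<^sub>m k * Q) * P) $$ (i, i))"
    using w by (intro trace_mult_comm) (auto intro: mult_carrier_mat)
  also have "\<dots> = (\<Sum>i<n. (B ^\<^sub>m k) $$ (i, i))"
  proof -
    have "(B ^\<^sub>m k * Q) * P = B ^\<^sub>m k * (Q * P)" using w by (intro assoc_mult_mat) auto
    also have "\<dots> = B ^\<^sub>m k" unfolding w(2) by (rule right_mult_one_mat[OF w(5)])
    finally show ?thesis by simp
  qed
  also have "\<dots> = (\<Sum>i<n. (B $$ (i, i)) ^ k)"
    using upper_triangular_pow_entries(2)[OF B u] by (intro sum.cong) auto
  also have "\<dots> = sum_list (map (\<lambda>e. e ^ k) (diag_mat B))"
    using B by (simp add: diag_mat_def o_def sum_list_distinct_conv_sum_set lessThan_atLeast0)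
  also have "\<dots> = (\<Sum>\<mu>\<in>#adj_eigenvalues n E. \<mu> ^ k)"
    unfolding mes dg by (simp add: sum_mset_sum_list[symmetric])
  finally show "complex_of_real (\<Sum>i<n. walks n E k i i) = (\<Sum>\<mu>\<in>#adj_eigenvalues n E. \<mu> ^ k)" .
qed

text \<open>The all-ones vector is an eigenvector.\<close>

lemma degree_in_adj_eigenvalues:
  assumes "simple_graph n E" "regular n E d" "0 < n"
  shows "complex_of_real (real d) \<in># adj_eigenvalues n E"
proof -
  define A where "A = adj_matrix n E"
  have A: "A \<in> carrier_mat n n" by (simp add: A_def adj_matrix_def)
  define v :: "complex vec" where "v = vec n (\<lambda>_. 1)"
  have "A *\<^sub>v v = complex_of_real (real d) \<cdot>\<^sub>v v"
  proof (rule eq_vecI)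
    fix i assume "i < dim_vec (complex_of_real (real d) \<cdot>\<^sub>v v)"
    then have i: "i < n" by (simp add: v_def)
    have "(A *\<^sub>v v) $ i = (\<Sum>j\<in>{0..<n}. complex_of_real (adj E i j))"
      using i by (simp add: A_def adj_matrix_def v_def scalar_prod_def adj_def) (rule sum.cong; simp)
    also have "\<dots> = complex_of_real (\<Sum>j<n. adj E i j)" by (simp add: lessThan_atLeast0)
    also have "\<dots> = complex_of_real (real d)" using sum_adj[OF assms(1,2) i] by simp
    finally show "(A *\<^sub>v v) $ i = (complex_of_real (real d) \<cdot>\<^sub>v v) $ i" using i by (simp add: v_def)
  qed (use A in \<open>simp add: v_def\<close>)
  moreover have "v \<noteq> 0\<^sub>v n"
  proof
    assume "v = 0\<^sub>v n"
    then have "v $ 0 = 0\<^sub>v n $ 0" by simp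
    then show False using assms(3) by (simp add: v_def)
  qed
  moreover have "v \<in> carrier_vec n" by (simp add: v_def)
  ultimately have "eigenvalue A (complex_of_real (real d))"
    unfolding eigenvalue_def eigenvector_def using A by (intro exI[of _ v]) auto
  then have "poly (char_poly A) (complex_of_real (real d)) = 0"
    using eigenvalue_root_char_poly[OF A] by simp
  moreover have "char_poly A \<noteq> 0"
    using degree_monic_char_poly[OF A] by auto
  ultimately show ?thesis by (simp add: adj_eigenvalues_def A_def)
qed

text \<open>Every eigenvalue except the top one contributes at most
  \<open>\<bar>lam\<bar> ^ k\<close>. The absolute value covers \<open>n = 1\<close>, where no
  second eigenvalue forces \<open>lam\<close> to be nonnegative.\<close>

lemma trace_bound:
  assumes ndl: "ndl_graph n d lam E" and lam: "lam < real d" and n: "0 < n"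
  shows "\<bar>(\<Sum>i<n. walks n E k i i) - real d ^ k\<bar> \<le> real n * \<bar>lam\<bar> ^ k"
proof -
  from ndl obtain \<mu> where \<mu>: "\<mu> \<in># adj_eigenvalues n E"
    and rest: "\<forall>\<nu>\<in>#adj_eigenvalues n E - {#\<mu>#}. cmod \<nu> \<le> lam"
    and g: "simple_graph n E" "regular n E d"
    unfolding ndl_graph_def by auto
  define M where "M = adj_eigenvalues n E - {#\<mu>#}"
  have eq: "adj_eigenvalues n E = add_mset \<mu> M" using \<mu> by (simp add: M_def)
  \<comment> \<open>The exceptional eigenvalue must be \<open>d\<close>; otherwise \<open>d\<close>
    would remain among those bounded by \<open>lam\<close>.\<close>
  have "\<mu> = complex_of_real (real d)"
  proof (rule ccontr)
    assume "\<not> ?thesis"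
    then have "complex_of_real (real d) \<in># M"
      using degree_in_adj_eigenvalues[OF g n] eq by auto
    then have "cmod (complex_of_real (real d)) \<le> lam" using rest by (auto simp: M_def)
    then show False using lam by simp
  qed
  then have "complex_of_real ((\<Sum>i<n. walks n E k i i) - real d ^ k) = (\<Sum>\<nu>\<in>#M. \<nu> ^ k)"
    using adj_eigenvalues_trace(2)[of n E k] eq by simp
  then have "\<bar>(\<Sum>i<n. walks n E k i i) - real d ^ k\<bar> = cmod (\<Sum>\<nu>\<in>#M. \<nu> ^ k)"
    by (metis norm_of_real)
  also have "\<dots> \<le> (\<Sum>\<nu>\<in>#M. \<bar>lam\<bar> ^ k)"
  proof -
    have "\<forall>\<nu>\<in>#M. cmod \<nu> \<le> \<bar>lam\<bar>" using rest by (fastforce simp: M_def)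
    then show ?thesis
    proof (induction M)
      case (add x M)
      have "cmod (\<Sum>\<nu>\<in>#add_mset x M. \<nu> ^ k) \<le> cmod (x ^ k) + cmod (\<Sum>\<nu>\<in>#M. \<nu> ^ k)"
        by (simp add: norm_triangle_ineq)
      moreover have "cmod (x ^ k) \<le> \<bar>lam\<bar> ^ k" using add.prems by (simp add: norm_power power_mono)
      ultimately show ?case using add by simp
    qed simp
  qed
  also have "\<dots> = real (size M) * \<bar>lam\<bar> ^ k" by simp
  also have "\<dots> \<le> real n * \<bar>lam\<bar> ^ k"
    using adj_eigenvalues_trace(1)[of n E] eq by (intro mult_right_mono) auto
  finally show ?thesis .
qed

text \<open>The constant \<open>c\<close> disappears on taking \<open>k\<close>-th roots.\<close>

lemma power_bound_imp_le:
  fixes r s :: real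
  assumes "\<And>k. r ^ k \<le> c * s ^ k" "0 \<le> s"
  shows "r \<le> s"
proof (rule ccontr)
  assume "\<not> ?thesis"
  then have rs: "s < r" by simp
  show False
  proof (cases "s = 0")
    case True
    then show ?thesis using assms(1)[of 1] rs by simp
  next
    case False
    then have s: "0 < s" using assms by simp
    then have "1 < r / s" using rs by simp
    then obtain k where "c < (r / s) ^ k" using real_arch_pow by blast
    then have "c * s ^ k < r ^ k" using s by (simp add: power_divide field_simps)
    then show False using assms(1)[of k] by simp
  qed
qed

text \<open>\<open>s k\<close> is the squared norm of the \<open>k\<close>-th power applied to the
  centred indicator \<open>f\<close>. The trace bounds it only up to a factor \<open>n\<close>. But
  log-convexity makes the ratios \<open>s (Suc k) / s k\<close> nondecreasing, so the first ratio
  \<open>r\<close> satisfies \<open>r ^ k \<le> n * (lam\<^sup>2) ^ k\<close> for every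
  \<open>k\<close>, and the factor \<open>n\<close> vanishes in the limit.\<close>

lemma ndl_spread:
  assumes ndl: "ndl_graph n d lam E" and lam: "lam < real d" and n: "0 < n" and T: "T \<subseteq> {..<n}"
  shows "(\<Sum>w<n. (real (card (nbrs E w \<inter> T)) - real d / real n * real (card T))\<^sup>2) \<le> lam\<^sup>2 * real (card T)"
proof -
  from ndl have g: "simple_graph n E" "regular n E d" unfolding ndl_graph_def by auto
  have Esym: "E x y = E y x" for x y using g by (auto simp: simple_graph_def)
  define t where "t = real (card T) / real n"
  define f where "f j = (if j \<in> T then 1 else 0) - t" for j
  have fT: "finite T" using T finite_subset by blast
  have sumf: "(\<Sum>j<n. f j) = 0"
  proof -
    have "(\<Sum>j<n. if j \<in> T then 1 else 0) = real (card T)"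
      using T by (simp add: sum.If_cases Int_absorb1)
    then show ?thesis using n by (simp add: f_def sum_subtractf t_def)
  qed
  have sumf2: "(\<Sum>j<n. (f j)\<^sup>2) \<le> real (card T)"
  proof -
    have "(\<Sum>j<n. (f j)\<^sup>2) = (\<Sum>j<n. (if j \<in> T then 1 else 0) * (1 - 2 * t) + t\<^sup>2)"
      by (rule sum.cong) (auto simp: f_def power2_eq_square algebra_simps)
    also have "\<dots> = real (card T) * (1 - 2 * t) + real n * t\<^sup>2"
      using T by (simp add: sum.distrib sum_distrib_right[symmetric] sum.If_cases Int_absorb1)
    also have "\<dots> = real (card T) - real (card T) * t"
      using n by (simp add: t_def power2_eq_square algebra_simps)
    also have "\<dots> \<le> real (card T)" by (simp add: t_def)
    finally show ?thesis .
  qed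
  define F where "F k i = (\<Sum>j<n. walks n E k i j * f j)" for k i
  define s where "s k = (\<Sum>i<n. (F k i)\<^sup>2)" for k
  have s_nonneg: "0 \<le> s k" for k unfolding s_def by (intro sum_nonneg) auto
  have F0: "F 0 i = f i" if "i < n" for i
  proof -
    have "F 0 i = (\<Sum>j<n. if i = j then f j else 0)" unfolding F_def by (rule sum.cong) auto
    then show ?thesis using that by simp
  qed
  have FSuc: "F (Suc k) i = (\<Sum>l<n. adj E i l * F k l)" if "i < n" for k i
  proof -
    have "F (Suc k) i = (\<Sum>j<n. (\<Sum>l<n. adj E i l * walks n E k l j) * f j)"
      unfolding F_def using walks_Suc_left[OF that] by (intro sum.cong) auto
    also have "\<dots> = (\<Sum>j<n. \<Sum>l<n. adj E i l * (walks n E k l j * f j))"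
      by (simp add: sum_distrib_right mult.assoc)
    also have "\<dots> = (\<Sum>l<n. adj E i l * F k l)"
      by (subst sum.swap) (simp add: F_def sum_distrib_left)
    finally show ?thesis .
  qed
  \<comment> \<open>Self-adjointness moves one adjacency factor across the inner product:
    \<open>s (Suc k)\<close> is the inner product of \<open>F k\<close> and
    \<open>F (Suc (Suc k))\<close>, to which Cauchy-Schwarz applies.\<close>
  have conv: "(s (Suc k))\<^sup>2 \<le> s k * s (Suc (Suc k))" for k
  proof -
    have "s (Suc k) = (\<Sum>i<n. (\<Sum>l<n. adj E i l * F k l) * F (Suc k) i)"
      unfolding s_def power2_eq_square by (rule sum.cong) (auto simp: FSuc)
    also have "\<dots> = (\<Sum>i<n. \<Sum>l<n. F k l * (adj E l i * F (Suc k) i))"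
    proof (rule sum.cong)
      fix i
      have "adj E i l = adj E l i" for l using Esym[of i l] by (simp add: adj_def)
      then show "(\<Sum>l<n. adj E i l * F k l) * F (Suc k) i = (\<Sum>l<n. F k l * (adj E l i * F (Suc k) i))"
        by (simp add: sum_distrib_left mult_ac)
    qed simp
    also have "\<dots> = (\<Sum>l<n. F k l * (\<Sum>i<n. adj E l i * F (Suc k) i))"
      by (subst sum.swap) (simp add: sum_distrib_left)
    also have "\<dots> = (\<Sum>l<n. F k l * F (Suc (Suc k)) l)"
      by (rule sum.cong) (auto simp: FSuc)
    finally show ?thesis
      using sum_product_sq_le[of "{..<n}" "F k" "F (Suc (Suc k))"] by (simp add: s_def)
  qed
  have upper: "s k \<le> real n * (lam\<^sup>2) ^ k * s 0" for k
  proof -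
    \<comment> \<open>The constant entry of the part of the \<open>k\<close>-th power that acts on
      constant vectors. As \<open>f\<close> sums to zero, subtracting \<open>c\<close> does not
      change \<open>F k i\<close>, but it removes the top eigenvalue's contribution
      \<open>d ^ (2 * k)\<close> from the trace.\<close>
    define c where "c = real d ^ k / real n"
    have "(F k i)\<^sup>2 \<le> (\<Sum>j<n. (walks n E k i j - c)\<^sup>2) * s 0" if i: "i < n" for i
    proof -
      have "F k i = (\<Sum>j<n. (walks n E k i j - c) * f j)"
        using sumf by (simp add: F_def left_diff_distrib sum_subtractf sum_distrib_left[symmetric])
      moreover have "s 0 = (\<Sum>j<n. (f j)\<^sup>2)" unfolding s_def using F0 by (intro sum.cong) auto
      ultimately show ?thesis using sum_product_sq_le[of "{..<n}"] by simp
    qed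
    then have "s k \<le> (\<Sum>i<n. (\<Sum>j<n. (walks n E k i j - c)\<^sup>2) * s 0)"
      unfolding s_def[of k] by (intro sum_mono) auto
    also have "\<dots> = (\<Sum>i<n. \<Sum>j<n. (walks n E k i j - c)\<^sup>2) * s 0"
      by (simp add: sum_distrib_right)
    \<comment> \<open>The squared Frobenius norm of the \<open>k\<close>-th power after subtracting
      \<open>c\<close> from each entry; by symmetry the sum of squared walk counts is a trace of the
      power \<open>2 * k\<close>.\<close>
    also have "(\<Sum>i<n. \<Sum>j<n. (walks n E k i j - c)\<^sup>2) = (\<Sum>i<n. walks n E (2 * k) i i) - real d ^ (2 * k)"
    proof -
      have "(\<Sum>j<n. (walks n E k i j - c)\<^sup>2) = walks n E (2 * k) i i - 2 * c * real d ^ k + real n * c\<^sup>2"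
        if i: "i < n" for i
      proof -
        have "(\<Sum>j<n. (walks n E k i j - c)\<^sup>2)
          = (\<Sum>j<n. walks n E k i j * walks n E k i j - 2 * c * walks n E k i j + c\<^sup>2)"
          by (rule sum.cong) (auto simp: power2_eq_square algebra_simps)
        also have "\<dots> = (\<Sum>j<n. walks n E k i j * walks n E k i j) - 2 * c * (\<Sum>j<n. walks n E k i j) + real n * c\<^sup>2"
          by (simp add: sum.distrib sum_subtractf sum_distrib_left)
        also have "(\<Sum>j<n. walks n E k i j * walks n E k i j) = (\<Sum>j<n. walks n E k i j * walks n E k j i)"
          using walks_sym[OF Esym] i by (intro sum.cong) auto
        also have "\<dots> = walks n E (2 * k) i i"
          using walks_add[OF i i, of E k k] by (simp add: mult_2)
        finally show ?thesis using walks_row_sum[OF g i] by simp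
      qed
      then have "(\<Sum>i<n. \<Sum>j<n. (walks n E k i j - c)\<^sup>2)
        = (\<Sum>i<n. walks n E (2 * k) i i - 2 * c * real d ^ k + real n * c\<^sup>2)"
        by (intro sum.cong) auto
      also have "\<dots> = (\<Sum>i<n. walks n E (2 * k) i i) + real n * (real n * c\<^sup>2 - 2 * c * real d ^ k)"
        by (simp add: sum.distrib sum_subtractf algebra_simps)
      also have "real n * (real n * c\<^sup>2 - 2 * c * real d ^ k) = - (real d ^ (2 * k))"
      proof -
        have nc: "real n * c = real d ^ k" using n by (simp add: c_def)
        have dd: "real d ^ (2 * k) = real d ^ k * real d ^ k" by (simp add: mult_2 power_add)
        have e: "real n * (real n * c\<^sup>2 - 2 * c * real d ^ k) = (real n * c) * (real n * c) - 2 * (real n * c) * real d ^ k"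
          by (simp add: power2_eq_square right_diff_distrib)
        have "x * x - 2 * x * x = - (x * x)" for x :: real by simp
        then show ?thesis unfolding e nc dd by blast
      qed
      finally show ?thesis by (simp only: diff_conv_add_uminus)
    qed
    also have "\<dots> * s 0 \<le> (real n * \<bar>lam\<bar> ^ (2 * k)) * s 0"
    proof (rule mult_right_mono[OF _ s_nonneg])
      show "(\<Sum>i<n. walks n E (2 * k) i i) - real d ^ (2 * k) \<le> real n * \<bar>lam\<bar> ^ (2 * k)"
        using trace_bound[OF ndl lam n, of "2 * k"] by (rule order_trans[OF abs_ge_self])
    qed
    finally show ?thesis by (simp only: power_mult power2_abs)
  qed
  have main: "s 1 \<le> lam\<^sup>2 * s 0"
  proof (cases "s 0 = 0 \<or> s 1 = 0")
    case True
    then show ?thesis using upper[of 1] s_nonneg[of 0] by auto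
  next
    case False
    then have s0: "0 < s 0" and s1: "0 < s 1" using s_nonneg[of 0] s_nonneg[of 1] by auto
    define r where "r = s 1 / s 0"
    have r: "0 < r" using s0 s1 by (simp add: r_def)
    have grow: "0 < s k \<and> r * s k \<le> s (Suc k)" for k
    proof (induction k)
      case 0
      then show ?case using s0 by (simp add: r_def)
    next
      case (Suc k)
      have pos: "0 < s (Suc k)" using Suc r by (meson less_le_trans mult_pos_pos)
      have "(r * s k) * s (Suc k) \<le> s (Suc k) * s (Suc k)"
        using Suc pos by (intro mult_right_mono) auto
      also have "\<dots> \<le> s k * s (Suc (Suc k))" using conv[of k] by (simp add: power2_eq_square)
      finally have "s k * (r * s (Suc k)) \<le> s k * s (Suc (Suc k))" by (simp add: mult_ac)
      then show ?case using Suc pos by simp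
    qed
    have low: "r ^ k * s 0 \<le> s k" for k
    proof (induction k)
      case (Suc k)
      have "r ^ Suc k * s 0 \<le> r * s k" using Suc r by simp
      then show ?case using grow[of k] by linarith
    qed simp
    have "r \<le> lam\<^sup>2"
    proof (rule power_bound_imp_le)
      fix k
      have "r ^ k * s 0 \<le> (real n * (lam\<^sup>2) ^ k) * s 0" using low[of k] upper[of k] by linarith
      then show "r ^ k \<le> real n * (lam\<^sup>2) ^ k" using s0 by simp
    qed simp
    then show ?thesis using s0 by (simp add: r_def field_simps)
  qed
  have "F 1 w = real (card (nbrs E w \<inter> T)) - real d / real n * real (card T)" if w: "w < n" for w
  proof -
    have "F 1 w = (\<Sum>l<n. adj E w l * f l)"
      unfolding One_nat_def FSuc[OF w] by (rule sum.cong) (auto simp: F0)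
    also have "\<dots> = (\<Sum>l<n. (if l \<in> nbrs E w \<inter> T then 1 else 0)) - (\<Sum>l<n. adj E w l) * t"
      unfolding f_def sum_distrib_right sum_subtractf[symmetric]
      by (rule sum.cong) (auto simp: adj_def nbrs_def)
    also have "(\<Sum>l<n. (if l \<in> nbrs E w \<inter> T then 1 else 0)) = real (card (nbrs E w \<inter> T))"
    proof -
      have "{..<n} \<inter> {l \<in> nbrs E w. l \<in> T} = nbrs E w \<inter> T" using T by auto
      then show ?thesis by (simp add: sum.If_cases)
    qed
    finally show ?thesis using sum_adj[OF g w] by (simp add: t_def)
  qed
  then have "(\<Sum>w<n. (real (card (nbrs E w \<inter> T)) - real d / real n * real (card T))\<^sup>2) = s 1"
    unfolding s_def by (intro sum.cong) auto
  also have "\<dots> \<le> lam\<^sup>2 * s 0" by (rule main)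
  also have "s 0 = (\<Sum>j<n. (f j)\<^sup>2)" unfolding s_def using F0 by (intro sum.cong) auto
  also have "lam\<^sup>2 * \<dots> \<le> lam\<^sup>2 * real (card T)"
    using sumf2 by (intro mult_left_mono) auto
  finally show ?thesis .
qed

text \<open>Degenerate sizes drop out: for \<open>n = 0\<close> there is no eigenvalue to single
  out, and \<open>n = 1\<close> contradicts \<open>0 < d\<close>. So a second eigenvalue exists, and
  its modulus shows \<open>0 \<le> lam\<close>. \<open>1 < K\<close> and \<open>0 < d\<close> give
  the strict \<open>lam < d\<close> that identifies the top eigenvalue.\<close>

lemma ndl_quasirandom:
  assumes ndl: "ndl_graph n d lam E" and d: "0 < d" and K: "1 < K" and le: "K * lam \<le> real d"
  shows "quasirandom n d lam K E"
proof -
  from ndl have g: "simple_graph n E" "regular n E d" unfolding ndl_graph_def by auto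
  have n: "0 < n"
  proof (rule ccontr)
    assume "\<not> ?thesis"
    then have "size (adj_eigenvalues n E) = 0" using adj_eigenvalues_trace(1)[of n E] by simp
    then show False using ndl by (auto simp: ndl_graph_def)
  qed
  have lam: "lam < real d"
  proof (cases "lam \<le> 0")
    case False
    then have "lam < K * lam" using K by simp
    then show ?thesis using le by simp
  qed (use d in simp)
  have "1 < n"
  proof (rule ccontr)
    assume "\<not> ?thesis"
    then have "n = 1" using n by simp
    then have "{y. y < n \<and> E 0 y} = {}" using g(1) by (auto simp: simple_graph_def)
    moreover have "card {y. y < n \<and> E 0 y} = d" using g(2) n by (auto simp: regular_def)
    ultimately show False using d by (metis card.empty less_irrefl)
  qed
  have "0 \<le> lam"
  proof -
    from ndl obtain \<mu> where \<mu>: "\<mu> \<in># adj_eigenvalues n E"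
      and rest: "\<forall>\<nu>\<in>#adj_eigenvalues n E - {#\<mu>#}. cmod \<nu> \<le> lam"
      unfolding ndl_graph_def by auto
    have "size (adj_eigenvalues n E - {#\<mu>#}) = n - 1"
      using \<mu> adj_eigenvalues_trace(1)[of n E] by (simp add: size_Diff_singleton)
    then have "adj_eigenvalues n E - {#\<mu>#} \<noteq> {#}" using \<open>1 < n\<close> by (metis size_empty diff_is_0_eq not_less)
    then obtain \<nu> where "\<nu> \<in># adj_eigenvalues n E - {#\<mu>#}" by blast
    then show ?thesis using rest norm_ge_zero order_trans by blast
  qed
  then show ?thesis
    unfolding quasirandom_def using g n d K le ndl_spread[OF ndl lam n] by auto
qed

section \<open>Routing\<close>

context quasirandom
begin

text \<open>Balls around \<open>x\<close> and \<open>y\<close> in the allowed graph double until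
  they hold \<open>g * n / 2\<close> vertices, which takes \<open>k + 1\<close> steps. Two such sets
  span more edges than are forbidden, so an allowed edge joins them. Each side contributes at most
  \<open>k + 2\<close> vertices.\<close>

lemma linked_within:
  assumes X: "X \<subseteq> V" and g: "0 < g" and K: "2 \<le> (g * K / 2)\<^sup>2" and K2: "32 \<le> K\<^sup>2 * (g / 2) ^ 3"
    and A_sym: "\<And>x y. A x y \<Longrightarrow> A y x" and A_sub: "\<And>x y. A x y \<Longrightarrow> y \<in> X"
    and deg: "\<And>x. x \<in> X \<Longrightarrow> g * real d \<le> real (card {y \<in> N x. A x y})"
    and missing: "real (card {(x, y). x \<in> X \<and> y \<in> N x \<inter> X \<and> \<not> A x y}) < (g / 2)\<^sup>2 * real n * real d / 4"
    and k: "n \<le> 2 ^ k * d"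
    and x: "x \<in> X" and y: "y \<in> X"
  shows "\<exists>q. q \<noteq> [] \<and> hd q = x \<and> last q = y \<and> successively (\<lambda>u v. E u v \<and> A u v) q \<and> distinct q
    \<and> set q \<subseteq> X \<and> length q \<le> 2 * k + 4"
proof -
  define P where "P u v \<longleftrightarrow> E u v \<and> A u v" for u v
  define R where "R x j = {z. \<exists>q. q \<noteq> [] \<and> hd q = x \<and> last q = z \<and> successively P q \<and> set q \<subseteq> X \<and> length q \<le> Suc j}" for x j
  have RX: "R x j \<subseteq> X" for x j unfolding R_def by fastforce
  have RV: "R x j \<subseteq> V" for x j using RX X by blast
  have mono: "R x j \<subseteq> R x (Suc j)" for x j unfolding R_def by fastforce
  have step: "{z \<in> N y. A y z} \<subseteq> R x (Suc j)" if y: "y \<in> R x j" for x y j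
  proof
    fix z assume z: "z \<in> {z \<in> N y. A y z}"
    obtain q where q: "q \<noteq> []" "hd q = x" "last q = y" "successively P q" "set q \<subseteq> X" "length q \<le> Suc j"
      using y unfolding R_def by auto
    show "z \<in> R x (Suc j)"
      unfolding R_def using q z A_sub[of y z]
      by (intro CollectI exI[of _ "q @ [z]"]) (auto simp: successively_append_iff P_def in_N)
  qed
  \<comment> \<open>Allowed neighbours of a ball lie in the next ball, so \<open>expansion\<close>
    applies with the next ball as \<open>T\<close> as long as that ball is smaller than
    \<open>g * n / 2\<close>.\<close>
  have grow: "min (g * real n / 2) (2 ^ j * (g * real d)) \<le> real (card (R x (Suc j)))" if x: "x \<in> X" for x j
  proof (induction j)
    case 0
    have "x \<in> R x 0" unfolding R_def using x by (auto intro!: exI[of _ "[x]"])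
    then have "{z \<in> N x. A x z} \<subseteq> R x (Suc 0)" by (rule step)
    then have "card {z \<in> N x. A x z} \<le> card (R x (Suc 0))" by (intro card_mono fin_sub RV)
    then show ?case using deg[OF x] by simp
  next
    case (Suc j)
    show ?case
    proof (cases "g * real n / 2 \<le> real (card (R x (Suc (Suc j))))")
      case False
      have "real (card (R x (Suc j))) * (g * K / 2)\<^sup>2 \<le> real (card (R x (Suc (Suc j))))"
      proof (rule expansion)
        fix a assume a: "a \<in> R x (Suc j)"
        have "g * real d \<le> real (card {y \<in> N a. A a y})" using a RX by (intro deg) auto
        also have "\<dots> \<le> real (card (N a \<inter> R x (Suc (Suc j))))"
          unfolding of_nat_le_iff using step[OF a] by (intro card_mono) auto
        finally show "g * real d \<le> real (card (N a \<inter> R x (Suc (Suc j))))" .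
      qed (use RV g False in auto)
      moreover have "real (card (R x (Suc j))) * 2 \<le> real (card (R x (Suc j))) * (g * K / 2)\<^sup>2"
        using K by (intro mult_left_mono) auto
      moreover have "card (R x (Suc j)) \<le> card (R x (Suc (Suc j)))"
        by (intro card_mono fin_sub RV mono)
      then have "\<not> g * real n / 2 \<le> real (card (R x (Suc j)))" using False by simp
      then have "2 ^ j * (g * real d) \<le> real (card (R x (Suc j)))" using Suc by simp
      ultimately show ?thesis by simp
    qed simp
  qed
  have big: "g / 2 * real n \<le> real (card (R x (Suc k)))" if "x \<in> X" for x
  proof -
    have "real n \<le> real (2 ^ k * d)" unfolding of_nat_le_iff by (rule k)
    then have "real n \<le> 2 ^ k * real d" by simp
    then have "g * real n \<le> g * (2 ^ k * real d)" using g by (intro mult_left_mono) auto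
    moreover have "0 \<le> g * real n" using g by simp
    ultimately have "g * real n / 2 \<le> 2 ^ k * (g * real d)" by (simp add: mult_ac)
    then show ?thesis using grow[OF that, of k] by simp
  qed
  define S T where "S = R x (Suc k)" and "T = R y (Suc k)"
  define s where "s = g / 2"
  have s: "0 < s" using g by (simp add: s_def)
  have SX: "S \<subseteq> X" and TX: "T \<subseteq> X" unfolding S_def T_def by (rule RX)+
  then have SV: "S \<subseteq> V" and TV: "T \<subseteq> V" using X by auto
  have "\<exists>u\<in>S. \<exists>v\<in>T. P u v"
  proof (rule ccontr)
    assume none: "\<not> ?thesis"
    \<comment> \<open>Vertices of \<open>S\<close> with unusually few neighbours in
      \<open>T\<close>; there are at most \<open>s * n / 8\<close>. At least
      \<open>s * n / 2\<close> vertices of \<open>S\<close> remain, each with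
      \<open>s * d / 2\<close> edges to \<open>T\<close>, and all these edges would have to be
      forbidden, against \<open>missing\<close>.\<close>
    define S1 where "S1 = {u \<in> S. real (card (N u \<inter> T)) \<le> s * real d / 2}"
    have "real (card S1) * (s * K / 2)\<^sup>2 \<le> real n"
      by (rule few_poor[where X = T]) (use big[OF y] SV TV s in \<open>auto simp: S1_def T_def s_def\<close>)
    moreover have "8 / s \<le> (s * K / 2)\<^sup>2"
      using K2 s unfolding s_def[symmetric] by (simp add: field_simps power2_eq_square power3_eq_cube)
    then have "real (card S1) * (8 / s) \<le> real (card S1) * (s * K / 2)\<^sup>2"
      by (intro mult_left_mono) auto
    ultimately have "real (card S1) * (8 / s) \<le> real n" by linarith
    then have S1: "real (card S1) \<le> s * real n / 8" using s by (simp add: field_simps)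
    have fS: "finite S" using SV fin_sub by auto
    have "real (card (S - S1)) = real (card S) - real (card S1)"
      using fS by (subst card_Diff_subset) (auto simp: S1_def card_mono of_nat_diff)
    then have S2: "s * real n / 2 \<le> real (card (S - S1))"
      using big[OF x] S1 s by (simp add: S_def s_def)
    have "(\<Sum>u\<in>S - S1. s * real d / 2) \<le> (\<Sum>u\<in>S - S1. real (card (N u \<inter> T)))"
      by (rule sum_mono) (auto simp: S1_def)
    also have "\<dots> = real (card (SIGMA u : S - S1. N u \<inter> T))"
      using fS by (subst card_SigmaI) auto
    also have "\<dots> \<le> real (card {(x, y). x \<in> X \<and> y \<in> N x \<inter> X \<and> \<not> A x y})"
      unfolding of_nat_le_iff
    proof (rule card_mono)
      show "finite {(x, y). x \<in> X \<and> y \<in> N x \<inter> X \<and> \<not> A x y}"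
        by (rule finite_subset[of _ "V \<times> V"]) (use X in auto)
      show "(SIGMA u : S - S1. N u \<inter> T) \<subseteq> {(x, y). x \<in> X \<and> y \<in> N x \<inter> X \<and> \<not> A x y}"
        using none SX TX by (auto simp: P_def in_N)
    qed
    finally have "real (card (S - S1)) * (s * real d / 2) < s\<^sup>2 * real n * real d / 4"
      using missing by (simp add: s_def)
    moreover have "(s * real n / 2) * (s * real d / 2) \<le> real (card (S - S1)) * (s * real d / 2)"
      using S2 s by (intro mult_right_mono) auto
    moreover have "(s * real n / 2) * (s * real d / 2) = s\<^sup>2 * real n * real d / 4"
      by (simp add: power2_eq_square)
    ultimately show False by linarith
  qed
  then obtain u v where uv: "u \<in> S" "v \<in> T" "P u v" by auto
  obtain q where q: "q \<noteq> []" "hd q = x" "last q = u" "successively P q" "set q \<subseteq> X" "length q \<le> Suc (Suc k)"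
    using uv(1) unfolding S_def R_def by auto
  obtain r where r: "r \<noteq> []" "hd r = y" "last r = v" "successively P r" "set r \<subseteq> X" "length r \<le> Suc (Suc k)"
    using uv(2) unfolding T_def R_def by auto
  have Psym: "P b a \<longleftrightarrow> P a b" for a b
    using graph A_sym by (auto simp: P_def simple_graph_def)
  have "successively P (q @ rev r)"
    using q r uv(3) by (simp add: successively_append_iff Psym hd_rev)
  from distinct_path_of_walk[OF _ this] q obtain q' where q': "q' \<noteq> []" "hd q' = x" "last q' = last (q @ rev r)"
    "successively P q'" "distinct q'" "length q' \<le> length (q @ rev r)" "set q' \<subseteq> set (q @ rev r)"
    by auto
  show ?thesis
    using q' q r unfolding P_def
    by (intro exI[of _ q']) (auto simp: last_rev)
qed

end

lemma card_ordered_pairs_le: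
  assumes "finite U" and D: "\<And>x y. (x, y) \<in> D \<Longrightarrow> x \<noteq> y \<and> {x, y} \<in> U"
  shows "card D \<le> 2 * card U"
proof -
  define F where "F e = {(x, y). x \<noteq> y \<and> {x, y} = e}" for e :: "'a set"
  have F: "finite (F e) \<and> card (F e) \<le> 2" for e
  proof (cases "\<exists>a b. e = {a, b}")
    case True
    then obtain a b where ab: "e = {a, b}" by blast
    have sub: "F e \<subseteq> {(a, b), (b, a)}"
    proof
      fix z assume "z \<in> F e"
      then obtain x y where xy: "z = (x, y)" "{x, y} = {a, b}" unfolding F_def ab by blast
      from xy(2) have "x = a \<and> y = b \<or> x = b \<and> y = a" by (simp only: doubleton_eq_iff)
      then show "z \<in> {(a, b), (b, a)}" using xy(1) by blast
    qed
    then have "card (F e) \<le> card {(a, b), (b, a)}" by (intro card_mono) auto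
    also have "\<dots> \<le> 2" using card_length[of "[(a, b), (b, a)]"] by simp
    finally show ?thesis using sub finite_subset by blast
  next
    case False
    then have "F e = {}" unfolding F_def by blast
    then show ?thesis by simp
  qed
  have "D \<subseteq> (\<Union>e\<in>U. F e)" using D by (fastforce simp: F_def)
  then have "card D \<le> card (\<Union>e\<in>U. F e)" using assms(1) F by (intro card_mono) auto
  also have "\<dots> \<le> (\<Sum>e\<in>U. card (F e))" using assms(1) by (rule card_UN_le)
  also have "\<dots> \<le> (\<Sum>e\<in>U. 2)" using F by (intro sum_mono) auto
  finally show ?thesis by simp
qed

context quasirandom
begin

text \<open>The pairs in \<open>L\<close> are routed one after the other through \<open>V - B\<close>, avoiding the closed set \<open>Zs U\<close>
  generated by the vertices that are poor in \<open>V - B\<close> or meet many of the used edges \<open>U\<close>. A pair is skipped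
  when one of its ends is stuck. Since \<open>Zs U\<close> grows with \<open>U\<close>, a vertex that is not stuck at the end never
  was, so no pair inside \<open>B'\<close> has been skipped.\<close>

lemma routing:
  fixes S :: "nat \<Rightarrow> nat set" and L :: "(nat \<times> nat) set"
  assumes B: "B \<subseteq> V" and \<omega>: "0 < \<omega>" and h: "0 < h"
    and K1: "2 \<le> (\<omega> / 8 * K / 2)\<^sup>2" and K2: "32 \<le> K\<^sup>2 * (\<omega> / 8) ^ 3"
    and L: "L \<subseteq> B \<times> B" "\<And>u v. (u, v) \<in> L \<Longrightarrow> u \<noteq> v"
    and S: "\<And>u. u \<in> B \<Longrightarrow> S u \<subseteq> N u - B"
    and Sbig: "\<And>u. u \<in> B \<Longrightarrow> real (card {e \<in> L. fst e = u \<or> snd e = u}) + h * real d \<le> real (card (S u))"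
    and load: "\<And>w. w \<in> V - B \<Longrightarrow> card {u \<in> B. w \<in> S u} \<le> t"
    and poor: "real (card {w \<in> V - B. real (card (N w - B)) < \<omega> / 2 * real d}) \<le> qb"
    and k: "n \<le> 2 ^ k * d"
    and zb: "zb = qb + 16 * real (card L) * real (2 * k + 4) / (\<omega> * real d)"
    and c1: "2 * zb + 1 \<le> \<omega> / 8 * real n / 2"
    and c2: "real (card L) * real (2 * k + 4) < (\<omega> / 8)\<^sup>2 * real n * real d / 8"
  shows "\<exists>B' P. B' \<subseteq> B \<and> real (card (B - B')) * (h * real d) \<le> real t * (2 * zb) \<and>
    (\<forall>e\<in>L \<inter> B' \<times> B'. is_path E (P e) (fst e) (snd e) \<and>
      path_edges (P e) \<subseteq> {{u, x} | u x. u \<in> B \<and> x \<in> S u} \<union> {{x, y} | x y. x \<in> V - B \<and> y \<in> V - B}) \<and>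
    (\<forall>e\<in>L \<inter> B' \<times> B'. \<forall>e'\<in>L \<inter> B' \<times> B'. e \<noteq> e' \<longrightarrow> path_edges (P e) \<inter> path_edges (P e') = {})"
proof -
  define W where "W = V - B"
  define l where "l = 2 * k + 4"
  have WV: "W \<subseteq> V" by (auto simp: W_def)
  have fB: "finite B" using B fin_sub by auto
  have fL: "finite L" using L(1) fB by (meson finite_SigmaI finite_subset)
  have fS: "finite (S u)" if "u \<in> B" for u using S[OF that] fin_N finite_subset by blast
  \<comment> \<open>Degree budget in units of \<open>d\<close>: a vertex outside \<open>Zs U\<close>
    has \<open>\<omega> / 2\<close> edges within \<open>V - B\<close>, loses
    \<open>\<omega> / 8\<close> to used edges and \<open>\<omega> / 8\<close> to neighbours in
    \<open>Zs U\<close>, and so keeps the \<open>\<omega> / 4\<close> that is passed to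
    \<open>linked_within\<close>.\<close>
  define base where "base U = {w \<in> W. real (card (N w - B)) < \<omega> / 2 * real d} \<union>
      {w \<in> W. \<omega> / 8 * real d \<le> real (card {y \<in> N w. {w, y} \<in> U})}" for U
  define closd where "closd Z \<longleftrightarrow> (\<forall>w\<in>V - Z. real (card (N w \<inter> Z)) < \<omega> / 8 * real d)" for Z
  \<comment> \<open>The intersection of all closed supersets is monotone in \<open>U\<close>, which
    an arbitrary set from \<open>small_closure\<close> would not be; that lemma is used to bound the
    size. The intersection is again closed, since a vertex outside it lies outside one of the closed
    sets.\<close>
  define Zs where "Zs U = \<Inter>{Z. base U \<subseteq> Z \<and> Z \<subseteq> V \<and> closd Z}" for U
  have Vin: "V \<in> {Z. base U \<subseteq> Z \<and> Z \<subseteq> V \<and> closd Z}" for U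
    using WV by (auto simp: base_def closd_def)
  have ZsV: "Zs U \<subseteq> V" for U unfolding Zs_def using Vin[of U] by (rule Inter_lower)
  have base_Zs: "base U \<subseteq> Zs U" for U unfolding Zs_def by auto
  have Zs_closed: "real (card (N w \<inter> Zs U)) < \<omega> / 8 * real d" if w: "w \<in> V - Zs U" for w U
  proof -
    obtain Z where Z: "base U \<subseteq> Z" "Z \<subseteq> V" "closd Z" "w \<notin> Z" using w unfolding Zs_def by blast
    have "Zs U \<subseteq> Z" unfolding Zs_def using Z by (intro Inter_lower) auto
    then have "card (N w \<inter> Zs U) \<le> card (N w \<inter> Z)" by (intro card_mono) auto
    moreover have "real (card (N w \<inter> Z)) < \<omega> / 8 * real d" using Z w unfolding closd_def by auto
    ultimately show ?thesis by linarith
  qed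
  have Zs_mono: "Zs U \<subseteq> Zs U'" if "U \<subseteq> U'" "finite U'" for U U'
  proof -
    have "base U \<subseteq> base U'"
    proof
      fix w assume w: "w \<in> base U"
      have "card {y \<in> N w. {w, y} \<in> U} \<le> card {y \<in> N w. {w, y} \<in> U'}"
        using that by (intro card_mono) auto
      then have "real (card {y \<in> N w. {w, y} \<in> U}) \<le> real (card {y \<in> N w. {w, y} \<in> U'})" by simp
      then show "w \<in> base U'" using w unfolding base_def by fastforce
    qed
    then show ?thesis unfolding Zs_def by (intro Inter_anti_mono) auto
  qed
  have d0: "0 < real d" using d_pos by simp
  \<comment> \<open>Each vertex of \<open>H\<close> sees at least \<open>\<omega> * d / 8\<close>
    used edges and each edge is seen at most twice, so \<open>card L * l\<close> used edges account
    for the second term of \<open>zb\<close>. The factor 2 is that of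
    \<open>small_closure\<close>.\<close>
  have Zs_card: "real (card (Zs U)) \<le> 2 * zb" if U: "finite U" "card U \<le> card L * l" for U
  proof -
    define H where "H = {w \<in> W. \<omega> / 8 * real d \<le> real (card {y \<in> N w. {w, y} \<in> U})}"
    have fH: "finite H" using WV fin_sub[of H] by (auto simp: H_def)
    have "real (card H) * (\<omega> / 8 * real d) = (\<Sum>w\<in>H. \<omega> / 8 * real d)" by simp
    also have "\<dots> \<le> (\<Sum>w\<in>H. real (card {y \<in> N w. {w, y} \<in> U}))"
      by (rule sum_mono) (auto simp: H_def)
    also have "\<dots> = real (card (SIGMA w : H. {y \<in> N w. {w, y} \<in> U}))"
      using fH by (subst card_SigmaI) auto
    also have "\<dots> \<le> real (2 * card U)"
      unfolding of_nat_le_iff by (rule card_ordered_pairs_le[OF U(1)]) (use N_irrefl in auto)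
    also have "\<dots> \<le> 2 * (real (card L) * real l)"
    proof -
      have "real (card U) \<le> real (card L * l)" unfolding of_nat_le_iff by (rule U(2))
      then show ?thesis by simp
    qed
    finally have "real (card H) * (\<omega> * real d) \<le> 16 * real (card L) * real l" by simp
    then have cH: "real (card H) \<le> 16 * real (card L) * real l / (\<omega> * real d)"
      using \<omega> d0 by (simp add: pos_le_divide_eq)
    have "base U = {w \<in> V - B. real (card (N w - B)) < \<omega> / 2 * real d} \<union> H"
      by (auto simp: base_def H_def W_def)
    then have "card (base U) \<le> card {w \<in> V - B. real (card (N w - B)) < \<omega> / 2 * real d} + card H"
      by (simp only: card_Un_le)
    then have cb: "real (card (base U)) \<le> zb" using poor cH unfolding zb l_def by linarith
    have "\<exists>Z. base U \<subseteq> Z \<and> Z \<subseteq> V \<and> card Z \<le> 2 * card (base U) \<and>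
        (\<forall>w\<in>V - Z. real (card (N w \<inter> Z)) < \<omega> / 8 * real d)"
      by (rule small_closure) (use \<omega> K1 cb c1 WV in \<open>auto simp: base_def\<close>)
    then obtain Z where Z: "base U \<subseteq> Z" "Z \<subseteq> V" "card Z \<le> 2 * card (base U)" "closd Z"
      unfolding closd_def by auto
    have "Zs U \<subseteq> Z" unfolding Zs_def using Z by (intro Inter_lower) auto
    then have "card (Zs U) \<le> card Z" using Z(2) fin_sub by (intro card_mono) auto
    then show ?thesis using Z(3) cb by linarith
  qed
  define Us where "Us Rt P = (\<Union>e\<in>Rt. path_edges (P e))" for Rt :: "(nat \<times> nat) set" and P :: "nat \<times> nat \<Rightarrow> nat list"
  define stuck where "stuck U u \<longleftrightarrow> h * real d \<le> real (card (S u \<inter> Zs U))" for U u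
  \<comment> \<open>At this stage \<open>P e\<close> is only the inner part of a path, inside
    \<open>W\<close>. Its two end edges run from a branch vertex into that vertex's star and are
    recorded as oriented pairs, so that their disjointness is tracked apart from that of the inner
    edges.\<close>
  define stubs where "stubs P e = {(fst e, hd (P e)), (snd e, last (P e))}" for P :: "nat \<times> nat \<Rightarrow> nat list" and e
  define ok where "ok e q \<longleftrightarrow> q \<noteq> [] \<and> hd q \<in> S (fst e) \<and> last q \<in> S (snd e) \<and> distinct q \<and> set q \<subseteq> W \<and>
      successively E q \<and> length q \<le> l" for e q
  define consistent where "consistent Rt P \<longleftrightarrow> (\<forall>e\<in>Rt. ok e (P e)) \<and> (\<forall>e\<in>Rt. \<forall>e'\<in>Rt. e \<noteq> e' \<longrightarrow>
      path_edges (P e) \<inter> path_edges (P e') = {} \<and> stubs P e \<inter> stubs P e' = {})" for Rt P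
  have cUs: "finite (Us Rt P) \<and> card (Us Rt P) \<le> card L * l" if "Rt \<subseteq> L" "consistent Rt P" for Rt P
  proof -
    have fR: "finite Rt" using that fL finite_subset by auto
    have "card (Us Rt P) \<le> (\<Sum>e\<in>Rt. card (path_edges (P e)))"
      unfolding Us_def using fR by (rule card_UN_le)
    also have "\<dots> \<le> (\<Sum>e\<in>Rt. l)"
    proof (rule sum_mono)
      fix e assume "e \<in> Rt"
      then have "ok e (P e)" using that(2) unfolding consistent_def by blast
      then have "length (P e) \<le> l" by (simp add: ok_def)
      then show "card (path_edges (P e)) \<le> l" using card_path_edges[of "P e"] by linarith
    qed
    also have "\<dots> \<le> card L * l" using card_mono[OF fL that(1)] by simp
    finally show ?thesis using fR by (auto simp: Us_def)
  qed
  have main: "\<exists>Rt P. Rt \<subseteq> L' \<and> consistent Rt P \<and> (\<forall>e\<in>L' - Rt. stuck (Us Rt P) (fst e) \<or> stuck (Us Rt P) (snd e))"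
    if "finite L'" "L' \<subseteq> L" for L'
    using that
  proof (induction L' rule: finite_induct)
    case empty
    show ?case by (intro exI[of _ "{}"]) (auto simp: consistent_def)
  next
    case (insert e L')
    then have "L' \<subseteq> L" by blast
    from insert.IH[OF this] obtain Rt P where Rt: "Rt \<subseteq> L'" "consistent Rt P"
      and st0: "\<forall>e\<in>L' - Rt. stuck (Us Rt P) (fst e) \<or> stuck (Us Rt P) (snd e)" by blast
    have st: "stuck (Us Rt P) (fst e) \<or> stuck (Us Rt P) (snd e)" if "e \<in> L' - Rt" for e
      using st0 that by (rule bspec)
    have RtL: "Rt \<subseteq> L" using Rt insert.prems by auto
    define U where "U = Us Rt P"
    have U: "finite U" "card U \<le> card L * l" using cUs[OF RtL Rt(2)] by (auto simp: U_def)
    obtain u v where e: "e = (u, v)" by (cases e)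
    have uv: "u \<in> B" "v \<in> B" "u \<noteq> v" using insert.prems e L by auto
    show ?case
    proof (cases "stuck U u \<or> stuck U v")
      case True
      then show ?thesis using Rt st e by (intro exI[of _ Rt] exI[of _ P]) (auto simp: U_def)
    next
      case False
      \<comment> \<open>The stubs already used at \<open>u\<close> number at most the pairs of
        \<open>L\<close> at \<open>u\<close>. By \<open>Sbig\<close> the star has
        \<open>h * d\<close> further vertices, and fewer than \<open>h * d\<close> are blocked
        because \<open>u\<close> is not stuck.\<close>
      have free: "\<exists>x \<in> S u. x \<notin> Zs U \<and> (\<forall>e\<in>Rt. (u, x) \<notin> stubs P e)" if u: "u \<in> B" "\<not> stuck U u" for u
      proof -
        define used where "used = {x. \<exists>e\<in>Rt. (u, x) \<in> stubs P e}"
        define D where "D = {e \<in> L. fst e = u \<or> snd e = u}"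
        have fD: "finite D" using fL by (auto simp: D_def)
        have "used \<subseteq> (\<lambda>e. if fst e = u then hd (P e) else last (P e)) ` D"
        proof
          fix x assume "x \<in> used"
          then obtain e where e: "e \<in> Rt" "(u, x) \<in> stubs P e" by (auto simp: used_def)
          then have "e \<in> D" using RtL by (auto simp: stubs_def D_def)
          moreover have "fst e \<noteq> snd e" using L(2)[of "fst e" "snd e"] e RtL by auto
          ultimately show "x \<in> (\<lambda>e. if fst e = u then hd (P e) else last (P e)) ` D"
            using e(2) by (intro image_eqI[of _ _ e]) (auto simp: stubs_def)
        qed
        then have "card used \<le> card D" using fD by (rule surj_card_le[rotated])
        moreover have "finite used" using \<open>used \<subseteq> _\<close> fD finite_subset by blast
        moreover have "real (card (S u \<inter> Zs U)) < h * real d" using u by (simp add: stuck_def)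
        moreover have "real (card D) + h * real d \<le> real (card (S u))" using Sbig[OF u(1)] by (simp add: D_def)
        moreover have "card ((S u \<inter> Zs U) \<union> used) \<le> card (S u \<inter> Zs U) + card used" by (rule card_Un_le)
        ultimately have "card ((S u \<inter> Zs U) \<union> used) < card (S u)" by linarith
        moreover have "finite ((S u \<inter> Zs U) \<union> used)" using fS[OF u(1)] \<open>finite used\<close> by auto
        ultimately have "\<not> S u \<subseteq> (S u \<inter> Zs U) \<union> used" using card_mono[of "(S u \<inter> Zs U) \<union> used" "S u"] by linarith
        then show ?thesis by (auto simp: used_def)
      qed
      obtain x where x: "x \<in> S u" "x \<notin> Zs U" "\<forall>e\<in>Rt. (u, x) \<notin> stubs P e" using free[of u] False uv by auto
      obtain y where y: "y \<in> S v" "y \<notin> Zs U" "\<forall>e\<in>Rt. (v, y) \<notin> stubs P e" using free[of v] False uv by auto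
      define X where "X = W - Zs U"
      define A where "A a b \<longleftrightarrow> a \<in> X \<and> b \<in> X \<and> {a, b} \<notin> U" for a b
      have "\<exists>q. q \<noteq> [] \<and> hd q = x \<and> last q = y \<and> successively (\<lambda>u v. E u v \<and> A u v) q \<and> distinct q
        \<and> set q \<subseteq> X \<and> length q \<le> 2 * k + 4"
      proof (rule linked_within[where g = "\<omega> / 4"])
        show "X \<subseteq> V" using WV by (auto simp: X_def)
        show "0 < \<omega> / 4" using \<omega> by simp
        show "2 \<le> (\<omega> / 4 * K / 2)\<^sup>2"
        proof -
          have "(\<omega> / 8 * K / 2)\<^sup>2 \<le> (\<omega> / 4 * K / 2)\<^sup>2" using \<omega> K_pos by (intro power_mono) auto
          then show ?thesis using K1 by linarith
        qed
        show "32 \<le> K\<^sup>2 * (\<omega> / 4 / 2) ^ 3" using K2 by simp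
        show "A b a" if "A a b" for a b using that unfolding A_def by (subst insert_commute) blast
        show "b \<in> X" if "A a b" for a b using that by (auto simp: A_def)
        show "n \<le> 2 ^ k * d" by (rule k)
        show "x \<in> X" using x(1,2) S[OF uv(1)] N_sub[of u] unfolding X_def W_def by blast
        show "y \<in> X" using y(1,2) S[OF uv(2)] N_sub[of v] unfolding X_def W_def by blast
        show "\<omega> / 4 * real d \<le> real (card {b \<in> N a. A a b})" if a: "a \<in> X" for a
        proof -
          have aW: "a \<in> W" "a \<notin> base U" "a \<in> V - Zs U" using a base_Zs WV by (auto simp: X_def)
          have "N a - B \<subseteq> {b \<in> N a. A a b} \<union> (N a \<inter> Zs U) \<union> {b \<in> N a. {a, b} \<in> U}"
            using N_sub a by (auto simp: A_def X_def W_def)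
          then have "card (N a - B) \<le> card ({b \<in> N a. A a b} \<union> (N a \<inter> Zs U) \<union> {b \<in> N a. {a, b} \<in> U})"
            by (intro card_mono) auto
          also have "\<dots> \<le> card {b \<in> N a. A a b} + card (N a \<inter> Zs U) + card {b \<in> N a. {a, b} \<in> U}"
            by (meson add_le_mono card_Un_le le_trans order_refl)
          finally have "real (card (N a - B)) \<le> real (card {b \<in> N a. A a b}) + real (card (N a \<inter> Zs U)) + real (card {b \<in> N a. {a, b} \<in> U})"
            by linarith
          moreover have "\<omega> / 2 * real d \<le> real (card (N a - B))" "real (card {b \<in> N a. {a, b} \<in> U}) < \<omega> / 8 * real d"
            using aW by (auto simp: base_def)
          ultimately show ?thesis using Zs_closed[OF aW(3)] by linarith
        qed
        show "real (card {(a, b). a \<in> X \<and> b \<in> N a \<inter> X \<and> \<not> A a b}) < (\<omega> / 4 / 2)\<^sup>2 * real n * real d / 4"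
        proof -
          have "card {(a, b). a \<in> X \<and> b \<in> N a \<inter> X \<and> \<not> A a b} \<le> 2 * card U"
            by (rule card_ordered_pairs_le[OF U(1)]) (use N_irrefl in \<open>auto simp: A_def\<close>)
          then have "real (card {(a, b). a \<in> X \<and> b \<in> N a \<inter> X \<and> \<not> A a b}) \<le> 2 * real (card U)" by linarith
          moreover have "real (card U) \<le> real (card L * l)" unfolding of_nat_le_iff by (rule U(2))
          ultimately show ?thesis using c2 unfolding l_def by (simp add: power2_eq_square)
        qed
      qed
      then obtain q where q: "q \<noteq> []" "hd q = x" "last q = y" "successively (\<lambda>u v. E u v \<and> A u v) q" "distinct q"
        "set q \<subseteq> X" "length q \<le> l" unfolding l_def by blast
      have succE: "successively E q" using q(4) by (rule successively_mono) auto
      have qU: "path_edges q \<inter> U = {}"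
      proof (rule ccontr)
        assume "\<not> ?thesis"
        then obtain f where f: "f \<in> path_edges q" "f \<in> U" by auto
        from path_edges_successively[OF q(4) f(1)] obtain a b where "f = {a, b}" "A a b" by blast
        then show False using f(2) by (simp add: A_def)
      qed
      define P' where "P' = P(e := q)"
      have eRt: "e \<notin> Rt" using insert.hyps Rt by auto
      then have P'eq: "P' e' = P e'" if "e' \<in> Rt" for e' using that by (auto simp: P'_def)
      have P'e: "P' e = q" by (simp add: P'_def)
      have oke: "ok e q" using q x y succE e by (auto simp: ok_def X_def)
      have new: "path_edges q \<inter> path_edges (P e') = {} \<and> stubs P' e \<inter> stubs P e' = {}" if e': "e' \<in> Rt" for e'
      proof
        show "path_edges q \<inter> path_edges (P e') = {}" using qU e' by (auto simp: U_def Us_def)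
        have se: "stubs P' e = {(u, x), (v, y)}" unfolding stubs_def P'e using e q by simp
        have "(u, x) \<notin> stubs P e'" using x(3) e' by (rule bspec)
        moreover have "(v, y) \<notin> stubs P e'" using y(3) e' by (rule bspec)
        ultimately show "stubs P' e \<inter> stubs P e' = {}" unfolding se by simp
      qed
      have stubs': "stubs P' e' = stubs P e'" if "e' \<in> Rt" for e' using P'eq[OF that] by (simp add: stubs_def)
      have consistent': "consistent (insert e Rt) P'"
        unfolding consistent_def
      proof (intro conjI ballI impI)
        fix e1 assume "e1 \<in> insert e Rt"
        then show "ok e1 (P' e1)" using oke P'e P'eq Rt(2) unfolding consistent_def by (metis insertE)
      next
        fix e1 e2 assume *: "e1 \<in> insert e Rt" "e2 \<in> insert e Rt" "e1 \<noteq> e2"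
        have "path_edges (P' e1) \<inter> path_edges (P' e2) = {} \<and> stubs P' e1 \<inter> stubs P' e2 = {}"
        proof (cases "e1 = e")
          case True
          then have "e2 \<in> Rt" using * by auto
          then show ?thesis using new[of e2] True P'e P'eq stubs' by auto
        next
          case False
          then have e1: "e1 \<in> Rt" using * by auto
          show ?thesis
          proof (cases "e2 = e")
            case True
            then show ?thesis using new[of e1] e1 P'e P'eq stubs' by auto
          next
            case False
            then have "e2 \<in> Rt" using * by auto
            then show ?thesis using e1 Rt(2) *(3) P'eq stubs' unfolding consistent_def by metis
          qed
        qed
        then show "path_edges (P' e1) \<inter> path_edges (P' e2) = {}" "stubs P' e1 \<inter> stubs P' e2 = {}" by auto
      qed
      define U' where "U' = Us (insert e Rt) P'"
      have "U \<subseteq> U'" using P'eq by (auto simp: U_def U'_def Us_def)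
      moreover have "finite U'" using cUs[of "insert e Rt" P'] consistent' insert.prems RtL by (auto simp: U'_def)
      ultimately have ZZ: "Zs U \<subseteq> Zs U'" by (rule Zs_mono)
      have stm: "stuck U' w" if "stuck U w" "w \<in> B" for w
      proof -
        have "card (S w \<inter> Zs U) \<le> card (S w \<inter> Zs U')" using ZZ fS[OF that(2)] by (intro card_mono) auto
        then show ?thesis using that unfolding stuck_def by linarith
      qed
      show ?thesis
      proof (intro exI[of _ "insert e Rt"] exI[of _ P'] conjI ballI)
        show "insert e Rt \<subseteq> insert e L'" using Rt by auto
        show "consistent (insert e Rt) P'" by (rule consistent')
        fix e1 assume e1: "e1 \<in> insert e L' - insert e Rt"
        then have "stuck U (fst e1) \<or> stuck U (snd e1)" using st by (auto simp: U_def)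
        moreover have "fst e1 \<in> B" "snd e1 \<in> B" using e1 insert.prems L by auto
        ultimately show "stuck (Us (insert e Rt) P') (fst e1) \<or> stuck (Us (insert e Rt) P') (snd e1)"
          using stm unfolding U'_def by auto
      qed
    qed
  qed
  from main[OF fL order_refl] obtain Rt P where Rt: "Rt \<subseteq> L" "consistent Rt P"
    and st0: "\<forall>e\<in>L - Rt. stuck (Us Rt P) (fst e) \<or> stuck (Us Rt P) (snd e)" by blast
  have st: "stuck (Us Rt P) (fst e) \<or> stuck (Us Rt P) (snd e)" if "e \<in> L - Rt" for e
    using st0 that by (rule bspec)
  define U where "U = Us Rt P"
  have U: "finite U" "card U \<le> card L * l" using cUs[OF Rt] by (auto simp: U_def)
  define B' where "B' = {u \<in> B. \<not> stuck U u}"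
  define P' where "P' e = fst e # P e @ [snd e]" for e
  have inRt: "e \<in> Rt" if "e \<in> L \<inter> B' \<times> B'" for e
  proof (rule ccontr)
    assume "e \<notin> Rt"
    then have "stuck U (fst e) \<or> stuck U (snd e)" using st[of e] that unfolding U_def by blast
    then show False using that by (auto simp: B'_def)
  qed
  have okP: "ok e (P e)" if "e \<in> Rt" for e using that Rt(2) unfolding consistent_def by blast
  have edges: "path_edges (P' e) = {{fst e, hd (P e)}, {last (P e), snd e}} \<union> path_edges (P e)" if "e \<in> Rt" for e
  proof -
    have "P e \<noteq> []" using okP[OF that] by (simp add: ok_def)
    then show ?thesis by (auto simp: P'_def path_edges_Cons path_edges_append)
  qed
  have WB: "W \<inter> B = {}" by (auto simp: W_def)
  have SW: "S u \<subseteq> W" if "u \<in> B" for u using S[OF that] N_sub by (auto simp: W_def)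
  show ?thesis
  proof (intro exI[of _ B'] exI[of _ P'] conjI ballI impI)
    show "B' \<subseteq> B" by (auto simp: B'_def)
    \<comment> \<open>Double counting of pairs of a stuck \<open>u\<close> and a vertex of its star
      in \<open>Zs U\<close>: at least \<open>h * d\<close> for each \<open>u\<close>, at most
      \<open>t\<close> for each star vertex.\<close>
    have "real (card (B - B')) * (h * real d) = (\<Sum>u\<in>B - B'. h * real d)" by simp
    also have "\<dots> \<le> (\<Sum>u\<in>B - B'. real (card (S u \<inter> Zs U)))"
      by (rule sum_mono) (auto simp: B'_def stuck_def)
    also have "\<dots> \<le> (\<Sum>u\<in>B. real (card (S u \<inter> Zs U)))"
      using fB by (intro sum_mono2) auto
    also have "\<dots> = real (\<Sum>u\<in>B. card {w \<in> Zs U \<inter> W. w \<in> S u})"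
    proof -
      have "S u \<inter> Zs U = {w \<in> Zs U \<inter> W. w \<in> S u}" if "u \<in> B" for u using SW[OF that] by auto
      then show ?thesis by simp
    qed
    also have "(\<Sum>u\<in>B. card {w \<in> Zs U \<inter> W. w \<in> S u}) = (\<Sum>w\<in>Zs U \<inter> W. card {u \<in> B. w \<in> S u})"
      using sum_multicount_gen[of "Zs U \<inter> W" B "\<lambda>w u. w \<in> S u" "\<lambda>u. card {w \<in> Zs U \<inter> W. w \<in> S u}"] fB
        fin_sub[OF ZsV] by auto
    also have "real \<dots> \<le> real (\<Sum>w\<in>Zs U \<inter> W. t)"
      unfolding of_nat_le_iff by (rule sum_mono) (use load in \<open>auto simp: W_def\<close>)
    also have "\<dots> \<le> real t * real (card (Zs U))"
      using fin_sub[OF ZsV] by (simp add: mult.commute card_mono mult_left_mono)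
    also have "\<dots> \<le> real t * (2 * zb)" using Zs_card[OF U] by (intro mult_left_mono) auto
    finally show "real (card (B - B')) * (h * real d) \<le> real t * (2 * zb)" .
  next
    fix e assume e: "e \<in> L \<inter> B' \<times> B'"
    then have okP: "ok e (P e)" using inRt okP by blast
    obtain u v where uv: "e = (u, v)" by (cases e)
    have uvB: "u \<in> B" "v \<in> B" "u \<noteq> v" using e uv L by auto
    have "hd (P e) \<in> S u" "last (P e) \<in> S v" using okP uv by (simp_all add: ok_def)
    then have "hd (P e) \<in> N u" "last (P e) \<in> N v" using S[OF uvB(1)] S[OF uvB(2)] by blast+
    moreover from this(2) have "v \<in> N (last (P e))" by (subst N_sym)
    ultimately have "E u (hd (P e))" "E (last (P e)) v" by (simp_all only: in_N)
    moreover have "u \<notin> set (P e)" "v \<notin> set (P e)" using okP uvB WB by (auto simp: ok_def)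
    ultimately show "is_path E (P' e) (fst e) (snd e)"
      using okP uvB uv unfolding is_path_iff_successively P'_def ok_def
      by (auto simp: successively_Cons successively_append_iff)
    have i1: "path_edges (P e) \<subseteq> {{x, y} | x y. x \<in> V - B \<and> y \<in> V - B}"
    proof
      fix f assume f: "f \<in> path_edges (P e)"
      have "successively E (P e)" using okP by (simp add: ok_def)
      from path_edges_successively[OF this f] obtain a b where "f = {a, b}" "a \<in> set (P e)" "b \<in> set (P e)"
        by blast
      then show "f \<in> {{x, y} | x y. x \<in> V - B \<and> y \<in> V - B}" using okP by (auto simp: ok_def W_def)
    qed
    have "{{fst e, hd (P e)}, {last (P e), snd e}} \<subseteq> {{u, x} | u x. u \<in> B \<and> x \<in> S u}"
      using okP uvB uv by (auto simp: ok_def insert_commute)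
    then show "path_edges (P' e) \<subseteq> {{u, x} | u x. u \<in> B \<and> x \<in> S u} \<union> {{x, y} | x y. x \<in> V - B \<and> y \<in> V - B}"
      unfolding edges[OF inRt[OF e]] using i1 by blast
  next
    fix e e' assume *: "e \<in> L \<inter> B' \<times> B'" "e' \<in> L \<inter> B' \<times> B'" "e \<noteq> e'"
    have r: "e \<in> Rt" "e' \<in> Rt" using * inRt by auto
    have ok: "ok e (P e)" "ok e' (P e')" using r okP by blast+
    have disj: "path_edges (P e) \<inter> path_edges (P e') = {}" "stubs P e \<inter> stubs P e' = {}"
      using r Rt(2) *(3) unfolding consistent_def by blast+
    have ends: "fst e \<in> B" "snd e \<in> B" "fst e' \<in> B" "snd e' \<in> B" using * by (auto simp: B'_def)
    have sub: "f \<subseteq> W" if "f \<in> path_edges (P e) \<union> path_edges (P e')" for f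
      using that path_edges_sub ok by (fastforce simp: ok_def)
    have inW: "hd (P e) \<in> W" "last (P e) \<in> W" "hd (P e') \<in> W" "last (P e') \<in> W"
      using ok SW ends by (auto simp: ok_def)
    have notW: "fst e \<notin> W" "snd e \<notin> W" "fst e' \<notin> W" "snd e' \<notin> W" using ends WB by auto
    show "path_edges (P' e) \<inter> path_edges (P' e') = {}"
    proof (rule ccontr)
      assume "\<not> ?thesis"
      then obtain f where f: "f \<in> path_edges (P' e)" "f \<in> path_edges (P' e')" by auto
      \<comment> \<open>A stub edge has exactly one end in \<open>W\<close>. Hence it is never an
        inner edge, and that end recovers the orientation, so equal stub edges come from equal
        stubs.\<close>
      define SE where "SE a = {{u, x} | u x. (u, x) \<in> stubs P a}" for a
      have eq: "path_edges (P' a) = SE a \<union> path_edges (P a)" if "a \<in> Rt" for a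
        unfolding edges[OF that] by (auto simp: SE_def stubs_def insert_commute)
      have SE_notW: "\<not> f \<subseteq> W" if "f \<in> SE e \<union> SE e'"
        using that notW by (auto simp: SE_def stubs_def)
      have "f \<in> SE e \<and> f \<in> SE e'"
        using f sub[of f] SE_notW disj(1) unfolding eq[OF r(1)] eq[OF r(2)] by blast
      then have "f \<in> SE e" "f \<in> SE e'" by blast+
      then obtain u x u' x' where ux: "f = {u, x}" "(u, x) \<in> stubs P e" "f = {u', x'}" "(u', x') \<in> stubs P e'"
        unfolding SE_def by blast
      have "u \<notin> W" "x \<in> W" "u' \<notin> W" "x' \<in> W"
        using ux inW notW by (auto simp: stubs_def)
      then have "(u, x) = (u', x')" using ux by (auto simp: doubleton_eq_iff)
      then show False using ux disj(2) by auto
    qed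
  qed
qed

end

section \<open>Disjoint stars and the moderately sparse case\<close>

context quasirandom
begin

text \<open>At most \<open>b * d / t\<close> vertices lie in \<open>t\<close> stars already. By
  \<open>expansion\<close> few vertices have \<open>h * d\<close> neighbours among these, so a new
  centre is available, and its star omits the saturated vertices.\<close>

lemma spread_stars_greedy:
  assumes h: "0 < h" and hK: "8 \<le> (h * K / 2)\<^sup>2" and t: "0 < t"
    and room: "real b * real d / real t + real b \<le> h * real n / 2" and h1: "h \<le> 1"
  shows "j \<le> b \<Longrightarrow> \<exists>B S. B \<subseteq> V \<and> card B = j \<and> (\<forall>u\<in>B. S u \<subseteq> N u \<and> (1 - h) * real d \<le> real (card (S u))) \<and>
    (\<forall>w\<in>V. card {u \<in> B. w \<in> S u} \<le> t)"
proof (induction j)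
  case 0
  show ?case by (intro exI[of _ "{}"]) auto
next
  case (Suc j)
  then have "j \<le> b" by simp
  from Suc.IH[OF this] obtain B S where B: "B \<subseteq> V" "card B = j"
    and S0: "\<forall>u\<in>B. S u \<subseteq> N u \<and> (1 - h) * real d \<le> real (card (S u))"
    and load0: "\<forall>w\<in>V. card {u \<in> B. w \<in> S u} \<le> t" by blast
  have S: "\<And>u. u \<in> B \<Longrightarrow> S u \<subseteq> N u" "\<And>u. u \<in> B \<Longrightarrow> (1 - h) * real d \<le> real (card (S u))"
    and load: "\<And>w. w \<in> V \<Longrightarrow> card {u \<in> B. w \<in> S u} \<le> t" using S0 load0 by blast+
  have fB: "finite B" using B fin_sub by auto
  define Sat where "Sat = {w \<in> V. t \<le> card {u \<in> B. w \<in> S u}}"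
  have "t * card Sat \<le> (\<Sum>w\<in>Sat. card {u \<in> B. w \<in> S u})"
    using sum_bounded_below[of Sat t "\<lambda>w. card {u \<in> B. w \<in> S u}"] by (auto simp: Sat_def mult.commute)
  also have "\<dots> \<le> (\<Sum>w\<in>V. card {u \<in> B. w \<in> S u})"
    by (rule sum_mono2) (auto simp: Sat_def)
  also have "\<dots> = (\<Sum>u\<in>B. card {w \<in> V. w \<in> S u})"
    using sum_multicount_gen[of V B "\<lambda>w u. w \<in> S u" "\<lambda>u. card {w \<in> V. w \<in> S u}"] fB by auto
  also have "\<dots> \<le> (\<Sum>u\<in>B. d)"
  proof (rule sum_mono)
    fix u assume u: "u \<in> B"
    have "card {w \<in> V. w \<in> S u} \<le> card (N u)" using S(1)[OF u] by (intro card_mono) auto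
    then show "card {w \<in> V. w \<in> S u} \<le> d" using card_N u B by auto
  qed
  also have "\<dots> \<le> b * d" using Suc.prems B by simp
  finally have "real (t * card Sat) \<le> real (b * d)" unfolding of_nat_le_iff .
  then have Sat: "real (card Sat) \<le> real b * real d / real t"
    using t by (simp add: pos_le_divide_eq mult.commute)
  define Q where "Q = Sat"
  define Bad where "Bad = {u \<in> V. h * real d \<le> real (card (N u \<inter> Q))}"
  have QV: "Q \<subseteq> V" by (auto simp: Q_def Sat_def)
  have "real (card Bad) * (h * K / 2)\<^sup>2 \<le> real (card Q)"
  proof (rule expansion)
    show "real (card Q) \<le> h * real n / 2" unfolding Q_def using Sat room of_nat_0_le_iff[of b] by linarith
  qed (use QV h in \<open>auto simp: Bad_def\<close>)
  moreover have "real (card Bad) * 8 \<le> real (card Bad) * (h * K / 2)\<^sup>2"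
    using hK by (intro mult_left_mono) auto
  moreover have "real (card Q) \<le> real n" using card_sub[OF QV] by simp
  ultimately have "real (card Bad) * 8 \<le> real n" by linarith
  moreover have "real j \<le> h * real n / 2"
  proof -
    have "0 \<le> real b * real d / real t" by simp
    moreover have "real j \<le> real b" using Suc.prems by simp
    ultimately show ?thesis using room by linarith
  qed
  moreover have "h * real n \<le> 1 * real n" using h1 by (intro mult_right_mono) auto
  ultimately have "real (card (Bad \<union> B)) < real n"
    using card_Un_le[of Bad B] B n_pos by linarith
  then have "card (Bad \<union> B) < card V" by simp
  then have "\<not> V \<subseteq> Bad \<union> B" using B card_mono[of "Bad \<union> B" V] by (auto simp: Bad_def fB)
  then obtain u where u: "u \<in> V" "u \<notin> Bad" "u \<notin> B" by auto
  define S' where "S' = S(u := N u - Sat)"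
  have cu: "real (card (N u \<inter> Sat)) < h * real d" using u by (auto simp: Bad_def Q_def)
  have "card (N u) = card (N u \<inter> Sat) + card (N u - Sat)"
    by (simp add: card_Diff_subset_Int) (metis card_mono fin_N inf_le1 le_add_diff_inverse)
  then have "real (card (N u - Sat)) = real d - real (card (N u \<inter> Sat))"
    using card_N[OF u(1)] by linarith
  then have c2: "(1 - h) * real d \<le> real (card (N u - Sat))" using cu by (simp add: algebra_simps)
  show ?case
  proof (intro exI[of _ "insert u B"] exI[of _ S'] conjI ballI)
    show "insert u B \<subseteq> V" using u B by auto
    show "card (insert u B) = Suc j" using u B fB by simp
    fix v assume v: "v \<in> insert u B"
    show "S' v \<subseteq> N v" using v S u by (auto simp: S'_def)
    show "(1 - h) * real d \<le> real (card (S' v))" using v S u c2 by (auto simp: S'_def)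
  next
    fix w assume w: "w \<in> V"
    have "{v \<in> insert u B. w \<in> S' v} = (if w \<in> N u - Sat then insert u {v \<in> B. w \<in> S v} else {v \<in> B. w \<in> S v})"
      using u by (auto simp: S'_def)
    moreover have "w \<in> N u - Sat \<Longrightarrow> card {v \<in> B. w \<in> S v} < t" using w by (auto simp: Sat_def)
    moreover have "card (insert u {v \<in> B. w \<in> S v}) \<le> Suc (card {v \<in> B. w \<in> S v})"
      by (rule card_insert_le_m1) auto
    ultimately show "card {v \<in> insert u B. w \<in> S' v} \<le> t" using load[OF w] by auto
  qed
qed

text \<open>Stars must also avoid \<open>B\<close>. By \<open>expansion\<close> at most
  \<open>h * d\<close> centres have \<open>h * d\<close> neighbours in \<open>B\<close>; these are
  dropped, and every other star loses at most \<open>h * d\<close> vertices.\<close>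

lemma spread_stars:
  assumes h: "0 < h" "h \<le> 1" and hK: "8 \<le> (h * K / 2)\<^sup>2" "8 \<le> h * (h * K / 2)\<^sup>2" and t: "0 < t"
    and room: "real b * real d / real t + real b \<le> h * real n / 2" and b: "b \<le> d"
  shows "\<exists>B S. B \<subseteq> V \<and> real b - h * real d \<le> real (card B) \<and> card B \<le> b \<and>
    (\<forall>u\<in>B. S u \<subseteq> N u - B \<and> (1 - 2 * h) * real d \<le> real (card (S u))) \<and>
    (\<forall>w\<in>V. card {u \<in> B. w \<in> S u} \<le> t)"
proof -
  from spread_stars_greedy[OF h(1) hK(1) t room h(2) order_refl] obtain B S where B: "B \<subseteq> V" "card B = b"
    and S0: "\<forall>u\<in>B. S u \<subseteq> N u \<and> (1 - h) * real d \<le> real (card (S u))"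
    and load0: "\<forall>w\<in>V. card {u \<in> B. w \<in> S u} \<le> t" by blast
  have S: "\<And>u. u \<in> B \<Longrightarrow> S u \<subseteq> N u" "\<And>u. u \<in> B \<Longrightarrow> (1 - h) * real d \<le> real (card (S u))"
    and load: "\<And>w. w \<in> V \<Longrightarrow> card {u \<in> B. w \<in> S u} \<le> t" using S0 load0 by blast+
  have fB: "finite B" using B fin_sub by auto
  define Bad where "Bad = {u \<in> V. h * real d \<le> real (card (N u \<inter> B))}"
  have "real (card Bad) * (h * K / 2)\<^sup>2 \<le> real (card B)"
  proof (rule expansion)
    have "0 \<le> real b * real d / real t" by simp
    then show "real (card B) \<le> h * real n / 2" using B room by linarith
  qed (use B h in \<open>auto simp: Bad_def\<close>)
  then have "h * (real (card Bad) * (h * K / 2)\<^sup>2) \<le> h * real b" using h B by simp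
  moreover have "real (card Bad) * 8 \<le> real (card Bad) * (h * (h * K / 2)\<^sup>2)"
    using hK by (intro mult_left_mono) auto
  moreover have "h * real b \<le> h * real d" using h b by simp
  moreover have "h * (real (card Bad) * (h * K / 2)\<^sup>2) = real (card Bad) * (h * (h * K / 2)\<^sup>2)" by simp
  moreover have "0 \<le> real (card Bad)" by simp
  ultimately have bad: "real (card Bad) \<le> h * real d" by linarith
  define B' where "B' = B - Bad"
  show ?thesis
  proof (intro exI[of _ B'] exI[of _ "\<lambda>u. S u - B"] conjI ballI)
    show "B' \<subseteq> V" using B by (auto simp: B'_def)
    have "finite Bad" by (auto simp: Bad_def)
    then have "card B - card Bad \<le> card B'" unfolding B'_def by (rule diff_card_le_card_Diff)
    then show "real b - h * real d \<le> real (card B')" using bad B by linarith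
    show "card B' \<le> b" using B fB by (auto simp: B'_def intro: card_mono)
    fix u assume u: "u \<in> B'"
    then have uB: "u \<in> B" "u \<notin> Bad" "u \<in> V" using B by (auto simp: B'_def)
    show "S u - B \<subseteq> N u - B'" using S uB by (auto simp: B'_def)
    have "card (S u \<inter> B) \<le> card (N u \<inter> B)" using S uB by (intro card_mono) auto
    then have "real (card (S u \<inter> B)) \<le> h * real d" using uB by (auto simp: Bad_def)
    moreover have "finite (S u)" using S uB finite_subset fin_N by blast
    then have "card (S u) = card (S u \<inter> B) + card (S u - B)"
      by (simp add: card_Diff_subset_Int) (metis card_mono inf_le1 le_add_diff_inverse)
    ultimately show "(1 - 2 * h) * real d \<le> real (card (S u - B))"
      using S(2)[OF uB(1)] by (simp add: algebra_simps)
  next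
    fix w assume w: "w \<in> V"
    have "card {u \<in> B'. w \<in> S u - B} \<le> card {u \<in> B. w \<in> S u}"
      using fB by (intro card_mono) (auto simp: B'_def)
    then show "card {u \<in> B'. w \<in> S u - B} \<le> t" using load[OF w] by simp
  qed
qed


text \<open>All pairs of branch vertices are routed. \<open>room\<close> asks for a large
  \<open>t\<close>, so that the stars fit into the graph; the bound on
  \<open>66 * t * (2 * k + 5)\<close> asks for a small one, so that the avoided set, of size at most
  \<open>66 * d * l\<close>, makes at most \<open>g * d\<close> centres stuck.\<close>

lemma middle_immersion:
  assumes g: "0 < g" "g \<le> 1" and gK: "8 \<le> (g * K / 2)\<^sup>2" "8 \<le> g * (g * K / 2)\<^sup>2" and K: "2048 \<le> K"
    and b: "real b \<le> (1 - 3 * g) * real d"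
    and k: "n \<le> 2 ^ k * d" and n: "4096 * d * (2 * k + 5) \<le> n"
    and t: "0 < t" "66 * real t * real (2 * k + 5) \<le> g\<^sup>2 * real d"
    and room: "2 * ((real d)\<^sup>2 / real t + real d) \<le> g * real n"
    and m: "real m \<le> real b - 2 * g * real d"
  shows "has_complete_immersion n E m"
proof -
  have d0: "1 \<le> real d" using d_pos by simp
  have b_le: "b \<le> d"
  proof -
    have "(1 - 3 * g) * real d \<le> 1 * real d" using g by (intro mult_right_mono) auto
    then show ?thesis using b by simp
  qed
  have room': "real b * real d / real t + real b \<le> g * real n / 2"
  proof -
    have "real b * real d / real t \<le> (real d)\<^sup>2 / real t"
      using b_le t(1) unfolding power2_eq_square by (intro divide_right_mono mult_right_mono) auto
    moreover have "real b \<le> real d" using b_le by simp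
    ultimately have "real b * real d / real t + real b \<le> (real d)\<^sup>2 / real t + real d" by (rule add_mono)
    also have "\<dots> \<le> g * real n / 2" using room unfolding distrib_left by linarith
    finally show ?thesis .
  qed
  from spread_stars[OF g gK t(1) room' b_le]
  obtain B S where B: "B \<subseteq> V" "real b - g * real d \<le> real (card B)" "card B \<le> b"
    and S0: "\<forall>u\<in>B. S u \<subseteq> N u - B \<and> (1 - 2 * g) * real d \<le> real (card (S u))"
    and load: "\<forall>w\<in>V. card {u \<in> B. w \<in> S u} \<le> t" by blast
  have S: "S u \<subseteq> N u - B" "(1 - 2 * g) * real d \<le> real (card (S u))" if "u \<in> B" for u
    using bspec[OF S0 that] by blast+
  have fB: "finite B" using B fin_sub by auto
  define L where "L = {e \<in> B \<times> B. fst e < snd e}"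
  have cL: "card L \<le> d\<^sup>2"
  proof -
    have "card L \<le> card (B \<times> B)" using fB by (intro card_mono) (auto simp: L_def)
    also have "\<dots> = card B * card B" by (rule card_cartesian_product)
    also have "\<dots> \<le> d * d" using B(3) b_le by (intro mult_mono) auto
    finally show ?thesis by (simp add: power2_eq_square)
  qed
  have cLr: "real (card L) \<le> (real d)\<^sup>2"
  proof -
    have "real (card L) \<le> real (d\<^sup>2)" unfolding of_nat_le_iff by (rule cL)
    then show ?thesis by simp
  qed
  define l where "l = real (2 * k + 5)"
  have l1: "1 \<le> l" "real (2 * k + 4) \<le> l" by (simp_all add: l_def)
  have nl: "4096 * (real d * l) \<le> real n"
  proof -
    have "real (4096 * d * (2 * k + 5)) \<le> real n" unfolding of_nat_le_iff by (rule n)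
    then show ?thesis unfolding l_def by (simp only: of_nat_mult of_nat_numeral mult.assoc)
  qed
  have dl: "real d \<le> real d * l" using d0 l1 by simp
  have dn: "2 * real d \<le> real n * (3 / 4)" using nl dl d0 by linarith
  \<comment> \<open>A poor vertex has at least \<open>3 / 4 * d\<close> neighbours in
    \<open>B\<close>, a set of at most \<open>d\<close> elements, so \<open>expansion\<close> leaves
    at most \<open>d\<close> poor vertices.\<close>
  define qb where "qb = real d"
  define zb where "zb = qb + 16 * real (card L) * real (2 * k + 4) / (1 / 2 * real d)"
  have zb_le: "zb \<le> 33 * (real d * l)"
  proof -
    have "16 * real (card L) * real (2 * k + 4) \<le> 16 * (real d)\<^sup>2 * l"
      using cLr l1 by (intro mult_mono) auto
    then have "16 * real (card L) * real (2 * k + 4) / (1 / 2 * real d) \<le> 16 * (real d)\<^sup>2 * l / (1 / 2 * real d)"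
      using d0 by (intro divide_right_mono) auto
    also have "\<dots> = 32 * (real d * l)" using d0 by (simp add: power2_eq_square)
    finally show ?thesis using dl unfolding zb_def qb_def by linarith
  qed
  have "\<exists>B' P. B' \<subseteq> B \<and> real (card (B - B')) * (g * real d) \<le> real t * (2 * zb) \<and>
    (\<forall>e\<in>L \<inter> B' \<times> B'. is_path E (P e) (fst e) (snd e) \<and>
      path_edges (P e) \<subseteq> {{u, x} | u x. u \<in> B \<and> x \<in> S u} \<union> {{x, y} | x y. x \<in> V - B \<and> y \<in> V - B}) \<and>
    (\<forall>e\<in>L \<inter> B' \<times> B'. \<forall>e'\<in>L \<inter> B' \<times> B'. e \<noteq> e' \<longrightarrow> path_edges (P e) \<inter> path_edges (P e') = {})"
  proof (rule routing[OF B(1) _ g(1), where \<omega> = "1 / 2" and k = k and qb = qb])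
    have K32: "64\<^sup>2 \<le> (1 / 2 / 8 * K / 2)\<^sup>2" using K by (intro power_mono) auto
    then show "2 \<le> (1 / 2 / 8 * K / 2)\<^sup>2" by simp
    have "2048\<^sup>2 \<le> K\<^sup>2" using K by (intro power_mono) auto
    then show "32 \<le> K\<^sup>2 * (1 / 2 / 8) ^ 3" by (simp add: power3_eq_cube)
    show "L \<subseteq> B \<times> B" by (auto simp: L_def)
    show "u \<noteq> v" if "(u, v) \<in> L" for u v using that by (auto simp: L_def)
    show "S u \<subseteq> N u - B" if "u \<in> B" for u by (rule S(1)[OF that])
    show "real (card {e \<in> L. fst e = u \<or> snd e = u}) + g * real d \<le> real (card (S u))" if u: "u \<in> B" for u
    proof -
      have "inj_on (\<lambda>e. if fst e = u then snd e else fst e) {e \<in> L. fst e = u \<or> snd e = u}"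
        by (auto simp: inj_on_def L_def)
      then have "card {e \<in> L. fst e = u \<or> snd e = u} \<le> card B"
        by (rule card_inj_on_le) (use fB in \<open>auto simp: L_def\<close>)
      then have "real (card {e \<in> L. fst e = u \<or> snd e = u}) \<le> (1 - 3 * g) * real d" using B(3) b by linarith
      moreover have "(1 - 3 * g) * real d + g * real d = (1 - 2 * g) * real d" by (simp add: algebra_simps)
      ultimately show ?thesis using S(2)[OF u] by linarith
    qed
    show "card {u \<in> B. w \<in> S u} \<le> t" if "w \<in> V - B" for w using load that by blast
    show "real (card {w \<in> V - B. real (card (N w - B)) < 1 / 2 / 2 * real d}) \<le> qb"
    proof -
      define Q where "Q = {w \<in> V - B. real (card (N w - B)) < 1 / 2 / 2 * real d}"
      have QV: "Q \<subseteq> V" by (auto simp: Q_def)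
      have "real (card Q) * (3 / 4 * K / 2)\<^sup>2 \<le> real (card B)"
      proof (rule expansion[OF QV B(1)])
        fix w assume w: "w \<in> Q"
        have "card (N w) = card (N w \<inter> B) + card (N w - B)" using card_Int_Diff[OF fin_N] .
        then have "real d = real (card (N w \<inter> B)) + real (card (N w - B))" using card_N[of w] w QV by auto
        moreover have "real (card (N w - B)) < 1 / 2 / 2 * real d" using w by (simp add: Q_def)
        ultimately show "3 / 4 * real d \<le> real (card (N w \<inter> B))" by linarith
      next
        show "real (card B) \<le> 3 / 4 * real n / 2" using B(3) b_le dn by linarith
      qed simp
      moreover have "1\<^sup>2 \<le> (3 / 4 * K / 2)\<^sup>2" using K by (intro power_mono) auto
      then have "real (card Q) * 1 \<le> real (card Q) * (3 / 4 * K / 2)\<^sup>2" by (intro mult_left_mono) auto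
      ultimately have "real (card Q) \<le> real d" using B(3) b_le by linarith
      then show ?thesis by (simp add: Q_def qb_def)
    qed
    show "n \<le> 2 ^ k * d" by (rule k)
    show "zb = qb + 16 * real (card L) * real (2 * k + 4) / (1 / 2 * real d)" by (rule zb_def)
    show "2 * zb + 1 \<le> 1 / 2 / 8 * real n / 2" using zb_le nl dl d0 by linarith
    show "real (card L) * real (2 * k + 4) < (1 / 2 / 8)\<^sup>2 * real n * real d / 8"
    proof -
      have "real (card L) * real (2 * k + 4) \<le> (real d)\<^sup>2 * l" using cLr l1 by (intro mult_mono) auto
      also have "\<dots> = (real d * l) * real d" by (simp add: power2_eq_square)
      also have "\<dots> \<le> (real n / 4096) * real d" using nl by (intro mult_right_mono) auto
      also have "\<dots> < (1 / 2 / 8)\<^sup>2 * real n * real d / 8" using n_pos d_pos by (simp add: power2_eq_square)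
      finally show ?thesis .
    qed
  qed simp
  then obtain B' P where B': "B' \<subseteq> B" "real (card (B - B')) * (g * real d) \<le> real t * (2 * zb)"
    and P: "\<forall>e\<in>L \<inter> B' \<times> B'. is_path E (P e) (fst e) (snd e) \<and>
      path_edges (P e) \<subseteq> {{u, x} | u x. u \<in> B \<and> x \<in> S u} \<union> {{x, y} | x y. x \<in> V - B \<and> y \<in> V - B}"
    and D: "\<forall>e\<in>L \<inter> B' \<times> B'. \<forall>e'\<in>L \<inter> B' \<times> B'. e \<noteq> e' \<longrightarrow> path_edges (P e) \<inter> path_edges (P e') = {}"
    by blast
  have drop: "real (card (B - B')) \<le> g * real d"
  proof -
    have "real t * (2 * zb) \<le> real t * (66 * (real d * l))"
      by (intro mult_left_mono) (use zb_le in linarith, simp)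
    also have "\<dots> = (66 * real t * l) * real d" by simp
    also have "\<dots> \<le> (g\<^sup>2 * real d) * real d" using t(2) unfolding l_def by (intro mult_right_mono) auto
    finally have "real (card (B - B')) * (g * real d) \<le> (g * real d) * (g * real d)"
      using B'(2) by (simp add: power2_eq_square mult_ac)
    then show ?thesis using g d_pos by simp
  qed
  have inL: "(u, v) \<in> L \<inter> B' \<times> B'" if "u \<in> B'" "v \<in> B'" "u < v" for u v
    using that B'(1) by (auto simp: L_def)
  show ?thesis
  proof (rule complete_immersionI[of B' n m E "\<lambda>u v. P (u, v)"])
    show "B' \<subseteq> {..<n}" using B' B by auto
    have "card B = card (B - B') + card B'"
      using fB B'(1) by (simp add: card_Diff_subset card_mono finite_subset)
    then have "real b - g * real d - g * real d \<le> real (card B')" using B(2) drop by linarith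
    then show "m \<le> card B'" using m by simp
    show "is_path E (P (u, v)) u v" if "u \<in> B'" "v \<in> B'" "u < v" for u v
      using bspec[OF P inL[OF that]] by simp
    show "path_edges (P (u, v)) \<inter> path_edges (P (u', v')) = {}"
      if "u \<in> B'" "v \<in> B'" "u < v" "u' \<in> B'" "v' \<in> B'" "u' < v'" "(u, v) \<noteq> (u', v')" for u v u' v'
      using bspec[OF bspec[OF D inL[OF that(1-3)]] inL[OF that(4-6)]] that(7) by blast
  qed
qed

end

section \<open>Extendable forests and the very sparse case\<close>

context quasirandom
begin

definition nbrs_set :: "nat set \<Rightarrow> nat set" where
  "nbrs_set X = (\<Union>x\<in>X. N x)"

definition out_arcs :: "(nat \<times> nat) set \<Rightarrow> nat set \<Rightarrow> nat" where
  "out_arcs F X = card {a \<in> F. fst a \<in> X}"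

text \<open>\<open>O'\<close> is the set of initially occupied vertices, \<open>F\<close> the set of (parent, child) arcs of the forest
  grown so far, and \<open>r x\<close> the total number of children \<open>x\<close> may ever have. Counting the children already
  present on the right-hand side makes the condition hereditary in \<open>F\<close>.\<close>

definition extendable :: "nat set \<Rightarrow> (nat \<Rightarrow> nat) \<Rightarrow> nat \<Rightarrow> (nat \<times> nat) set \<Rightarrow> bool" where
  "extendable O' r m F \<longleftrightarrow> finite F \<and> inj_on snd F \<and> snd ` F \<inter> O' = {} \<and> (\<forall>(x, y) \<in> F. E x y) \<and>
     (\<forall>X \<subseteq> V. card X \<le> 2 * m \<longrightarrow> (\<Sum>x\<in>X. r x) \<le> card (nbrs_set X - (O' \<union> snd ` F)) + out_arcs F X)"

lemma nbrs_set_sub: "nbrs_set X \<subseteq> V"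
  using N_sub by (auto simp: nbrs_set_def)

lemma fin_nbrs_set [simp]: "finite (nbrs_set X)"
  using nbrs_set_sub fin_sub by blast

lemma extendable_new_disjoint:
  assumes "extendable O' r m G" "A \<subseteq> G"
  shows "snd ` (G - A) \<inter> (O' \<union> snd ` A) = {}"
proof -
  have "snd a \<notin> snd ` A" if a: "a \<in> G - A" for a
  proof
    assume "snd a \<in> snd ` A"
    then obtain a' where a': "a' \<in> A" "snd a = snd a'" by blast
    have "inj_on snd G" using assms(1) by (simp add: extendable_def)
    then have "a = a'" using a a' assms(2) by (meson DiffD1 inj_onD subsetD)
    then show False using a a' by blast
  qed
  then have "snd ` (G - A) \<inter> snd ` A = {}" by blast
  moreover have "snd ` (G - A) \<inter> O' = {}" using assms(1) unfolding extendable_def by blast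
  ultimately show ?thesis by blast
qed

lemma extendable_subset:
  assumes F: "extendable O' r m F" and F': "F' \<subseteq> F"
  shows "extendable O' r m F'"
  unfolding extendable_def
proof (intro conjI allI impI)
  show fin: "finite F'" using F F' finite_subset by (auto simp: extendable_def)
  show "inj_on snd F'" using F F' unfolding extendable_def by (meson inj_on_subset)
  show "snd ` F' \<inter> O' = {}" using F F' unfolding extendable_def by blast
  show "\<forall>(x, y)\<in>F'. E x y" using F F' unfolding extendable_def by blast
  fix X assume X: "X \<subseteq> V" "card X \<le> 2 * m"
  define D where "D = {a \<in> F - F'. fst a \<in> X}"
  have finF: "finite F" using F by (simp add: extendable_def)
  have fD: "finite D" using finF by (auto simp: D_def)
  have "out_arcs F X = out_arcs F' X + card D"
  proof -
    have "{a \<in> F. fst a \<in> X} = {a \<in> F'. fst a \<in> X} \<union> D" using F' by (auto simp: D_def)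
    then show ?thesis unfolding out_arcs_def using fin fD by (simp add: card_Un_disjoint D_def Int_def)
  qed
  moreover have "card (nbrs_set X - (O' \<union> snd ` F)) + card D \<le> card (nbrs_set X - (O' \<union> snd ` F'))"
  proof -
    have "card (snd ` D) = card D"
      using F by (intro card_image) (auto simp: extendable_def D_def inj_on_def)
    moreover have "(nbrs_set X - (O' \<union> snd ` F)) \<inter> snd ` D = {}" by (auto simp: D_def)
    then have "card ((nbrs_set X - (O' \<union> snd ` F)) \<union> snd ` D) = card (nbrs_set X - (O' \<union> snd ` F)) + card (snd ` D)"
      using fD by (intro card_Un_disjoint) auto
    moreover have "(nbrs_set X - (O' \<union> snd ` F)) \<union> snd ` D \<subseteq> nbrs_set X - (O' \<union> snd ` F')"
    proof -
      have "snd ` D \<subseteq> nbrs_set X" using F by (force simp: D_def extendable_def nbrs_set_def nbrs_def)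
      moreover have "snd ` D \<inter> (O' \<union> snd ` F') = {}"
        using extendable_new_disjoint[OF F F'] by (auto simp: D_def)
      ultimately show ?thesis using F' by blast
    qed
    then have "card ((nbrs_set X - (O' \<union> snd ` F)) \<union> snd ` D) \<le> card (nbrs_set X - (O' \<union> snd ` F'))"
      by (intro card_mono) auto
    ultimately show ?thesis by linarith
  qed
  moreover have "(\<Sum>x\<in>X. r x) \<le> card (nbrs_set X - (O' \<union> snd ` F)) + out_arcs F X" using F X by (auto simp: extendable_def)
  ultimately show "(\<Sum>x\<in>X. r x) \<le> card (nbrs_set X - (O' \<union> snd ` F')) + out_arcs F' X" by linarith
qed

text \<open>If every candidate \<open>y\<close> fails, each is adjacent to a critical (tight) set
  that avoids \<open>x\<close>. By submodularity critical sets are closed under union, so a single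
  one is adjacent to all free neighbours of \<open>x\<close>. Adding \<open>x\<close> to it raises
  the demand by \<open>r x\<close> but the supply only by \<open>out_arcs F {x}\<close>, a
  contradiction.\<close>

lemma extendable_step:
  assumes F: "extendable O' r m F" and m: "1 \<le> m"
    and big: "\<And>X. X \<subseteq> V \<Longrightarrow> m \<le> card X \<Longrightarrow> card X \<le> 2 * m \<Longrightarrow> (\<Sum>x\<in>X. r x) < card (nbrs_set X - (O' \<union> snd ` F))"
    and x: "x \<in> V" "out_arcs F {x} < r x"
  shows "\<exists>y. E x y \<and> y \<notin> O' \<union> snd ` F \<and> extendable O' r m (insert (x, y) F)"
proof (rule ccontr)
  assume none: "\<not> ?thesis"
  define Y where "Y = O' \<union> snd ` F"
  define f where "f X = card (nbrs_set X - Y)" for X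
  define crit where "crit X \<longleftrightarrow> X \<subseteq> V \<and> card X \<le> 2 * m \<and> f X + out_arcs F X \<le> (\<Sum>x\<in>X. r x)" for X
  have finF: "finite F" using F by (simp add: extendable_def)
  have extD: "(\<Sum>x\<in>X. r x) \<le> f X + out_arcs F X" if "X \<subseteq> V" "card X \<le> 2 * m" for X
    using F that by (auto simp: extendable_def f_def Y_def)
  \<comment> \<open>The strict inequality \<open>big\<close> excludes critical sets with
    \<open>m\<close> to \<open>2 * m\<close> elements. A union of two critical sets thus stays
    within \<open>2 * m\<close>, where extendability still applies.\<close>
  have small: "card X < m" if "crit X" for X
    using that big[of X] by (force simp: crit_def f_def Y_def)
  have out_arcs_modular: "out_arcs F (X \<union> X') + out_arcs F (X \<inter> X') = out_arcs F X + out_arcs F X'" for X X'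
  proof -
    have "{a \<in> F. fst a \<in> X \<union> X'} = {a \<in> F. fst a \<in> X} \<union> {a \<in> F. fst a \<in> X'}"
      "{a \<in> F. fst a \<in> X \<inter> X'} = {a \<in> F. fst a \<in> X} \<inter> {a \<in> F. fst a \<in> X'}" by auto
    then show ?thesis unfolding out_arcs_def using finF by (simp add: card_Un_Int[symmetric])
  qed
  have crit_Un: "crit (X \<union> X')" if c: "crit X" "crit X'" for X X'
  proof -
    have XV: "X \<subseteq> V" "X' \<subseteq> V" using c by (auto simp: crit_def)
    have fX: "finite X" "finite X'" using XV fin_sub by auto
    have "card (X \<union> X') \<le> 2 * m" using small[OF c(1)] small[OF c(2)] card_Un_le[of X X'] by linarith
    moreover have "f (X \<union> X') + f (X \<inter> X') \<le> f X + f X'"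
    proof -
      have "nbrs_set (X \<union> X') - Y = (nbrs_set X - Y) \<union> (nbrs_set X' - Y)" by (auto simp: nbrs_set_def)
      moreover have "card (nbrs_set (X \<inter> X') - Y) \<le> card ((nbrs_set X - Y) \<inter> (nbrs_set X' - Y))"
        by (intro card_mono finite_Int disjI1 finite_Diff fin_nbrs_set) (auto simp: nbrs_set_def)
      ultimately show ?thesis unfolding f_def using card_Un_Int[of "nbrs_set X - Y" "nbrs_set X' - Y"] by simp
    qed
    moreover have "(\<Sum>x\<in>X \<union> X'. r x) + (\<Sum>x\<in>X \<inter> X'. r x) = (\<Sum>x\<in>X. r x) + (\<Sum>x\<in>X'. r x)"
      using fX by (rule sum.union_inter)
    moreover have "(\<Sum>x\<in>X \<inter> X'. r x) \<le> f (X \<inter> X') + out_arcs F (X \<inter> X')"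
    proof (rule extD)
      show "X \<inter> X' \<subseteq> V" using XV by auto
      have "card (X \<inter> X') \<le> card X" using fX by (intro card_mono) auto
      then show "card (X \<inter> X') \<le> 2 * m" using small[OF c(1)] by linarith
    qed
    ultimately show ?thesis using c out_arcs_modular[of X X'] XV unfolding crit_def by auto
  qed
  \<comment> \<open>Occupying \<open>y\<close> costs the inequality of \<open>X\<close> at most one,
    and only if \<open>y\<close> is adjacent to \<open>X\<close>. So the violated inequality was
    tight before, and \<open>x\<close> is not in \<open>X\<close>, since the new arc would have paid
    for \<open>y\<close>.\<close>
  have witness: "\<exists>X. crit X \<and> x \<notin> X \<and> y \<in> nbrs_set X" if y: "y \<in> N x - Y" for y
  proof -
    have yF: "y \<notin> snd ` F" "y \<notin> O'" using y by (auto simp: Y_def)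
    have xyF: "(x, y) \<notin> F" using yF by force
    have "\<not> extendable O' r m (insert (x, y) F)" using none y by (auto simp: Y_def nbrs_def)
    moreover have "inj_on snd (insert (x, y) F)" using F yF by (auto simp: extendable_def)
    ultimately obtain X where X: "X \<subseteq> V" "card X \<le> 2 * m"
      and viol: "card (nbrs_set X - (O' \<union> snd ` insert (x, y) F)) + out_arcs (insert (x, y) F) X < (\<Sum>x\<in>X. r x)"
      using F yF y unfolding extendable_def nbrs_def by (auto simp: not_le)
    have eq: "nbrs_set X - (O' \<union> snd ` insert (x, y) F) = (nbrs_set X - Y) - {y}" by (auto simp: Y_def)
    have ge: "f X \<le> Suc (card ((nbrs_set X - Y) - {y}))" unfolding f_def by (simp add: card_Diff_singleton_if) arith
    have "x \<notin> X"
    proof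
      assume "x \<in> X"
      then have "{a \<in> insert (x, y) F. fst a \<in> X} = insert (x, y) {a \<in> F. fst a \<in> X}" by auto
      then have "out_arcs (insert (x, y) F) X = Suc (out_arcs F X)" using finF xyF by (simp add: out_arcs_def)
      then show False using viol ge extD[OF X] unfolding eq by linarith
    qed
    then have o: "out_arcs (insert (x, y) F) X = out_arcs F X" unfolding out_arcs_def by (metis fst_conv insert_iff)
    have "y \<in> nbrs_set X"
    proof (rule ccontr)
      assume "y \<notin> nbrs_set X"
      then have "(nbrs_set X - Y) - {y} = nbrs_set X - Y" by auto
      then show False using viol extD[OF X] o unfolding eq f_def by simp
    qed
    moreover have "crit X" using X viol ge o unfolding eq crit_def by linarith
    ultimately show ?thesis using \<open>x \<notin> X\<close> by auto
  qed
  have "\<exists>X. crit X \<and> x \<notin> X \<and> D \<subseteq> nbrs_set X" if "finite D" "D \<subseteq> N x - Y" for D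
    using that
  proof (induction D rule: finite_induct)
    case empty
    have "crit {}" by (simp add: crit_def f_def nbrs_set_def out_arcs_def)
    then show ?case by auto
  next
    case (insert y D)
    then obtain X where X: "crit X" "x \<notin> X" "D \<subseteq> nbrs_set X" by auto
    obtain X' where X': "crit X'" "x \<notin> X'" "y \<in> nbrs_set X'" using witness[of y] insert.prems by auto
    have "insert y D \<subseteq> nbrs_set (X \<union> X')" using X X' by (auto simp: nbrs_set_def)
    then show ?case using crit_Un[OF X(1) X'(1)] X X' by (intro exI[of _ "X \<union> X'"]) auto
  qed
  from this[of "N x - Y"] obtain X where X: "crit X" "x \<notin> X" "N x - Y \<subseteq> nbrs_set X" by auto
  have fX: "finite X" using X fin_sub by (auto simp: crit_def)
  have "nbrs_set (insert x X) - Y = nbrs_set X - Y" using X(3) by (auto simp: nbrs_set_def)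
  then have "f (insert x X) = f X" by (simp add: f_def)
  moreover have "out_arcs F (insert x X) = out_arcs F X + out_arcs F {x}"
    using out_arcs_modular[of "{x}" X] X(2) by (simp add: out_arcs_def)
  moreover have "(\<Sum>x\<in>insert x X. r x) \<le> f (insert x X) + out_arcs F (insert x X)"
    using X x small[OF X(1)] fX m by (intro extD) (auto simp: crit_def)
  moreover have "f X + out_arcs F X \<le> (\<Sum>x\<in>X. r x)" using X by (simp add: crit_def)
  ultimately show False using x fX X(2) by simp
qed

text \<open>The demand that \<open>extendable_step\<close> makes on large sets, uniform over forests
  with at most \<open>M\<close> arcs so that it survives iteration. Two children per new vertex
  allow binary trees.\<close>

definition roomy :: "nat set \<Rightarrow> (nat \<Rightarrow> nat) \<Rightarrow> nat \<Rightarrow> nat \<Rightarrow> bool" where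
  "roomy O' r m M \<longleftrightarrow> 1 \<le> m \<and> (\<forall>y\<in>V - O'. r y = 2) \<and>
     (\<forall>F X. extendable O' r m F \<longrightarrow> card F \<le> M \<longrightarrow> X \<subseteq> V \<longrightarrow> m \<le> card X \<longrightarrow> card X \<le> 2 * m \<longrightarrow>
        (\<Sum>x\<in>X. r x) < card (nbrs_set X - (O' \<union> snd ` F)))"

text \<open>A binary tree of depth \<open>h\<close> below \<open>x\<close>, with
  \<open>2 ^ Suc h - 2\<close> arcs, is grown one subtree after the other. Its root-to-leaf paths
  run along new arcs only, so one of them can later be kept without the rest. Since arcs start only
  in \<open>O'\<close> or at children of earlier arcs, a fresh vertex has no arcs yet.\<close>

lemma extendable_grow:
  assumes roomy: "roomy O' r m M"
  shows "extendable O' r m F \<Longrightarrow> x \<in> V \<Longrightarrow> x \<in> O' \<union> snd ` F \<Longrightarrow> fst ` F \<subseteq> O' \<union> snd ` F \<Longrightarrow> out_arcs F {x} + 2 \<le> r x \<Longrightarrow>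
    card F + 2 ^ Suc h \<le> M \<Longrightarrow>
    \<exists>F' Lf. F \<subseteq> F' \<and> extendable O' r m F' \<and> card F' + 2 \<le> card F + 2 ^ Suc h \<and>
      fst ` (F' - F) \<subseteq> insert x (snd ` (F' - F)) \<and> finite Lf \<and> 2 ^ h \<le> card Lf \<and> Lf \<subseteq> insert x (snd ` (F' - F)) \<and>
      (\<forall>l\<in>Lf. \<exists>q. q \<noteq> [] \<and> hd q = x \<and> last q = l \<and> distinct q \<and> length q \<le> Suc h \<and>
        set q \<subseteq> insert x (snd ` (F' - F)) \<and> successively (\<lambda>a b. (a, b) \<in> F' - F) q)"
proof (induction h arbitrary: F x)
  case 0
  then show ?case
    by (intro exI[of _ F] exI[of _ "{x}"]) (auto intro!: exI[of _ "[x]"])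
next
  case (Suc h)
  have m: "1 \<le> m" and r2: "\<And>y. y \<in> V - O' \<Longrightarrow> r y = 2"
    and big: "\<And>F X. extendable O' r m F \<Longrightarrow> card F \<le> M \<Longrightarrow> X \<subseteq> V \<Longrightarrow> m \<le> card X \<Longrightarrow> card X \<le> 2 * m \<Longrightarrow>
      (\<Sum>x\<in>X. r x) < card (nbrs_set X - (O' \<union> snd ` F))"
    using roomy unfolding roomy_def by blast+
  note F = Suc.prems(1) and xV = Suc.prems(2) and xF = Suc.prems(3) and fstF = Suc.prems(4)
    and ox = Suc.prems(5) and cM = Suc.prems(6)
  have finF: "finite F" using F by (simp add: extendable_def)
  have "\<exists>y. E x y \<and> y \<notin> O' \<union> snd ` F \<and> extendable O' r m (insert (x, y) F)"
    by (rule extendable_step[OF F m big[OF F]]) (use cM xV ox in auto)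
  then obtain y1 where y1: "E x y1" "y1 \<notin> O' \<union> snd ` F" and F1: "extendable O' r m (insert (x, y1) F)" by auto
  define F1 where "F1 = insert (x, y1) F"
  have y1V: "y1 \<in> V" using y1 N_sub in_N by blast
  have xy1F: "(x, y1) \<notin> F" using y1 by force
  then have cF1: "card F1 = Suc (card F)" using finF by (simp add: F1_def)
  have x1: "x \<noteq> y1" using xF y1 by auto
  have fst_ne1: "\<And>a. a \<in> F \<Longrightarrow> fst a \<noteq> y1" using fstF y1(2) by blast
  have "fst a \<noteq> y1" if "a \<in> F1" for a
    using that fst_ne1[of a] x1 by (cases "a = (x, y1)") (simp_all add: F1_def)
  then have "{a \<in> F1. fst a \<in> {y1}} = {}" by blast
  then have o1: "out_arcs F1 {y1} = 0" by (simp only: out_arcs_def card.empty)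
  have fst1: "fst ` F1 \<subseteq> O' \<union> snd ` F1" using fstF xF by (auto simp: F1_def)
  have F1e: "extendable O' r m F1" using F1 by (simp add: F1_def)
  have y1in: "y1 \<in> O' \<union> snd ` F1" by (simp add: F1_def)
  have o1': "out_arcs F1 {y1} + 2 \<le> r y1" using o1 r2[of y1] y1 y1V by simp
  have cM1: "card F1 + 2 ^ Suc h \<le> M"
  proof -
    have "1 \<le> (2::nat) ^ h" by simp
    then show ?thesis using cM unfolding cF1 power_Suc by linarith
  qed
  from Suc.IH[OF F1e y1V y1in fst1 o1' cM1]
  obtain F2 L1 where F2: "F1 \<subseteq> F2" "extendable O' r m F2" "card F2 + 2 \<le> card F1 + 2 ^ Suc h"
    "fst ` (F2 - F1) \<subseteq> insert y1 (snd ` (F2 - F1))"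
    and L1: "finite L1" "2 ^ h \<le> card L1" "L1 \<subseteq> insert y1 (snd ` (F2 - F1))"
    and q1: "\<forall>l\<in>L1. \<exists>q. q \<noteq> [] \<and> hd q = y1 \<and> last q = l \<and> distinct q \<and> length q \<le> Suc h \<and>
        set q \<subseteq> insert y1 (snd ` (F2 - F1)) \<and> successively (\<lambda>a b. (a, b) \<in> F2 - F1) q"
    by blast
  have finF2: "finite F2" using F2 by (simp add: extendable_def)
  have FF2: "F \<subseteq> F2" using F2 by (auto simp: F1_def)
  have new2: "snd ` (F2 - F1) \<inter> (O' \<union> snd ` F1) = {}" by (rule extendable_new_disjoint[OF F2(2,1)])
  have x2: "x \<notin> insert y1 (snd ` (F2 - F1))" using x1 xF new2 by (auto simp: F1_def)
  have "{a \<in> F2. fst a \<in> {x}} = insert (x, y1) {a \<in> F. fst a \<in> {x}}"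
  proof -
    have "\<And>a. a \<in> F2 - F1 \<Longrightarrow> fst a \<noteq> x" using F2(4) x2 by blast
    then show ?thesis using F2(1) by (auto simp: F1_def)
  qed
  then have o2: "out_arcs F2 {x} = Suc (out_arcs F {x})" unfolding out_arcs_def using xy1F finF by simp
  have "\<exists>y. E x y \<and> y \<notin> O' \<union> snd ` F2 \<and> extendable O' r m (insert (x, y) F2)"
    by (rule extendable_step[OF F2(2) m big[OF F2(2)]]) (use cM xV ox o2 F2(3) cF1 in auto)
  then obtain y2 where y2: "E x y2" "y2 \<notin> O' \<union> snd ` F2" and F3: "extendable O' r m (insert (x, y2) F2)" by auto
  define F3 where "F3 = insert (x, y2) F2"
  have y2V: "y2 \<in> V" using y2 N_sub in_N by blast
  have xy2F: "(x, y2) \<notin> F2" using y2 by force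
  then have cF3: "card F3 = Suc (card F2)" using finF2 by (simp add: F3_def)
  have fst2: "fst ` F2 \<subseteq> O' \<union> snd ` F2"
  proof -
    have "fst ` F2 \<subseteq> fst ` F1 \<union> fst ` (F2 - F1)" by auto
    moreover have "y1 \<in> snd ` F1" by (simp add: F1_def)
    then have "fst ` F1 \<union> fst ` (F2 - F1) \<subseteq> O' \<union> snd ` F2" using fst1 F2(1,4) by blast
    ultimately show ?thesis by (rule subset_trans)
  qed
  have x3: "x \<noteq> y2" using xF y2 FF2 by auto
  have fst_ne2: "\<And>a. a \<in> F2 \<Longrightarrow> fst a \<noteq> y2" using fst2 y2(2) by blast
  have "fst a \<noteq> y2" if "a \<in> F3" for a
    using that fst_ne2[of a] x3 by (cases "a = (x, y2)") (simp_all add: F3_def)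
  then have "{a \<in> F3. fst a \<in> {y2}} = {}" by blast
  then have o3: "out_arcs F3 {y2} = 0" by (simp only: out_arcs_def card.empty)
  have fst3: "fst ` F3 \<subseteq> O' \<union> snd ` F3" using fst2 xF FF2 by (auto simp: F3_def)
  have cM3: "card F3 + 2 ^ Suc h \<le> M" using cM cF1 cF3 F2(3) by simp
  have F3e: "extendable O' r m F3" using F3 by (simp add: F3_def)
  have y2in: "y2 \<in> O' \<union> snd ` F3" by (simp add: F3_def)
  have o3': "out_arcs F3 {y2} + 2 \<le> r y2" using o3 r2[of y2] y2 y2V by simp
  from Suc.IH[OF F3e y2V y2in fst3 o3' cM3]
  obtain F4 L2 where F4: "F3 \<subseteq> F4" "extendable O' r m F4" "card F4 + 2 \<le> card F3 + 2 ^ Suc h"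
    "fst ` (F4 - F3) \<subseteq> insert y2 (snd ` (F4 - F3))"
    and L2: "finite L2" "2 ^ h \<le> card L2" "L2 \<subseteq> insert y2 (snd ` (F4 - F3))"
    and q2: "\<forall>l\<in>L2. \<exists>q. q \<noteq> [] \<and> hd q = y2 \<and> last q = l \<and> distinct q \<and> length q \<le> Suc h \<and>
        set q \<subseteq> insert y2 (snd ` (F4 - F3)) \<and> successively (\<lambda>a b. (a, b) \<in> F4 - F3) q"
    by blast
  have new4: "snd ` (F4 - F3) \<inter> (O' \<union> snd ` F3) = {}" by (rule extendable_new_disjoint[OF F4(2,1)])
  have FF4: "F \<subseteq> F4" "F2 \<subseteq> F4" using FF2 F4 by (auto simp: F3_def)
  have in4: "(x, y1) \<in> F4 - F" "(x, y2) \<in> F4 - F" "F2 - F1 \<subseteq> F4 - F" "F4 - F3 \<subseteq> F4 - F"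
    using xy1F xy2F FF2 F4(1) F2(1) by (auto simp: F1_def F3_def)
  have s1: "insert y1 (snd ` (F2 - F1)) \<subseteq> snd ` (F4 - F)" and s2: "insert y2 (snd ` (F4 - F3)) \<subseteq> snd ` (F4 - F)"
    using in4 by force+
  have x4: "x \<notin> insert y2 (snd ` (F4 - F3))" using x3 xF FF2 new4 by (auto simp: F3_def)
  have dec: "F4 - F = insert (x, y1) (insert (x, y2) ((F2 - F1) \<union> (F4 - F3)))"
    using in4 by (auto simp: F1_def F3_def)
  have L12: "L1 \<inter> L2 = {}"
  proof -
    have "insert y1 (snd ` (F2 - F1)) \<subseteq> snd ` F2" using F2(1) by (force simp: F1_def)
    then have "L1 \<subseteq> snd ` F2" using L1 by auto
    moreover have "snd ` F2 \<subseteq> snd ` F3" by (auto simp: F3_def)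
    then have "L2 \<inter> snd ` F2 = {}" using L2(3) y2(2) new4 by blast
    ultimately show ?thesis by auto
  qed
  show ?case
  proof (intro exI[of _ F4] exI[of _ "L1 \<union> L2"] conjI ballI)
    show "F \<subseteq> F4" "extendable O' r m F4" using FF4 F4 by auto
    show "card F4 + 2 \<le> card F + 2 ^ Suc (Suc h)" using F4(3) F2(3) cF1 cF3 by simp
    show "fst ` (F4 - F) \<subseteq> insert x (snd ` (F4 - F))"
    proof -
      have "fst ` (F4 - F) = insert x (fst ` (F2 - F1) \<union> fst ` (F4 - F3))" unfolding dec by auto
      then show ?thesis
        by (simp only:) (intro insert_mono Un_least subset_trans[OF F2(4) s1] subset_trans[OF F4(4) s2])
    qed
    show "finite (L1 \<union> L2)" using L1 L2 by auto
    show "2 ^ Suc h \<le> card (L1 \<union> L2)" using L1 L2 L12 by (simp add: card_Un_disjoint)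
    show "L1 \<union> L2 \<subseteq> insert x (snd ` (F4 - F))" 
      by (intro Un_least subset_insertI2 subset_trans[OF L1(3) s1] subset_trans[OF L2(3) s2])
    fix l assume "l \<in> L1 \<union> L2"
    then consider "l \<in> L1" | "l \<in> L2" by auto
    then show "\<exists>q. q \<noteq> [] \<and> hd q = x \<and> last q = l \<and> distinct q \<and> length q \<le> Suc (Suc h) \<and>
        set q \<subseteq> insert x (snd ` (F4 - F)) \<and> successively (\<lambda>a b. (a, b) \<in> F4 - F) q"
    proof cases
      case 1
      then obtain q where q: "q \<noteq> []" "hd q = y1" "last q = l" "distinct q" "length q \<le> Suc h"
        "set q \<subseteq> insert y1 (snd ` (F2 - F1))" "successively (\<lambda>a b. (a, b) \<in> F2 - F1) q" using q1 by blast
      have "successively (\<lambda>a b. (a, b) \<in> F4 - F) q" using q(7) by (rule successively_mono) (use in4 in auto)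
      then show ?thesis using q x2 s1 in4 by (intro exI[of _ "x # q"]) (auto simp: successively_Cons)
    next
      case 2
      then obtain q where q: "q \<noteq> []" "hd q = y2" "last q = l" "distinct q" "length q \<le> Suc h"
        "set q \<subseteq> insert y2 (snd ` (F4 - F3))" "successively (\<lambda>a b. (a, b) \<in> F4 - F3) q" using q2 by blast
      have "successively (\<lambda>a b. (a, b) \<in> F4 - F) q" using q(7) by (rule successively_mono) (use in4 in auto)
      then show ?thesis using q x4 s2 in4 by (intro exI[of _ "x # q"]) (auto simp: successively_Cons)
    qed
  qed
qed

section \<open>Joining prescribed pairs by vertex-disjoint paths\<close>

lemma successively_arcs:
  "successively (\<lambda>a b. (a, b) \<in> G) q \<Longrightarrow> set (zip q (tl q)) \<subseteq> G"
  by (induction q rule: induct_list012) auto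

lemma arcs_props:
  assumes "q \<noteq> []"
  shows "fst ` set (zip q (tl q)) \<subseteq> set q" "set q = insert (hd q) (snd ` set (zip q (tl q)))"
    "card (set (zip q (tl q))) \<le> length q - 1"
proof -
  show "fst ` set (zip q (tl q)) \<subseteq> set q" by (auto dest: set_zip_leftD)
  have "map snd (zip q (tl q)) = tl q" by (simp add: map_snd_zip_take)
  then have "snd ` set (zip q (tl q)) = set (tl q)" by (metis set_map)
  then show "set q = insert (hd q) (snd ` set (zip q (tl q)))" using assms by (cases q) auto
  show "card (set (zip q (tl q))) \<le> length q - 1" using card_length[of "zip q (tl q)"] by simp
qed

text \<open>A tree is grown at each end, and \<open>joined\<close> supplies an edge between their
  leaf sets. Afterwards only the two branches leading to that edge are kept: a connection costs
  \<open>2 * h\<close> arcs permanently, although the search takes up to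
  \<open>2 ^ (h + 2)\<close>.\<close>

lemma extendable_connect:
  assumes roomy: "roomy O' r m M"
    and joined: "\<forall>A B. A \<subseteq> V \<longrightarrow> B \<subseteq> V \<longrightarrow> 2 ^ h \<le> card A \<longrightarrow> 2 ^ h \<le> card B \<longrightarrow> (\<exists>u\<in>A. \<exists>v\<in>B. E u v)"
    and F: "extendable O' r m F" and fstF: "fst ` F \<subseteq> O' \<union> snd ` F" and cM: "card F + 2 ^ (h + 2) \<le> M"
    and a: "a \<in> V" "a \<in> O'" "out_arcs F {a} = 0" "r a = 2"
    and b: "b \<in> V" "b \<in> O'" "out_arcs F {b} = 0" "r b = 2" and ab: "a \<noteq> b"
  shows "\<exists>F' q. F \<subseteq> F' \<and> extendable O' r m F' \<and> card F' \<le> card F + 2 * h \<and> fst ` (F' - F) \<subseteq> {a, b} \<union> snd ` (F' - F) \<and>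
    is_path E q a b \<and> set q \<subseteq> {a, b} \<union> snd ` (F' - F)"
proof -
  from extendable_grow[OF roomy F a(1), of h] a fstF cM
  obtain F1 L1 where F1: "F \<subseteq> F1" "extendable O' r m F1" "card F1 + 2 \<le> card F + 2 ^ Suc h"
    "fst ` (F1 - F) \<subseteq> insert a (snd ` (F1 - F))"
    and L1: "finite L1" "2 ^ h \<le> card L1" "L1 \<subseteq> insert a (snd ` (F1 - F))"
    and q1: "\<forall>l\<in>L1. \<exists>q. q \<noteq> [] \<and> hd q = a \<and> last q = l \<and> distinct q \<and> length q \<le> Suc h \<and>
        set q \<subseteq> insert a (snd ` (F1 - F)) \<and> successively (\<lambda>a b. (a, b) \<in> F1 - F) q"
    by auto
  have new1: "snd ` (F1 - F) \<inter> (O' \<union> snd ` F) = {}" by (rule extendable_new_disjoint[OF F1(2,1)])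
  have fst1: "fst ` F1 \<subseteq> O' \<union> snd ` F1"
  proof -
    have "fst ` F1 \<subseteq> fst ` F \<union> fst ` (F1 - F)" by auto
    moreover have "fst ` (F1 - F) \<subseteq> O' \<union> snd ` F1" using F1(4) a by blast
    moreover have "fst ` F \<subseteq> O' \<union> snd ` F1" using fstF F1(1) by blast
    ultimately show ?thesis by blast
  qed
  have "{x \<in> F1. fst x \<in> {b}} = {x \<in> F. fst x \<in> {b}}"
  proof -
    have "\<And>x. x \<in> F1 - F \<Longrightarrow> fst x \<noteq> b" using F1(4) new1 b ab by blast
    then show ?thesis using F1(1) by auto
  qed
  then have o1: "out_arcs F1 {b} = 0" using b(3) unfolding out_arcs_def by simp
  have "card F1 + 2 ^ Suc h \<le> M" using cM F1(3) by simp
  with extendable_grow[OF roomy F1(2) b(1), of h] b fst1 o1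
  obtain F2 L2 where F2: "F1 \<subseteq> F2" "extendable O' r m F2" "card F2 + 2 \<le> card F1 + 2 ^ Suc h"
    and L2: "finite L2" "2 ^ h \<le> card L2" "L2 \<subseteq> insert b (snd ` (F2 - F1))"
    and q2: "\<forall>l\<in>L2. \<exists>q. q \<noteq> [] \<and> hd q = b \<and> last q = l \<and> distinct q \<and> length q \<le> Suc h \<and>
        set q \<subseteq> insert b (snd ` (F2 - F1)) \<and> successively (\<lambda>a b. (a, b) \<in> F2 - F1) q"
    by auto
  have new2: "snd ` (F2 - F1) \<inter> (O' \<union> snd ` F1) = {}" by (rule extendable_new_disjoint[OF F2(2,1)])
  have sndV: "snd ` F2 \<subseteq> V" using F2(2) N_sub by (force simp: extendable_def nbrs_def)
  have "L1 \<subseteq> V" "L2 \<subseteq> V" using L1(3) L2(3) F2(1) sndV a(1) b(1) by blast+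
  then obtain u v where uv: "u \<in> L1" "v \<in> L2" "E u v" using joined L1(2) L2(2) by meson
  obtain qa where qa: "qa \<noteq> []" "hd qa = a" "last qa = u" "distinct qa" "length qa \<le> Suc h"
    "set qa \<subseteq> insert a (snd ` (F1 - F))" "successively (\<lambda>a b. (a, b) \<in> F1 - F) qa" using q1 uv by blast
  obtain qb where qb: "qb \<noteq> []" "hd qb = b" "last qb = v" "distinct qb" "length qb \<le> Suc h"
    "set qb \<subseteq> insert b (snd ` (F2 - F1))" "successively (\<lambda>a b. (a, b) \<in> F2 - F1) qb" using q2 uv by blast
  define Aa Ab where "Aa = set (zip qa (tl qa))" and "Ab = set (zip qb (tl qb))"
  have Aa: "Aa \<subseteq> F1 - F" and Ab: "Ab \<subseteq> F2 - F1"
    unfolding Aa_def Ab_def using successively_arcs[OF qa(7)] successively_arcs[OF qb(7)] by auto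
  note pa = arcs_props[OF qa(1), folded Aa_def] and pb = arcs_props[OF qb(1), folded Ab_def]
  define F' where "F' = F \<union> (Aa \<union> Ab)"
  have F'F: "F' - F = Aa \<union> Ab" using Aa Ab F1(1) by (auto simp: F'_def)
  have sub: "F' \<subseteq> F2" using Aa Ab F1(1) F2(1) by (auto simp: F'_def)
  have setq: "set qa \<subseteq> {a, b} \<union> snd ` (F' - F)" "set qb \<subseteq> {a, b} \<union> snd ` (F' - F)"
    unfolding F'F pa(2) pb(2) using qa qb by auto
  have disj: "set qa \<inter> set qb = {}"
  proof -
    have "b \<notin> snd ` (F1 - F)" "a \<notin> snd ` (F2 - F1)" using new1 new2 a b by auto
    moreover have "snd ` (F1 - F) \<inter> snd ` (F2 - F1) = {}" using new2 by auto
    ultimately show ?thesis using qa(6) qb(6) ab by blast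
  qed
  have E2: "E x y" if "(x, y) \<in> F2" for x y using F2(2) that by (auto simp: extendable_def)
  have Esym: "E x y \<longleftrightarrow> E y x" for x y using graph by (auto simp: simple_graph_def)
  have "successively E qa" using qa(7) by (rule successively_mono) (use E2 F2(1) in auto)
  moreover have "successively E (rev qb)"
    unfolding successively_rev using qb(7) by (rule successively_mono) (use E2 Esym in auto)
  ultimately have "successively E (qa @ rev qb)" using qa qb uv by (simp add: successively_append_iff hd_rev)
  then have path: "is_path E (qa @ rev qb) a b"
    unfolding is_path_iff_successively using qa qb disj by (simp add: last_rev)
  show ?thesis
  proof (intro exI[of _ F'] exI[of _ "qa @ rev qb"] conjI)
    show "F \<subseteq> F'" by (auto simp: F'_def)
    show "extendable O' r m F'" by (rule extendable_subset[OF F2(2) sub])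
    have "card F' \<le> card F + (card Aa + card Ab)"
      unfolding F'_def by (meson add_le_mono card_Un_le le_trans order_refl)
    then show "card F' \<le> card F + 2 * h" using pa(3) pb(3) qa(5) qb(5) by linarith
    show "fst ` (F' - F) \<subseteq> {a, b} \<union> snd ` (F' - F)"
      using pa(1) pb(1) setq unfolding F'F by blast
    show "is_path E (qa @ rev qb) a b" by (rule path)
    show "set (qa @ rev qb) \<subseteq> {a, b} \<union> snd ` (F' - F)" using setq by auto
  qed
qed

text \<open>All terminals lie in \<open>O'\<close>, which no arc enters, so paths avoid foreign
  terminals; inner vertices are children of arcs and hence differ between pairs. The search space
  \<open>2 ^ (h + 2)\<close> is released after each pair and enters \<open>M\<close> once.\<close>

lemma extendable_connect_all:
  fixes L :: "'e set"
  assumes roomy: "roomy O' r m M"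
    and joined: "\<forall>A B. A \<subseteq> V \<longrightarrow> B \<subseteq> V \<longrightarrow> 2 ^ h \<le> card A \<longrightarrow> 2 ^ h \<le> card B \<longrightarrow> (\<exists>u\<in>A. \<exists>v\<in>B. E u v)"
    and init: "extendable O' r m {}" and L: "finite L"
    and tk: "\<And>e. e \<in> L \<Longrightarrow> a e \<in> V \<inter> O' \<and> r (a e) = 2 \<and> b e \<in> V \<inter> O' \<and> r (b e) = 2"
    and inj: "inj_on a L" "inj_on b L" "a ` L \<inter> b ` L = {}"
    and cM: "2 * h * card L + 2 ^ (h + 2) \<le> M"
  shows "\<exists>P. (\<forall>e\<in>L. is_path E (P e) (a e) (b e) \<and> set (P e) \<inter> O' \<subseteq> {a e, b e}) \<and>
    (\<forall>e\<in>L. \<forall>e'\<in>L. e \<noteq> e' \<longrightarrow> set (P e) \<inter> set (P e') = {})"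
proof -
  have "\<exists>F P. extendable O' r m F \<and> card F \<le> 2 * h * card L' \<and> fst ` F \<subseteq> a ` L' \<union> b ` L' \<union> snd ` F \<and>
    (\<forall>e\<in>L'. is_path E (P e) (a e) (b e) \<and> set (P e) \<subseteq> {a e, b e} \<union> snd ` F) \<and>
    (\<forall>e\<in>L'. \<forall>e'\<in>L'. e \<noteq> e' \<longrightarrow> set (P e) \<inter> set (P e') = {})" if "finite L'" "L' \<subseteq> L" for L'
    using that
  proof (induction L' rule: finite_induct)
    case empty
    show ?case using init by (intro exI[of _ "{}"]) auto
  next
    case (insert e L')
    then have "L' \<subseteq> L" by blast
    from insert.IH[OF this] obtain F P where F: "extendable O' r m F" "card F \<le> 2 * h * card L'" "fst ` F \<subseteq> a ` L' \<union> b ` L' \<union> snd ` F"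
      and P0: "\<forall>e\<in>L'. is_path E (P e) (a e) (b e) \<and> set (P e) \<subseteq> {a e, b e} \<union> snd ` F"
      and D0: "\<forall>e\<in>L'. \<forall>e'\<in>L'. e \<noteq> e' \<longrightarrow> set (P e) \<inter> set (P e') = {}" by blast
    have P: "is_path E (P e) (a e) (b e) \<and> set (P e) \<subseteq> {a e, b e} \<union> snd ` F" if "e \<in> L'" for e
      using P0 that by (rule bspec)
    have D: "set (P e) \<inter> set (P e') = {}" if "e \<in> L'" "e' \<in> L'" "e \<noteq> e'" for e e'
      using bspec[OF bspec[OF D0 that(1)] that(2)] that(3) by simp
    have L'L: "L' \<subseteq> L" "e \<in> L" using insert.prems by auto
    have sndO: "snd ` F \<inter> O' = {}" using F by (simp add: extendable_def)
    have tkn: "a e \<notin> a ` L'" "a e \<notin> b ` L'" "b e \<notin> a ` L'" "b e \<notin> b ` L'" "a e \<noteq> b e"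
      using inj_on_image_mem_iff[OF inj(1) L'L(2,1)] inj_on_image_mem_iff[OF inj(2) L'L(2,1)] insert.hyps(2)
        inj(3) L'L by blast+
    have tkF: "a e \<notin> snd ` F" "b e \<notin> snd ` F" using sndO tk[OF L'L(2)] by auto
    have "fst x \<notin> {a e, b e}" if "x \<in> F" for x
    proof
      assume "fst x \<in> {a e, b e}"
      then consider "fst x = a e" | "fst x = b e" by blast
      moreover have "fst x \<in> a ` L' \<union> b ` L' \<union> snd ` F"
        using F(3) imageI[OF that, of fst] by (rule subsetD)
      ultimately show False using tkn tkF by cases (simp_all only: Un_iff simp_thms)
    qed
    then have "{x \<in> F. fst x \<in> {a e}} = {}" "{x \<in> F. fst x \<in> {b e}} = {}" by blast+
    then have o: "out_arcs F {a e} = 0" "out_arcs F {b e} = 0" by (simp_all only: out_arcs_def card.empty)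
    have tkO: "a e \<in> O' \<and> b e \<in> O'" if "e \<in> L'" for e
      using tk[of e] subsetD[OF L'L(1) that] by blast
    have "a ` L' \<subseteq> O'" "b ` L' \<subseteq> O'" by (rule image_subsetI; use tkO in blast)+
    then have fstF: "fst ` F \<subseteq> O' \<union> snd ` F" using F(3) by blast
    have "card L' < card L" using insert.hyps L'L L by (intro psubset_card_mono) auto
    then have "2 * h * card L' \<le> 2 * h * card L" by simp
    then have cF: "card F + 2 ^ (h + 2) \<le> M" using F(2) cM by linarith
    have ta: "a e \<in> V" "a e \<in> O'" "r (a e) = 2" and tb: "b e \<in> V" "b e \<in> O'" "r (b e) = 2"
      using tk[OF L'L(2)] by blast+
    from extendable_connect[OF roomy joined F(1) fstF cF ta(1,2) o(1) ta(3) tb(1,2) o(2) tb(3) tkn(5)]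
    obtain F' q where F': "F \<subseteq> F'" "extendable O' r m F'" "card F' \<le> card F + 2 * h"
      "fst ` (F' - F) \<subseteq> {a e, b e} \<union> snd ` (F' - F)"
      and q: "is_path E q (a e) (b e)" "set q \<subseteq> {a e, b e} \<union> snd ` (F' - F)" by blast
    have new: "snd ` (F' - F) \<inter> (O' \<union> snd ` F) = {}" by (rule extendable_new_disjoint[OF F'(2,1)])
    define P' where "P' = P(e := q)"
    have P'eq: "P' e' = P e'" if "e' \<in> L'" for e' using that insert.hyps by (auto simp: P'_def)
    have P'e: "P' e = q" by (simp add: P'_def)
    have nd: "set q \<inter> set (P e') = {}" if e': "e' \<in> L'" for e'
    proof -
      have "set (P e') \<subseteq> {a e', b e'} \<union> snd ` F" using P[OF e'] by simp
      moreover have "{a e', b e'} \<inter> {a e, b e} = {}" using tkn e' by auto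
      ultimately have "set q \<inter> set (P e') \<subseteq> (snd ` (F' - F) \<inter> ({a e', b e'} \<union> snd ` F)) \<union> ({a e, b e} \<inter> snd ` F)"
        using q(2) by blast
      moreover have "{a e', b e'} \<subseteq> O'" using tkO[OF e'] by blast
      ultimately show ?thesis using new tkF by blast
    qed
    show ?case
    proof (intro exI[of _ F'] exI[of _ P'] conjI)
      show "extendable O' r m F'" by (rule F'(2))
      show "card F' \<le> 2 * h * card (insert e L')" using F' F(2) insert.hyps by simp
      have "fst ` F' \<subseteq> fst ` F \<union> fst ` (F' - F)" by auto
      moreover have "fst ` F \<subseteq> a ` insert e L' \<union> b ` insert e L' \<union> snd ` F'" using F(3) F'(1) by blast
      moreover have "fst ` (F' - F) \<subseteq> a ` insert e L' \<union> b ` insert e L' \<union> snd ` F'" using F'(4) by blast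
      ultimately show "fst ` F' \<subseteq> a ` insert e L' \<union> b ` insert e L' \<union> snd ` F'" by blast
      show "\<forall>e'\<in>insert e L'. is_path E (P' e') (a e') (b e') \<and> set (P' e') \<subseteq> {a e', b e'} \<union> snd ` F'"
      proof
        fix e' assume "e' \<in> insert e L'"
        then show "is_path E (P' e') (a e') (b e') \<and> set (P' e') \<subseteq> {a e', b e'} \<union> snd ` F'"
        proof (cases "e' = e")
          case True
          then show ?thesis using q by (auto simp: P'e)
        next
          case False
          then have e': "e' \<in> L'" using \<open>e' \<in> insert e L'\<close> by auto
          show ?thesis using P[OF e'] F'(1) unfolding P'eq[OF e'] by blast
        qed
      qed
      show "\<forall>e1\<in>insert e L'. \<forall>e2\<in>insert e L'. e1 \<noteq> e2 \<longrightarrow> set (P' e1) \<inter> set (P' e2) = {}"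
      proof (intro ballI impI)
        fix e1 e2 assume *: "e1 \<in> insert e L'" "e2 \<in> insert e L'" "e1 \<noteq> e2"
        consider "e1 = e" "e2 \<in> L'" | "e2 = e" "e1 \<in> L'" | "e1 \<in> L'" "e2 \<in> L'" using * by auto
        then show "set (P' e1) \<inter> set (P' e2) = {}"
          by cases (use nd P'e P'eq D * in auto)
      qed
    qed
  qed
  from this[OF L order_refl] obtain F P where F: "extendable O' r m F"
    and P: "\<forall>e\<in>L. is_path E (P e) (a e) (b e) \<and> set (P e) \<subseteq> {a e, b e} \<union> snd ` F"
    and D: "\<forall>e\<in>L. \<forall>e'\<in>L. e \<noteq> e' \<longrightarrow> set (P e) \<inter> set (P e') = {}" by blast
  have "snd ` F \<inter> O' = {}" using F by (simp add: extendable_def)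
  then show ?thesis using P D by (intro exI[of _ P]) blast
qed


text \<open>With \<open>t = 1\<close> the stars are disjoint, and each branch vertex
  \<open>u\<close> reserves a private star vertex \<open>tk u v\<close> for every partner
  \<open>v\<close>. Vertex-disjoint paths from \<open>tk u v\<close> to \<open>tk v u\<close> then
  extend to edge-disjoint paths between branch vertices.\<close>

lemma huge_immersion:
  assumes g: "0 < g" "g \<le> 1" and gK: "8 \<le> (g * K / 2)\<^sup>2" "8 \<le> g * (g * K / 2)\<^sup>2" "64 \<le> g\<^sup>2 * K\<^sup>2" and K: "2048 \<le> K"
    and b: "real b \<le> (1 - 3 * g) * real d"
    and n: "64 * d\<^sup>2 \<le> n" "4 * (real d)\<^sup>2 \<le> g * real n"
    and hh: "n \<le> 64 * 2 ^ hh" "32 * 2 ^ hh \<le> n" "16 * hh * d\<^sup>2 \<le> n"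
    and m: "real m \<le> real b - 2 * g * real d"
  shows "has_complete_immersion n E m"
proof -
  have b_le: "b \<le> d"
  proof -
    have "(1 - 3 * g) * real d \<le> 1 * real d" using g by (intro mult_right_mono) auto
    then show ?thesis using b by simp
  qed
  have dd: "d \<le> d\<^sup>2" using d_pos by (simp add: power2_eq_square)
  have "b * d \<le> d * d" using b_le by simp
  then have bd: "b * d + b \<le> 2 * d\<^sup>2" using b_le dd unfolding power2_eq_square by linarith
  have n64: "64 \<le> n" using n(1) dd d_pos by linarith
  have room: "real b * real d / real 1 + real b \<le> g * real n / 2"
  proof -
    have "real (b * d + b) \<le> real (2 * d\<^sup>2)" unfolding of_nat_le_iff by (rule bd)
    then show ?thesis using n(2) by simp
  qed
  have t1: "0 < (1::nat)" by simp
  from spread_stars[OF g gK(1,2) t1 room b_le]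
  obtain B S where B: "B \<subseteq> V" "real b - g * real d \<le> real (card B)" "card B \<le> b"
    and S0: "\<forall>u\<in>B. S u \<subseteq> N u - B \<and> (1 - 2 * g) * real d \<le> real (card (S u))"
    and load: "\<forall>w\<in>V. card {u \<in> B. w \<in> S u} \<le> 1" by blast
  have S: "S u \<subseteq> N u - B" "(1 - 2 * g) * real d \<le> real (card (S u))" if "u \<in> B" for u
    using bspec[OF S0 that] by blast+
  have fB: "finite B" using B fin_sub by auto
  have fS: "finite (S u)" if "u \<in> B" for u using S(1)[OF that] fin_N finite_subset by blast
  have SV: "S u \<subseteq> V" if "u \<in> B" for u using S(1)[OF that] N_sub[of u] by blast
  have S_disj: "u = u'" if "w \<in> S u" "w \<in> S u'" "u \<in> B" "u' \<in> B" for u u' w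
  proof (rule ccontr)
    assume "u \<noteq> u'"
    have "w \<in> V" using that SV by blast
    then have "card {u \<in> B. w \<in> S u} \<le> 1" using load by blast
    moreover have "card {u, u'} \<le> card {u \<in> B. w \<in> S u}" using that fB by (intro card_mono) auto
    ultimately show False using \<open>u \<noteq> u'\<close> by simp
  qed
  define SS where "SS = (\<Union>u\<in>B. S u)"
  have SSV: "SS \<subseteq> V" using SV by (auto simp: SS_def)
  have "card SS \<le> (\<Sum>u\<in>B. card (S u))" unfolding SS_def using fB by (rule card_UN_le)
  also have "\<dots> \<le> (\<Sum>u\<in>B. d)"
  proof (rule sum_mono)
    fix u assume u: "u \<in> B"
    have "card (S u) \<le> card (N u)" using S(1)[OF u] by (intro card_mono) auto
    then show "card (S u) \<le> d" using card_N B u by auto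
  qed
  also have "\<dots> \<le> b * d" using B by simp
  finally have cSS: "card SS \<le> b * d" .
  define base where "base = B \<union> SS"
  have baseV: "base \<subseteq> V" using B SSV by (auto simp: base_def)
  have cbase: "card base \<le> 2 * d\<^sup>2" using cSS bd B(3) card_Un_le[of B SS] unfolding base_def by linarith
  have cbr: "real (card base) \<le> 2 * (real d)\<^sup>2" "64 * (real d)\<^sup>2 \<le> real n"
  proof -
    have "real (card base) \<le> real (2 * d\<^sup>2)" "real (64 * d\<^sup>2) \<le> real n"
      unfolding of_nat_le_iff by (rule cbase) (rule n(1))
    then show "real (card base) \<le> 2 * (real d)\<^sup>2" "64 * (real d)\<^sup>2 \<le> real n" by simp_all
  qed
  have Kp: "x\<^sup>2 \<le> (c * K)\<^sup>2" if "0 \<le> x" "x \<le> c * 2048" "0 \<le> c" for x c :: real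
  proof -
    have "c * 2048 \<le> c * K" using that K by (intro mult_left_mono) auto
    then show ?thesis using that by (intro power_mono) auto
  qed
  have "\<exists>Z. base \<subseteq> Z \<and> Z \<subseteq> V \<and> card Z \<le> 2 * card base \<and> (\<forall>w\<in>V - Z. real (card (N w \<inter> Z)) < 1 / 4 * real d)"
  proof (rule small_closure[OF baseV])
    show "2 \<le> (1 / 4 * K / 2)\<^sup>2" using Kp[of 2 "1 / 8"] by simp
    show "2 * real (card base) + 1 \<le> 1 / 4 * real n / 2" using cbr n64 by linarith
  qed simp
  then obtain Z where Z: "base \<subseteq> Z" "Z \<subseteq> V" "card Z \<le> 2 * card base"
    and Zout: "\<And>w. w \<in> V - Z \<Longrightarrow> real (card (N w \<inter> Z)) < 1 / 4 * real d" by blast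
  have fZ: "finite Z" using Z fin_sub by auto
  have cZ: "real (card Z) \<le> real n / 16" "real (card Z) \<le> 4 * (real d)\<^sup>2"
    using Z(3) cbr by linarith+
  \<comment> \<open>Vertices outside the closed set \<open>Z\<close> keep \<open>3 / 4 * d\<close>
    neighbours outside it, but star vertices lie in \<open>Z\<close> and may have too many
    neighbours there. By \<open>expansion\<close> at most \<open>g\<^sup>2 * d\<^sup>2\<close> do,
    and as stars are disjoint, at most \<open>g * d\<close> centres lose more than
    \<open>g * d\<close> star vertices.\<close>
  define Bd where "Bd = {x \<in> SS. 1 / 2 * real d \<le> real (card (N x \<inter> Z))}"
  have BdV: "Bd \<subseteq> V" using SSV by (auto simp: Bd_def)
  have cBd: "real (card Bd) \<le> g\<^sup>2 * (real d)\<^sup>2"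
  proof -
    have "real (card Bd) * (1 / 2 * K / 2)\<^sup>2 \<le> real (card Z)"
      by (rule expansion[OF BdV Z(2)]) (use cZ in \<open>auto simp: Bd_def\<close>)
    then have "real (card Bd) * K\<^sup>2 \<le> 64 * (real d)\<^sup>2" using cZ(2) by (simp add: power_divide)
    then have "g\<^sup>2 * (real (card Bd) * K\<^sup>2) \<le> g\<^sup>2 * (64 * (real d)\<^sup>2)" by (intro mult_left_mono) auto
    moreover have "real (card Bd) * 64 \<le> real (card Bd) * (g\<^sup>2 * K\<^sup>2)" using gK(3) by (intro mult_left_mono) auto
    ultimately show ?thesis by (simp add: mult_ac)
  qed
  define B' where "B' = {u \<in> B. real (card (S u \<inter> Bd)) \<le> g * real d}"
  have B'B: "B' \<subseteq> B" by (auto simp: B'_def)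
  have cB': "real (card (B - B')) \<le> g * real d"
  proof -
    have "real (card (B - B')) * (g * real d) = (\<Sum>u\<in>B - B'. g * real d)" by simp
    also have "\<dots> \<le> (\<Sum>u\<in>B - B'. real (card (S u \<inter> Bd)))" by (rule sum_mono) (auto simp: B'_def)
    also have "\<dots> = real (card (\<Union>u\<in>B - B'. S u \<inter> Bd))"
      using fB fS S_disj by (subst card_UN_disjoint) auto
    also have "\<dots> \<le> real (card Bd)"
      unfolding of_nat_le_iff using BdV fin_sub by (intro card_mono) auto
    also have "\<dots> \<le> (g * real d) * (g * real d)" using cBd by (simp add: power2_eq_square mult_ac)
    finally show ?thesis using g d_pos by simp
  qed
  have fB': "finite B'" using fB B'B finite_subset by auto
  have tok: "\<exists>f. f ` B' \<subseteq> S u - Bd \<and> inj_on f B'" if u: "u \<in> B'" for u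
  proof (rule card_le_inj[OF fB'])
    have uB: "u \<in> B" using u B'B by auto
    show "finite (S u - Bd)" using fS[OF uB] by auto
    have "card (S u) = card (S u \<inter> Bd) + card (S u - Bd)"
      using card_Int_Diff[OF fS[OF uB]] by simp
    moreover have "real (card (S u \<inter> Bd)) \<le> g * real d" using u by (auto simp: B'_def)
    ultimately have "(1 - 2 * g) * real d - g * real d \<le> real (card (S u - Bd))"
      using S(2)[OF uB] by linarith
    moreover have "(1 - 2 * g) * real d - g * real d = (1 - 3 * g) * real d" by (simp add: algebra_simps)
    moreover have "card B' \<le> b" using card_mono[OF fB B'B] B(3) by linarith
    ultimately have "real (card B') \<le> real (card (S u - Bd))" using b by linarith
    then show "card B' \<le> card (S u - Bd)" by simp
  qed
  then have "\<forall>u\<in>B'. \<exists>f. f ` B' \<subseteq> S u - Bd \<and> inj_on f B'" by blast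
  from bchoice[OF this] obtain tk where tk: "\<forall>u\<in>B'. tk u ` B' \<subseteq> S u - Bd \<and> inj_on (tk u) B'" by blast
  have tkS: "tk u v \<in> S u" "tk u v \<notin> Bd" if "u \<in> B'" "v \<in> B'" for u v
    using bspec[OF tk that(1)] that(2) by blast+
  have tk_inj: "u = u' \<and> v = v'" if "tk u v = tk u' v'" "u \<in> B'" "v \<in> B'" "u' \<in> B'" "v' \<in> B'" for u v u' v'
  proof -
    have "tk u v \<in> S u" "tk u v \<in> S u'" using tkS(1)[of u v] tkS(1)[of u' v'] that by simp_all
    then have "u = u'" using S_disj that B'B by blast
    then show ?thesis using that bspec[OF tk that(2)] by (auto dest: inj_onD)
  qed
  define L where "L = {e \<in> B' \<times> B'. fst e < snd e}"
  define a where "a e = tk (fst e) (snd e)" for e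
  define bb where "bb e = tk (snd e) (fst e)" for e
  have LB: "fst e \<in> B'" "snd e \<in> B'" "fst e < snd e" if "e \<in> L" for e using that by (auto simp: L_def)
  \<comment> \<open>Zero on the vertices of \<open>Z\<close> that are not usable star vertices: they
    never become parents, and no expansion out of \<open>Z\<close> is guaranteed for them.\<close>
  define r where "r x = (if x \<in> V - Z \<or> x \<in> SS - Bd then 2 else 0 :: nat)" for x
  have r_le: "r x \<le> 2" for x by (simp add: r_def)
  \<comment> \<open>Sets of about \<open>n / 64\<close> vertices have more than \<open>n / 2\<close>
    neighbours. \<open>Z\<close> and a forest of \<open>n / 4\<close> arcs occupy at most
    \<open>n / 16 + n / 4\<close>, and the rest exceeds the demand of at most \<open>4 * mm\<close>,
    about \<open>n / 16\<close>.\<close>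
  define mm where "mm = n div 64 + 1"
  have mm: "real n < 64 * real mm" "64 * real mm \<le> real n + 64"
  proof -
    have "n < 64 * mm" "64 * mm \<le> n + 64" 
    proof -
      have "n mod 64 < 64" "64 * (n div 64) + n mod 64 = n" by simp_all
      then show "n < 64 * mm" "64 * mm \<le> n + 64" unfolding mm_def distrib_left by linarith+
    qed
    then have "real n < real (64 * mm)" "real (64 * mm) \<le> real (n + 64)" unfolding of_nat_less_iff of_nat_le_iff .
    then show "real n < 64 * real mm" "64 * real mm \<le> real n + 64" by simp_all
  qed
  have big: "(\<Sum>x\<in>X. r x) < card (nbrs_set X - (Z \<union> snd ` F))"
    if F: "finite F" "card F \<le> n div 4" and X: "X \<subseteq> V" "mm \<le> card X" "card X \<le> 2 * mm" for F X
  proof -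
    have "real n / 2 < real (card (nbrs_set X))"
    proof (rule ccontr)
      assume "\<not> ?thesis"
      then have sm: "real (card (nbrs_set X)) \<le> 1 * real n / 2" by simp
      have "real (card X) * (1 * K / 2)\<^sup>2 \<le> real (card (nbrs_set X))"
      proof (rule expansion[OF X(1) nbrs_set_sub _ _ sm])
        fix x assume x: "x \<in> X"
        then have "N x \<inter> nbrs_set X = N x" by (auto simp: nbrs_set_def)
        then show "1 * real d \<le> real (card (N x \<inter> nbrs_set X))" using card_N X(1) x by auto
      qed simp
      moreover have "(1048576::real) \<le> (1 * K / 2)\<^sup>2" using Kp[of 1024 "1 / 2"] by simp
      then have "real (card X) * 1048576 \<le> real (card X) * (1 * K / 2)\<^sup>2" by (intro mult_left_mono) auto
      moreover have "real mm \<le> real (card X)" unfolding of_nat_le_iff by (rule X(2))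
      then have "real n < 64 * real (card X)" using mm by linarith
      moreover have "0 < real n" using n_pos by simp
      ultimately show False using sm by linarith
    qed
    moreover have "card (nbrs_set X) \<le> card (nbrs_set X - (Z \<union> snd ` F)) + card (Z \<union> snd ` F)"
    proof -
      have "card (nbrs_set X) \<le> card ((nbrs_set X - (Z \<union> snd ` F)) \<union> (Z \<union> snd ` F))"
        using fZ F by (intro card_mono) auto
      then show ?thesis using card_Un_le by (rule order_trans)
    qed
    moreover have "card (Z \<union> snd ` F) \<le> card Z + card F"
      using card_Un_le[of Z "snd ` F"] card_image_le[OF F(1), of snd] by linarith
    moreover have "real (card F) \<le> real n / 4"
    proof -
      have "4 * card F \<le> n" using F(2) by linarith
      then have "real (4 * card F) \<le> real n" unfolding of_nat_le_iff .
      then show ?thesis by simp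
    qed
    ultimately have "3 * real n < 16 * real (card (nbrs_set X - (Z \<union> snd ` F)))" using cZ(1) by linarith
    moreover have "(\<Sum>x\<in>X. r x) \<le> (\<Sum>x\<in>X. 2)" using r_le by (intro sum_mono) auto
    then have "(\<Sum>x\<in>X. r x) \<le> 2 * card X" by simp
    then have "real (\<Sum>x\<in>X. r x) \<le> real (2 * card X)" unfolding of_nat_le_iff .
    moreover have "real (card X) \<le> real (2 * mm)" unfolding of_nat_le_iff by (rule X(3))
    then have "16 * real (2 * card X) \<le> real n + 64" using mm by simp
    moreover have "64 \<le> real n" using n64 by simp
    ultimately have "real (\<Sum>x\<in>X. r x) < real (card (nbrs_set X - (Z \<union> snd ` F)))" by linarith
    then show ?thesis unfolding of_nat_less_iff .
  qed
  have roomy: "roomy Z r mm (n div 4)"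
    unfolding roomy_def
  proof (intro conjI allI impI ballI)
    show "1 \<le> mm" by (simp add: mm_def)
    show "r y = 2" if "y \<in> V - Z" for y using that by (simp add: r_def)
    fix F X assume "extendable Z r mm F" "card F \<le> n div 4" "X \<subseteq> V" "mm \<le> card X" "card X \<le> 2 * mm"
    then show "(\<Sum>x\<in>X. r x) < card (nbrs_set X - (Z \<union> snd ` F))"
      using big[of F X] by (auto simp: extendable_def)
  qed
  have init: "extendable Z r mm {}"
    unfolding extendable_def
  proof (intro conjI allI impI)
    fix X assume X: "X \<subseteq> V" "card X \<le> 2 * mm"
    define X' where "X' = {x \<in> X. x \<in> V - Z \<or> x \<in> SS - Bd}"
    have fX: "finite X" using X fin_sub by auto
    have X'V: "X' \<subseteq> V" using X by (auto simp: X'_def)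
    define T where "T = nbrs_set X' - Z"
    have TV: "T \<subseteq> V" using nbrs_set_sub by (auto simp: T_def)
    have "(\<Sum>x\<in>X. r x) = 2 * card X'"
      using fX by (simp add: r_def X'_def sum.If_cases Int_def)
    moreover have cX': "card X' \<le> card X" using fX by (intro card_mono) (auto simp: X'_def)
    \<comment> \<open>Each vertex of \<open>X'\<close> has \<open>d / 2\<close> neighbours outside
      \<open>Z\<close>, so \<open>X'\<close> expands out of \<open>Z\<close>. If \<open>T\<close>
      exceeds \<open>n / 4\<close>, the size bound \<open>2 * mm\<close> alone suffices.\<close>
    moreover have cT: "2 * real (card X') \<le> real (card T)"
    proof (cases "real (card T) \<le> 1 / 2 * real n / 2")
      case True
      have "real (card X') * (1 / 2 * K / 2)\<^sup>2 \<le> real (card T)"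
      proof (rule expansion[OF X'V TV _ _ True])
        fix x assume x: "x \<in> X'"
        have "real (card (N x \<inter> Z)) \<le> 1 / 2 * real d"
        proof (cases "x \<in> V - Z")
          case True
          then show ?thesis using Zout[of x] d_pos by simp
        next
          case False
          then show ?thesis using x by (auto simp: X'_def Bd_def)
        qed
        moreover have "N x \<inter> T = N x - Z" using x by (auto simp: T_def nbrs_set_def)
        moreover have "card (N x) = card (N x \<inter> Z) + card (N x - Z)" using card_Int_Diff[OF fin_N] .
        ultimately show "1 / 2 * real d \<le> real (card (N x \<inter> T))" using card_N[of x] x X'V by auto
      qed simp
      moreover have "(262144::real) \<le> (1 / 2 * K / 2)\<^sup>2" using Kp[of 512 "1 / 4"] by simp
      then have "real (card X') * 2 \<le> real (card X') * (1 / 2 * K / 2)\<^sup>2" by (intro mult_left_mono) auto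
      ultimately show ?thesis by linarith
    next
      case False
      have "real (card X') \<le> real (2 * mm)" unfolding of_nat_le_iff using cX' X(2) by linarith
      then have "16 * (2 * real (card X')) \<le> real n + 64" using mm by simp
      moreover have "64 \<le> real n" using n64 by simp
      moreover have "real n < 4 * real (card T)" using False by simp
      ultimately show ?thesis by linarith
    qed
    moreover have "card T \<le> card (nbrs_set X - (Z \<union> snd ` {}))"
      by (intro card_mono finite_Diff fin_nbrs_set) (auto simp: T_def nbrs_set_def X'_def)
    moreover have "2 * card X' \<le> card T" using cT by linarith
    ultimately have "(\<Sum>x\<in>X. r x) \<le> card (nbrs_set X - (Z \<union> snd ` {}))" by (metis order_trans)
    then show "(\<Sum>x\<in>X. r x) \<le> card (nbrs_set X - (Z \<union> snd ` {})) + out_arcs {} X" by (rule trans_le_add1)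
  qed auto
  have joined: "\<forall>A B. A \<subseteq> V \<longrightarrow> B \<subseteq> V \<longrightarrow> 2 ^ hh \<le> card A \<longrightarrow> 2 ^ hh \<le> card B \<longrightarrow> (\<exists>u\<in>A. \<exists>v\<in>B. E u v)"
  proof (intro allI impI, rule ccontr)
    fix A B assume AB: "A \<subseteq> V" "B \<subseteq> V" "2 ^ hh \<le> card A" "2 ^ hh \<le> card B" and none: "\<not> (\<exists>u\<in>A. \<exists>v\<in>B. E u v)"
    have h2: "real n \<le> 64 * real (card A)" "real n \<le> 64 * real (card B)"
    proof -
      have "n \<le> 64 * card A" "n \<le> 64 * card B" using hh(1) AB by linarith+
      then have "real n \<le> real (64 * card A)" "real n \<le> real (64 * card B)" unfolding of_nat_le_iff by auto
      then show "real n \<le> 64 * real (card A)" "real n \<le> 64 * real (card B)" by simp_all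
    qed
    have "real (card A) * (1 / 64 * K / 2)\<^sup>2 \<le> real n"
    proof (rule few_poor[OF AB(1,2)])
      fix x assume "x \<in> A"
      then have "N x \<inter> B = {}" using none by (auto simp: nbrs_def)
      then show "real (card (N x \<inter> B)) \<le> 1 / 64 * real d / 2" by simp
    qed (use h2 in auto)
    moreover have "(256::real) \<le> (1 / 64 * K / 2)\<^sup>2" using Kp[of 16 "1 / 128"] by simp
    then have "real (card A) * 256 \<le> real (card A) * (1 / 64 * K / 2)\<^sup>2" by (intro mult_left_mono) auto
    moreover have "0 < real n" using n_pos by simp
    ultimately show False using h2 by linarith
  qed
  have fL: "finite L" unfolding L_def using fB' by auto
  have tks: "a e \<in> V \<inter> Z \<and> r (a e) = 2 \<and> bb e \<in> V \<inter> Z \<and> r (bb e) = 2" if "e \<in> L" for e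
  proof -
    have "a e \<in> SS - Bd" "bb e \<in> SS - Bd"
      using tkS LB[OF that] B'B unfolding a_def bb_def SS_def by blast+
    moreover have "SS \<subseteq> Z" using Z(1) by (auto simp: base_def)
    ultimately show ?thesis using SSV unfolding r_def by auto
  qed
  have inj: "inj_on a L" "inj_on bb L" "a ` L \<inter> bb ` L = {}"
  proof -
    show "inj_on a L"
    proof (rule inj_onI)
      fix e e' assume "e \<in> L" "e' \<in> L" "a e = a e'"
      then show "e = e'" using tk_inj[of "fst e" "snd e" "fst e'" "snd e'"] LB[of e] LB[of e'] by (simp add: a_def prod_eq_iff)
    qed
    show "inj_on bb L"
    proof (rule inj_onI)
      fix e e' assume "e \<in> L" "e' \<in> L" "bb e = bb e'"
      then show "e = e'" using tk_inj[of "snd e" "fst e" "snd e'" "fst e'"] LB[of e] LB[of e'] by (simp add: bb_def prod_eq_iff)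
    qed
    show "a ` L \<inter> bb ` L = {}"
    proof (rule ccontr)
      assume "\<not> ?thesis"
      then obtain e e' where ee: "e \<in> L" "e' \<in> L" "a e = bb e'" by blast
      then have "fst e = snd e' \<and> snd e = fst e'"
        using tk_inj[of "fst e" "snd e" "snd e'" "fst e'"] LB[of e] LB[of e'] by (simp add: a_def bb_def)
      then show False using LB(3)[OF ee(1)] LB(3)[OF ee(2)] by simp
    qed
  qed
  have cL: "card L \<le> d\<^sup>2"
  proof -
    have "card L \<le> card (B' \<times> B')" using fB' by (intro card_mono) (auto simp: L_def)
    also have "\<dots> = card B' * card B'" by (rule card_cartesian_product)
    also have "\<dots> \<le> d * d" using card_mono[OF fB B'B] B(3) b_le by (intro mult_mono) auto
    finally show ?thesis by (simp add: power2_eq_square)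
  qed
  \<comment> \<open>\<open>2 ^ hh\<close> lies between \<open>n / 64\<close> and
    \<open>n / 32\<close>: large enough for two such leaf sets to be joined by an edge, small enough
    for the trees to take at most \<open>n / 8\<close> arcs. The kept paths take at most another
    \<open>n / 8\<close>.\<close>
  have cM: "2 * hh * card L + 2 ^ (hh + 2) \<le> n div 4"
  proof -
    have "2 * hh * card L \<le> 2 * hh * d\<^sup>2" using cL by simp
    then have a1: "8 * (2 * hh * card L) \<le> n" using hh(3) by linarith
    have a2: "(2::nat) ^ (hh + 2) = 4 * 2 ^ hh" by (simp add: power_add)
    have "x + y \<le> n div 4" if "8 * x \<le> n" "y = 4 * z" "32 * z \<le> n" for x y z
    proof -
      have "(x + y) * 4 \<le> n" unfolding distrib_right using that by linarith
      then show ?thesis by (simp only: less_eq_div_iff_mult_less_eq zero_less_numeral)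
    qed
    from this[OF a1 a2 hh(2)] show ?thesis .
  qed
  from extendable_connect_all[OF roomy joined init fL tks inj cM]
  obtain P where P: "\<forall>e\<in>L. is_path E (P e) (a e) (bb e) \<and> set (P e) \<inter> Z \<subseteq> {a e, bb e}"
    and D: "\<forall>e\<in>L. \<forall>e'\<in>L. e \<noteq> e' \<longrightarrow> set (P e) \<inter> set (P e') = {}" by blast
  define Q where "Q u v = u # P (u, v) @ [v]" for u v
  have BZ: "B \<subseteq> Z" using Z(1) by (auto simp: base_def)
  have PB: "set (P e) \<inter> B = {}" if e: "e \<in> L" for e
  proof -
    have "a e \<notin> B" "bb e \<notin> B" using tkS(1) S(1) LB[OF e] B'B unfolding a_def bb_def by blast+
    then show ?thesis using bspec[OF P e] BZ by blast
  qed
  show ?thesis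
  proof (rule complete_immersionI[of B' n m E Q])
    show "B' \<subseteq> {..<n}" using B'B B by auto
    have "card B = card (B - B') + card B'"
      using fB B'B by (simp add: card_Diff_subset card_mono finite_subset)
    then have "real b - g * real d - g * real d \<le> real (card B')" using B(2) cB' by linarith
    then show "m \<le> card B'" using m by simp
  next
    fix u v assume uv: "u \<in> B'" "v \<in> B'" "u < v"
    then have e: "(u, v) \<in> L" by (simp add: L_def)
    have pe: "is_path E (P (u, v)) (tk u v) (tk v u)" using bspec[OF P e] by (simp add: a_def bb_def)
    have uB: "u \<in> B" "v \<in> B" using uv B'B by auto
    have "tk u v \<in> N u" "tk v u \<in> N v" using tkS(1) uv S(1)[OF uB(1)] S(1)[OF uB(2)] by blast+
    moreover from this(2) have "v \<in> N (tk v u)" by (subst N_sym)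
    ultimately have "E u (tk u v)" "E (tk v u) v" by (simp_all only: in_N)
    moreover have "u \<notin> set (P (u, v))" "v \<notin> set (P (u, v))" using PB[OF e] uB by blast+
    ultimately show "is_path E (Q u v) u v"
      using pe uv(3) unfolding is_path_iff_successively Q_def
      by (auto simp: successively_Cons successively_append_iff)
  next
    fix u v u' v' assume uv: "u \<in> B'" "v \<in> B'" "u < v" and uv': "u' \<in> B'" "v' \<in> B'" "u' < v'" and ne: "(u, v) \<noteq> (u', v')"
    have e: "(u, v) \<in> L" "(u', v') \<in> L" using uv uv' by (auto simp: L_def)
    have sub: "f \<subseteq> set (P (x, y)) \<union> B \<and> f \<inter> set (P (x, y)) \<noteq> {}" if "f \<in> path_edges (Q x y)" "(x, y) \<in> L" for f x y
    proof -
      have "P (x, y) \<noteq> []" using bspec[OF P that(2)] by (simp add: is_path_def)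
      then have "path_edges (Q x y) = {{x, hd (P (x, y))}, {last (P (x, y)), y}} \<union> path_edges (P (x, y))"
        by (auto simp: Q_def path_edges_Cons path_edges_append)
      moreover have "x \<in> B" "y \<in> B" using LB[OF that(2)] B'B by auto
      moreover have "f \<subseteq> set (P (x, y)) \<and> f \<noteq> {}" if "f \<in> path_edges (P (x, y))" for f
        using path_edges_sub[OF that] that by (auto simp: path_edges_def)
      ultimately show ?thesis using that(1) \<open>P (x, y) \<noteq> []\<close> by (auto simp: hd_in_set last_in_set)
    qed
    have dP: "set (P (u, v)) \<inter> set (P (u', v')) = {}" using bspec[OF bspec[OF D e(1)] e(2)] ne by blast
    show "path_edges (Q u v) \<inter> path_edges (Q u' v') = {}"
    proof (rule ccontr)
      assume "\<not> ?thesis"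
      then obtain f where f: "f \<in> path_edges (Q u v)" "f \<in> path_edges (Q u' v')" by blast
      show False using sub[OF f(1) e(1)] sub[OF f(2) e(2)] dP PB[OF e(1)] PB[OF e(2)] by blast
    qed
  qed
qed

end

section \<open>Length-two paths in the dense case\<close>

definition swap_ends :: "(nat \<times> nat \<times> nat) set \<Rightarrow> (nat \<times> nat \<times> nat) set" where
  "swap_ends T = (\<lambda>(x, y, w). (y, x, w)) ` T"

lemma in_swap_ends [simp]: "(y, x, w) \<in> swap_ends T \<longleftrightarrow> (x, y, w) \<in> T"
  by (force simp: swap_ends_def)

lemma card_swap_ends [simp]: "card (swap_ends T) = card T"
  unfolding swap_ends_def by (intro card_image) (auto simp: inj_on_def)

lemma swap_swap_ends [simp]: "swap_ends (swap_ends T) = T"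
  by auto

context quasirandom
begin

text \<open>A triple \<open>(x, y, w)\<close> stands for the path \<open>x\<close>,
  \<open>w\<close>, \<open>y\<close>. The last two clauses make the pairs served by one hub a
  matching, so that no hub edge is used twice; adjacent pairs are left to their own edge.\<close>

definition packing :: "nat set \<Rightarrow> nat set \<Rightarrow> nat set \<Rightarrow> (nat \<times> nat \<times> nat) set \<Rightarrow> bool" where
  "packing X Y P T \<longleftrightarrow> finite T \<and>
     (\<forall>x y w. (x, y, w) \<in> T \<longrightarrow> x \<in> X \<and> y \<in> Y \<and> w \<in> P \<and> w \<in> N x \<and> w \<in> N y \<and> y \<notin> N x) \<and>
     (\<forall>x y w w'. (x, y, w) \<in> T \<longrightarrow> (x, y, w') \<in> T \<longrightarrow> w = w') \<and>
     (\<forall>x y y' w. (x, y, w) \<in> T \<longrightarrow> (x, y', w) \<in> T \<longrightarrow> y = y') \<and>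
     (\<forall>x x' y w. (x, y, w) \<in> T \<longrightarrow> (x', y, w) \<in> T \<longrightarrow> x = x')"

definition unserved :: "nat set \<Rightarrow> (nat \<times> nat \<times> nat) set \<Rightarrow> nat \<Rightarrow> nat set" where
  "unserved Y T x = {y \<in> Y. y \<notin> N x \<and> (\<forall>w. (x, y, w) \<notin> T)}"

text \<open>Each triple uses its own edge between \<open>X\<close> and \<open>P\<close>, so for a
  packing this is the number of hub edges at \<open>X\<close> left idle. It is the quantity
  controlled by the Gronwall estimate.\<close>

definition missed :: "nat set \<Rightarrow> nat set \<Rightarrow> (nat \<times> nat \<times> nat) set \<Rightarrow> real" where
  "missed X P T = (\<Sum>x\<in>X. real (card (N x \<inter> P))) - real (card T)"

lemma packing_swap:
  assumes "packing X Y P T"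
  shows "packing Y X P (swap_ends T)"
  unfolding packing_def in_swap_ends
proof (intro conjI allI impI)
  show "finite (swap_ends T)" using assms by (simp add: packing_def swap_ends_def)
next
  fix y x w assume "(x, y, w) \<in> T"
  then have *: "x \<in> X \<and> y \<in> Y \<and> w \<in> P \<and> w \<in> N x \<and> w \<in> N y \<and> y \<notin> N x"
    using assms unfolding packing_def by blast
  then show "y \<in> Y" "x \<in> X" "w \<in> P" "w \<in> N y" "w \<in> N x" by blast+
  show "x \<notin> N y" using * by (subst N_sym) blast
qed (use assms in \<open>unfold packing_def, blast+\<close>)

lemma unserved_swap: "x \<in> X \<Longrightarrow> y \<in> unserved Y T x \<Longrightarrow> x \<in> unserved X (swap_ends T) y"
  by (auto simp: unserved_def N_sym)

lemma
  assumes T: "packing X Y P T" and sub: "X \<subseteq> V" "Y \<subseteq> V" "P \<subseteq> V" and x: "x \<in> X"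
  shows card_unserved: "real (card (unserved Y T x)) = real (card Y) - real (card (N x \<inter> Y)) - real (card {e \<in> T. fst e = x})"
    and card_used_le: "card {e \<in> T. fst e = x} \<le> card (N x \<inter> P)"
proof -
  define Tx where "Tx = {e \<in> T. fst e = x}"
  have fT: "finite T" using T by (simp add: packing_def)
  have mem: "\<And>e. e \<in> Tx \<longleftrightarrow> e = (x, fst (snd e), snd (snd e)) \<and> e \<in> T" by (auto simp: Tx_def)
  have fY: "finite Y" using sub fin_sub by auto
  have i1: "inj_on (\<lambda>e. fst (snd e)) Tx"
    unfolding inj_on_def Tx_def using T unfolding packing_def by fastforce
  have i2: "inj_on (\<lambda>e. snd (snd e)) Tx"
    unfolding inj_on_def Tx_def using T unfolding packing_def by fastforce
  define Ty where "Ty = (\<lambda>e. fst (snd e)) ` Tx"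
  have Ty: "Ty = {y. \<exists>w. (x, y, w) \<in> T}" unfolding Ty_def Tx_def by force
  have "Ty \<subseteq> Y - N x" unfolding Ty using T unfolding packing_def by blast
  moreover have "unserved Y T x = (Y - N x) - Ty" unfolding Ty unserved_def by blast
  moreover have "card Ty = card Tx" unfolding Ty_def by (rule card_image[OF i1])
  ultimately have "card (unserved Y T x) = card (Y - N x) - card Tx" and le: "card Tx \<le> card (Y - N x)"
    using fY card_Diff_subset[of Ty "Y - N x"] card_mono[of "Y - N x" Ty] by (auto intro: finite_subset)
  moreover have "card (Y - N x) = card Y - card (N x \<inter> Y)" "card (N x \<inter> Y) \<le> card Y"
    using fY card_mono[of Y "N x \<inter> Y"] by (simp_all add: card_Diff_subset_Int Int_commute)
  ultimately show "real (card (unserved Y T x)) = real (card Y) - real (card (N x \<inter> Y)) - real (card {e \<in> T. fst e = x})"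
    unfolding Tx_def[symmetric] by linarith
  have "(\<lambda>e. snd (snd e)) ` Tx \<subseteq> N x \<inter> P"
    unfolding Tx_def using T unfolding packing_def by fastforce
  then have "card ((\<lambda>e. snd (snd e)) ` Tx) \<le> card (N x \<inter> P)" by (intro card_mono) auto
  then show "card {e \<in> T. fst e = x} \<le> card (N x \<inter> P)" using card_image[OF i2] by (simp add: Tx_def)
qed

lemma card_packing_sum:
  assumes T: "packing X Y P T" and "finite X"
  shows "card T = (\<Sum>x\<in>X. card {e \<in> T. fst e = x})"
proof -
  have fT: "finite T" using T by (simp add: packing_def)
  have "T = (\<Union>x\<in>X. {e \<in> T. fst e = x})" using T unfolding packing_def by fastforce
  then have "card T = card (\<Union>x\<in>X. {e \<in> T. fst e = x})" by (rule arg_cong)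
  also have "\<dots> = (\<Sum>x\<in>X. card {e \<in> T. fst e = x})"
    using assms(2) fT by (intro card_UN_disjoint) auto
  finally show ?thesis .
qed

text \<open>\<open>D\<close> is what would be left at each \<open>x\<close> if densities were exact
  and every hub edge were used: \<open>p * card Y\<close> partners are adjacent and
  \<open>p * card P\<close> are served. The errors are two discrepancies of at most
  \<open>lam * n\<close> each and the idle edges, which all count with the same sign.\<close>

lemma unserved_deviation:
  assumes T: "packing X Y P T" and sub: "X \<subseteq> V" "Y \<subseteq> V" "P \<subseteq> V"
    and D: "D = real (card Y) - p * real (card Y) - p * real (card P)"
  shows "(\<Sum>x\<in>X. \<bar>real (card (unserved Y T x)) - D\<bar>) \<le> 2 * lam * real n + missed X P T" and "0 \<le> missed X P T"
proof -
  define c where "c x = real (card {e \<in> T. fst e = x})" for x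
  have fX: "finite X" using sub fin_sub by auto
  have T_sum: "real (card T) = (\<Sum>x\<in>X. c x)"
    unfolding card_packing_sum[OF T fX] c_def by simp
  have le: "c x \<le> real (card (N x \<inter> P))" if "x \<in> X" for x
    unfolding c_def of_nat_le_iff by (rule card_used_le[OF T sub that])
  have "(\<Sum>x\<in>X. \<bar>real (card (unserved Y T x)) - D\<bar>) \<le>
    (\<Sum>x\<in>X. \<bar>real (card (N x \<inter> Y)) - p * real (card Y)\<bar> + \<bar>real (card (N x \<inter> P)) - p * real (card P)\<bar>
       + (real (card (N x \<inter> P)) - c x))"
  proof (rule sum_mono)
    fix x assume x: "x \<in> X"
    have "real (card (unserved Y T x)) = real (card Y) - real (card (N x \<inter> Y)) - c x"
      unfolding c_def by (rule card_unserved[OF T sub x])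
    then show "\<bar>real (card (unserved Y T x)) - D\<bar> \<le> \<bar>real (card (N x \<inter> Y)) - p * real (card Y)\<bar> + \<bar>real (card (N x \<inter> P)) - p * real (card P)\<bar>
       + (real (card (N x \<inter> P)) - c x)"
      using le[OF x] unfolding D by linarith
  qed
  also have "\<dots> \<le> lam * real n + lam * real n + missed X P T"
    using abs_deviation_sum[OF sub(1,2)] abs_deviation_sum[OF sub(1,3)]
    by (simp add: sum.distrib sum_subtractf missed_def T_sum)
  finally show "(\<Sum>x\<in>X. \<bar>real (card (unserved Y T x)) - D\<bar>) \<le> 2 * lam * real n + missed X P T" by simp
  have "0 \<le> (\<Sum>x\<in>X. real (card (N x \<inter> P)) - c x)" by (rule sum_nonneg) (use le in force)
  then show "0 \<le> missed X P T" by (simp add: missed_def T_sum sum_subtractf)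
qed

text \<open>Measures how unevenly the unserved sets meet the neighbourhood of the hub
  \<open>w\<close>. It is controlled only on average over hubs, which is why the next hub has to be
  selected.\<close>

definition deviation :: "nat set \<Rightarrow> nat set \<Rightarrow> (nat \<times> nat \<times> nat) set \<Rightarrow> nat \<Rightarrow> real" where
  "deviation X Y T w = (\<Sum>x\<in>X. \<bar>real (card (N w \<inter> unserved Y T x)) - p * real (card (unserved Y T x))\<bar>)"

lemma deviation_sum:
  assumes sub: "X \<subseteq> V" "Y \<subseteq> V" "R \<subseteq> V"
  shows "(\<Sum>w\<in>R. deviation X Y T w) \<le> lam * (real n)\<^sup>2"
proof -
  have "(\<Sum>w\<in>R. deviation X Y T w) = (\<Sum>x\<in>X. \<Sum>w\<in>R. \<bar>real (card (N w \<inter> unserved Y T x)) - p * real (card (unserved Y T x))\<bar>)"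
    unfolding deviation_def by (rule sum.swap)
  also have "\<dots> \<le> (\<Sum>x\<in>X. lam * real n)"
    by (rule sum_mono, rule abs_deviation_sum) (use sub in \<open>auto simp: unserved_def\<close>)
  also have "\<dots> \<le> real n * (lam * real n)"
    using card_sub[OF sub(1)] lam_nonneg by (simp add: mult_right_mono)
  finally show ?thesis by (simp add: power2_eq_square mult_ac)
qed

text \<open>If the unserved pairs were exactly \<open>D\<close>-regular and spread evenly over neighbourhoods, counting edges
  between \<open>A\<close> and its neighbourhood would give Hall's condition inside \<open>N w\<close> without error terms.\<close>

lemma unserved_hall:
  assumes sub: "X \<subseteq> V" "Y \<subseteq> V" and A: "A \<subseteq> N w \<inter> X" and D: "0 \<le> D"
  shows "p * D * real (card A) \<le> p * D * real (card (\<Union>x\<in>A. unserved Y T x \<inter> N w))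
    + (deviation X Y T w + p * (\<Sum>x\<in>X. \<bar>real (card (unserved Y T x)) - D\<bar>))
    + (deviation Y X (swap_ends T) w + p * (\<Sum>y\<in>Y. \<bar>real (card (unserved X (swap_ends T) y)) - D\<bar>))"
proof -
  define U where "U = (\<Union>x\<in>A. unserved Y T x \<inter> N w)"
  define dv where "dv X Y T x = \<bar>real (card (N w \<inter> unserved Y T x)) - p * real (card (unserved Y T x))\<bar> + p * \<bar>real (card (unserved Y T x)) - D\<bar>" for X Y :: "nat set" and T x
  have fX: "finite X" and fY: "finite Y" using sub fin_sub by auto
  have fA: "finite A" using A fX finite_subset by auto
  have UY: "U \<subseteq> Y" by (auto simp: U_def unserved_def)
  have dv_pos: "0 \<le> dv X Y T x" for X Y T x by (simp add: dv_def)
  have dv: "\<bar>real (card (N w \<inter> unserved Y T x)) - p * D\<bar> \<le> dv X Y T x" for X Y T x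
  proof -
    have eq: "\<bar>p * real (card (unserved Y T x)) - p * D\<bar> = p * \<bar>real (card (unserved Y T x)) - D\<bar>"
    proof -
      have "0 \<le> p" by simp
      then show ?thesis unfolding right_diff_distrib[symmetric] abs_mult by (simp only: abs_of_nonneg)
    qed
    have "\<bar>a - c\<bar> \<le> \<bar>a - b\<bar> + \<bar>b - c\<bar>" for a b c :: real by linarith
    then show ?thesis unfolding dv_def eq[symmetric] .
  qed
  have sum_dv: "(\<Sum>x\<in>X. dv X Y T x) = deviation X Y T w + p * (\<Sum>x\<in>X. \<bar>real (card (unserved Y T x)) - D\<bar>)" for X Y T
    by (simp add: dv_def deviation_def sum.distrib sum_distrib_left)
  have "p * D * real (card A) = (\<Sum>x\<in>A. p * D)" by simp
  also have "\<dots> \<le> (\<Sum>x\<in>A. real (card (N w \<inter> unserved Y T x)) + dv X Y T x)"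
  proof (rule sum_mono)
    fix x show "p * D \<le> real (card (N w \<inter> unserved Y T x)) + dv X Y T x" using dv[where X = X and Y = Y and T = T and x = x] by linarith
  qed
  also have "\<dots> = (\<Sum>x\<in>A. real (card (N w \<inter> unserved Y T x))) + (\<Sum>x\<in>A. dv X Y T x)" by (rule sum.distrib)
  also have "(\<Sum>x\<in>A. dv X Y T x) \<le> (\<Sum>x\<in>X. dv X Y T x)"
    using fX A dv_pos by (intro sum_mono2) auto
  also have "(\<Sum>x\<in>A. real (card (N w \<inter> unserved Y T x))) = real (card (SIGMA x : A. N w \<inter> unserved Y T x))"
    using fA by (subst card_SigmaI) auto
  also have "card (SIGMA x : A. N w \<inter> unserved Y T x) \<le> card (SIGMA y : U. {x \<in> A. y \<in> unserved Y T x})"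
  proof (rule card_inj_on_le[of "\<lambda>(x, y). (y, x)"])
    show "inj_on (\<lambda>(x, y). (y, x)) (SIGMA x : A. N w \<inter> unserved Y T x)" by (auto simp: inj_on_def)
    show "(\<lambda>(x, y). (y, x)) ` (SIGMA x : A. N w \<inter> unserved Y T x) \<subseteq> (SIGMA y : U. {x \<in> A. y \<in> unserved Y T x})"
      by (auto simp: U_def)
    show "finite (SIGMA y : U. {x \<in> A. y \<in> unserved Y T x})"
      using fA UY fY finite_subset by (intro finite_SigmaI) auto
  qed
  also have "real \<dots> = (\<Sum>y\<in>U. real (card {x \<in> A. y \<in> unserved Y T x}))"
    using fA UY fY finite_subset by (subst card_SigmaI) auto
  finally have 1: "p * D * real (card A) \<le> (\<Sum>y\<in>U. real (card {x \<in> A. y \<in> unserved Y T x})) + (\<Sum>x\<in>X. dv X Y T x)"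
    by simp
  have "(\<Sum>y\<in>U. real (card {x \<in> A. y \<in> unserved Y T x})) \<le> (\<Sum>y\<in>U. p * D + dv Y X (swap_ends T) y)"
  proof (rule sum_mono)
    fix y
    have "{x \<in> A. y \<in> unserved Y T x} \<subseteq> N w \<inter> unserved X (swap_ends T) y" using A unserved_swap by blast
    then have "card {x \<in> A. y \<in> unserved Y T x} \<le> card (N w \<inter> unserved X (swap_ends T) y)" by (intro card_mono) auto
    then show "real (card {x \<in> A. y \<in> unserved Y T x}) \<le> p * D + dv Y X (swap_ends T) y"
      using dv[where X = Y and Y = X and T = "swap_ends T" and x = y] by linarith
  qed
  also have "\<dots> = p * D * real (card U) + (\<Sum>y\<in>U. dv Y X (swap_ends T) y)" by (simp add: sum.distrib)
  also have "(\<Sum>y\<in>U. dv Y X (swap_ends T) y) \<le> (\<Sum>y\<in>Y. dv Y X (swap_ends T) y)"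
    using fY UY dv_pos by (intro sum_mono2) auto
  finally have 2: "(\<Sum>y\<in>U. real (card {x \<in> A. y \<in> unserved Y T x})) \<le> p * D * real (card U) + (\<Sum>y\<in>Y. dv Y X (swap_ends T) y)"
    by simp
  show ?thesis using 1 2 unfolding sum_dv U_def[symmetric] by linarith
qed

section \<open>Adding one hub, and iterating\<close>

lemma packing_extend:
  assumes T: "packing X Y P T" and w: "w \<notin> P" and fX: "finite X'" and X': "X' \<subseteq> N w \<inter> X"
    and f: "inj_on f X'" "\<And>x. x \<in> X' \<Longrightarrow> f x \<in> unserved Y T x \<inter> N w"
  shows "packing X Y (insert w P) (T \<union> (\<lambda>x. (x, f x, w)) ` X')" and
    "card (T \<union> (\<lambda>x. (x, f x, w)) ` X') = card T + card X'"
proof -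
  define G where "G = (\<lambda>x. (x, f x, w)) ` X'"
  have G: "(a, b, c) \<in> G \<longleftrightarrow> a \<in> X' \<and> b = f a \<and> c = w" for a b c by (auto simp: G_def)
  have fT: "finite T" using T by (simp add: packing_def)
  have TP: "w' \<in> P" if "(a, b, w') \<in> T" for a b w' using T that unfolding packing_def by blast
  have fo: "f x \<in> Y" "f x \<notin> N x" "(x, f x, v) \<notin> T" "f x \<in> N w" if "x \<in> X'" for x v
    using f(2)[OF that] by (auto simp: unserved_def)
  have t1: "w1 = w2" if "(a, b, w1) \<in> T" "(a, b, w2) \<in> T" for a b w1 w2
    using T that unfolding packing_def by blast
  have t2: "b1 = b2" if "(a, b1, v) \<in> T" "(a, b2, v) \<in> T" for a b1 b2 v
    using T that unfolding packing_def by blast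
  have t3: "a1 = a2" if "(a1, b, v) \<in> T" "(a2, b, v) \<in> T" for a1 a2 b v
    using T that unfolding packing_def by blast
  have t0: "a \<in> X \<and> b \<in> Y \<and> v \<in> P \<and> v \<in> N a \<and> v \<in> N b \<and> b \<notin> N a" if "(a, b, v) \<in> T" for a b v
    using T that unfolding packing_def by blast
  show "packing X Y (insert w P) (T \<union> (\<lambda>x. (x, f x, w)) ` X')"
    unfolding G_def[symmetric] packing_def
  proof (intro conjI allI impI)
    show "finite (T \<union> G)" using fT fX by (simp add: G_def)
  next
    fix a b v assume "(a, b, v) \<in> T \<union> G"
    then have "(a, b, v) \<in> T \<or> (a \<in> X' \<and> b = f a \<and> v = w)" by (simp add: G)
    then show "a \<in> X" "b \<in> Y" "v \<in> insert w P" "v \<in> N a" "v \<in> N b" "b \<notin> N a"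
      using t0[of a b v] fo[of a] X' N_sym[of w a] N_sym[of w b] by blast+
  next
    fix a b v v' assume "(a, b, v) \<in> T \<union> G" "(a, b, v') \<in> T \<union> G"
    then show "v = v'" using t1[of a b v v'] fo(3)[of a] by (auto simp: G)
  next
    fix a b b' v assume "(a, b, v) \<in> T \<union> G" "(a, b', v) \<in> T \<union> G"
    then show "b = b'" using t2[of a b v b'] TP w by (auto simp: G)
  next
    fix a a' b v assume "(a, b, v) \<in> T \<union> G" "(a', b, v) \<in> T \<union> G"
    then show "a = a'" using t3[of a b v a'] TP w f(1) by (auto simp: G dest: inj_onD)
  qed
  have "T \<inter> G = {}" using fo(3) by (auto simp: G_def)
  moreover have "card G = card X'" unfolding G_def by (rule card_image) (auto simp: inj_on_def)
  ultimately show "card (T \<union> (\<lambda>x. (x, f x, w)) ` X') = card T + card X'"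
    unfolding G_def[symmetric] using fT fX by (subst card_Un_disjoint) (auto simp: G_def)
qed

lemma missed_insert:
  assumes "w \<notin> P" "finite P" "finite X"
  shows "missed X (insert w P) T' = missed X P T + real (card (N w \<inter> X)) - (real (card T') - real (card T))"
proof -
  have "real (card (N x \<inter> insert w P)) = real (card (N x \<inter> P)) + (if x \<in> N w then 1 else 0)" for x
  proof (cases "w \<in> N x")
    case True
    then have "N x \<inter> insert w P = insert w (N x \<inter> P)" by auto
    then show ?thesis using assms True N_sym[of w x] by simp
  next
    case False
    then have "N x \<inter> insert w P = N x \<inter> P" by auto
    then show ?thesis using False N_sym[of w x] by simp
  qed
  then have "(\<Sum>x\<in>X. real (card (N x \<inter> insert w P))) = (\<Sum>x\<in>X. real (card (N x \<inter> P))) + (\<Sum>x\<in>X. if x \<in> N w then 1 else 0)"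
    by (simp add: sum.distrib)
  also have "(\<Sum>x\<in>X. if x \<in> N w then 1 else 0) = real (card (N w \<inter> X))"
  proof -
    have "X \<inter> {x. x \<in> N w} = N w \<inter> X" by auto
    then show ?thesis using assms(3) by (simp add: sum.If_cases)
  qed
  finally show ?thesis by (simp add: missed_def)
qed

text \<open>Averaging over the remaining hubs, at least \<open>r0\<close> many, yields a
  \<open>w\<close> of small deviation. Hall's theorem with deficiency \<open>k\<close>, the total
  error divided by \<open>p * D\<close>, then matches almost all of its neighbourhood. The error
  contains \<open>p * \<tau>\<close>, so idle edges breed new ones at a rate of order
  \<open>1 / D\<close>; hence the factor \<open>1 + 3 / D0\<close>.\<close>

lemma packing_step:
  assumes T: "packing X Y P T" and sub: "X \<subseteq> V" "Y \<subseteq> V" "W \<subseteq> V" "P \<subseteq> W"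
    and s: "card X = s" "card Y = s"
    and D: "D = real s - p * real s - p * real (card P)" and D0: "0 < D0" "D0 \<le> D"
    and r0: "0 < r0" "r0 \<le> real (card (W - P))"
    and \<tau>: "\<tau> = missed X P T + missed Y P T"
  shows "\<exists>w T'. w \<in> W - P \<and> packing X Y (insert w P) T' \<and>
    missed X (insert w P) T' + missed Y (insert w P) T' \<le>
      \<tau> * (1 + 3 / D0) + (6 * lam * real n ^ 3 / (r0 * real d * D0) + 12 * lam * real n / D0)"
proof -
  define T2 where "T2 = swap_ends T"
  have T2: "packing Y X P T2" unfolding T2_def by (rule packing_swap[OF T])
  have PV: "P \<subseteq> V" using sub by auto
  have fin: "finite X" "finite Y" "finite P" "finite W" using sub PV fin_sub by auto
  have ppos: "0 < p" using d_pos n_pos by simp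
  define g where "g w = deviation X Y T w + deviation Y X T2 w" for w
  have sumg: "(\<Sum>w\<in>W - P. g w) \<le> 2 * (lam * (real n)\<^sup>2)"
  proof -
    have WP: "W - P \<subseteq> V" using sub by auto
    show ?thesis unfolding g_def sum.distrib
      using deviation_sum[OF sub(1,2) WP, of T] deviation_sum[OF sub(2,1) WP, of T2] by linarith
  qed
  define c where "c = 2 * (lam * (real n)\<^sup>2) / r0"
  have "\<exists>w\<in>W - P. g w \<le> c"
  proof (rule ccontr)
    assume "\<not> ?thesis"
    then have gt: "\<And>w. w \<in> W - P \<Longrightarrow> c < g w" using not_le by blast
    have ne: "W - P \<noteq> {}" using r0 by (metis card.empty of_nat_0 not_le)
    have "2 * (lam * (real n)\<^sup>2) = c * r0" using r0 by (simp add: c_def)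
    also have "\<dots> \<le> c * real (card (W - P))" using r0 lam_nonneg by (intro mult_left_mono) (auto simp: c_def)
    also have "\<dots> = (\<Sum>w\<in>W - P. c)" by simp
    also have "\<dots> < (\<Sum>w\<in>W - P. g w)" using gt ne fin by (intro sum_strict_mono) auto
    finally show False using sumg by simp
  qed
  then obtain w where w: "w \<in> W - P" "g w \<le> c" by auto
  define e where "e = g w + p * (4 * lam * real n + \<tau>)"
  have D0': "0 < D" using D0 by simp
  have irr: "(\<Sum>x\<in>X. \<bar>real (card (unserved Y T x)) - D\<bar>) \<le> 2 * lam * real n + missed X P T"
    "(\<Sum>y\<in>Y. \<bar>real (card (unserved X T2 y)) - D\<bar>) \<le> 2 * lam * real n + missed Y P T2"
    by (rule unserved_deviation[OF T sub(1,2) PV], use D s in simp) (rule unserved_deviation[OF T2 sub(2,1) PV], use D s in simp)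
  have m2: "missed Y P T2 = missed Y P T" by (simp add: missed_def T2_def)
  have pos: "0 \<le> missed X P T" "0 \<le> missed Y P T2"
    using unserved_deviation(2)[OF T sub(1,2) PV refl] unserved_deviation(2)[OF T2 sub(2,1) PV refl] by auto
  have tot: "(deviation X Y T w + p * (\<Sum>x\<in>X. \<bar>real (card (unserved Y T x)) - D\<bar>)) + (deviation Y X T2 w + p * (\<Sum>y\<in>Y. \<bar>real (card (unserved X T2 y)) - D\<bar>)) \<le> e"
  proof -
    have "p * (\<Sum>x\<in>X. \<bar>real (card (unserved Y T x)) - D\<bar>) + p * (\<Sum>y\<in>Y. \<bar>real (card (unserved X T2 y)) - D\<bar>)
      \<le> p * (2 * lam * real n + missed X P T) + p * (2 * lam * real n + missed Y P T2)"
      using irr ppos by (intro add_mono mult_left_mono) auto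
    also have "\<dots> = p * (4 * lam * real n + \<tau>)" using \<tau> m2 by (simp add: algebra_simps)
    finally show ?thesis unfolding e_def g_def by linarith
  qed
  define k where "k = nat \<lfloor>e / (p * D)\<rfloor>"
  have pD: "0 < p * D" using ppos D0' by (rule mult_pos_pos)
  have tau0: "0 \<le> \<tau>" using \<tau> pos m2 by simp
  have e0: "0 \<le> e"
  proof -
    have "0 \<le> g w" unfolding g_def deviation_def by (intro add_nonneg_nonneg sum_nonneg) auto
    moreover have "0 \<le> 4 * lam * real n + \<tau>" using lam_nonneg tau0 by simp
    then have "0 \<le> p * (4 * lam * real n + \<tau>)" using ppos by simp
    ultimately show ?thesis unfolding e_def by simp
  qed
  have k: "real k \<le> e / (p * D)"
    unfolding k_def using e0 pD by (intro of_nat_floor divide_nonneg_pos)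
  have hall: "a \<le> b + k" if "p * D * real a \<le> p * D * real b + e" for a b
  proof (cases "a \<le> b")
    case False
    have "(real a - real b) * (p * D) = p * D * real a - p * D * real b"
      by (rule trans[OF mult.commute right_diff_distrib])
    then have "(real a - real b) * (p * D) \<le> e" using that by linarith
    then have "real a - real b \<le> e / (p * D)" unfolding pos_le_divide_eq[OF pD] .
    then have "real (a - b) \<le> e / (p * D)" using False by (simp add: of_nat_diff)
    then have "a - b \<le> k" unfolding k_def by (simp add: le_nat_floor)
    then show ?thesis by simp
  qed simp
  define R where "R x = unserved Y T x \<inter> N w" for x
  have hX: "card A \<le> card (\<Union>(R ` A)) + k" if "A \<subseteq> N w \<inter> X" for A
  proof (rule hall)
    show "p * D * real (card A) \<le> p * D * real (card (\<Union>(R ` A))) + e"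
      using unserved_hall[OF sub(1,2) that, of D T] D0' tot unfolding R_def T2_def by linarith
  qed
  \<comment> \<open>The same count from the side of \<open>Y\<close> bounds the excess of its part
    of the neighbourhood over that of \<open>X\<close>, and with it the idle edges at
    \<open>Y\<close>.\<close>
  have hY: "card (N w \<inter> Y) \<le> card (N w \<inter> X) + k"
  proof (rule hall)
    have "(\<Union>x\<in>N w \<inter> Y. unserved X T2 x \<inter> N w) \<subseteq> N w \<inter> X" by (auto simp: unserved_def)
    then have "card (\<Union>x\<in>N w \<inter> Y. unserved X T2 x \<inter> N w) \<le> card (N w \<inter> X)" by (intro card_mono) auto
    then have "p * D * real (card (\<Union>x\<in>N w \<inter> Y. unserved X T2 x \<inter> N w)) \<le> p * D * real (card (N w \<inter> X))"
      using pD by (intro mult_left_mono) auto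
    moreover have "p * D * real (card (N w \<inter> Y)) \<le> p * D * real (card (\<Union>x\<in>N w \<inter> Y. unserved X T2 x \<inter> N w)) + e"
      using unserved_hall[OF sub(2,1) order_refl, of D w T2] D0' tot unfolding T2_def swap_swap_ends by linarith
    ultimately show "p * D * real (card (N w \<inter> Y)) \<le> p * D * real (card (N w \<inter> X)) + e" by linarith
  qed
  have "\<exists>X' f. X' \<subseteq> N w \<inter> X \<and> card (N w \<inter> X) \<le> card X' + k \<and> inj_on f X' \<and> (\<forall>x\<in>X'. f x \<in> R x)"
    by (rule hall_deficiency) (use hX in \<open>auto simp: R_def\<close>)
  then obtain X' f where X': "X' \<subseteq> N w \<inter> X" "card (N w \<inter> X) \<le> card X' + k" "inj_on f X'" "\<forall>x\<in>X'. f x \<in> R x"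
    by blast
  define T' where "T' = T \<union> (\<lambda>x. (x, f x, w)) ` X'"
  have fX': "finite X'" using X'(1) fin(1) finite_subset by blast
  have wP: "w \<notin> P" using w by auto
  have fR: "f x \<in> unserved Y T x \<inter> N w" if "x \<in> X'" for x using X'(4) that unfolding R_def by blast
  have T': "packing X Y (insert w P) T'" "card T' = card T + card X'"
    unfolding T'_def using packing_extend[OF T wP fX' X'(1,3) fR] by blast+
  have "missed X (insert w P) T' + missed Y (insert w P) T'
     = \<tau> + real (card (N w \<inter> X)) + real (card (N w \<inter> Y)) - 2 * real (card X')"
    using missed_insert[OF wP fin(3,1), of T' T] missed_insert[OF wP fin(3,2), of T' T] T'(2) \<tau> by simp
  \<comment> \<open>At most \<open>k\<close> edges of \<open>w\<close> stay idle at \<open>X\<close>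
    and at most \<open>2 * k\<close> at \<open>Y\<close>: \<open>k\<close> from the matching and
    \<open>k\<close> from the difference in size.\<close>
  also have "\<dots> \<le> \<tau> + 3 * real k" using X'(2) hY by linarith
  also have "\<dots> \<le> \<tau> + 3 * (e / (p * D))" using k by simp
  also have "\<dots> \<le> \<tau> + 3 * (e / (p * D0))"
    using e0 D0 ppos by (intro add_left_mono mult_left_mono divide_left_mono mult_pos_pos) auto
  also have "\<dots> \<le> \<tau> + 3 * ((c + p * (4 * lam * real n + \<tau>)) / (p * D0))"
    using w(2) D0 ppos unfolding e_def by (intro add_left_mono mult_left_mono divide_right_mono) auto
  also have "\<dots> = \<tau> * (1 + 3 / D0) + (6 * lam * real n ^ 3 / (r0 * real d * D0) + 12 * lam * real n / D0)"
  proof -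
    have "(c + p * (4 * lam * real n + \<tau>)) / (p * D0) = c / (p * D0) + (4 * lam * real n + \<tau>) / D0"
    proof -
      have "p \<noteq> 0" using ppos by linarith
      then have "p * z / (p * D0) = z / D0" for z by (rule mult_divide_mult_cancel_left)
      then show ?thesis by (subst add_divide_distrib) (simp only:)
    qed
    moreover have "c / (p * D0) = 2 * lam * real n ^ 3 / (r0 * real d * D0)"
      using n_pos d_pos by (simp add: c_def power2_eq_square power3_eq_cube field_simps)
    ultimately show ?thesis by (simp add: algebra_simps add_divide_distrib)
  qed
  finally show ?thesis using w(1) T'(1) by blast
qed

text \<open>Discrete Gronwall: the recursion with factor \<open>1 + 3 / D0\<close> and increment
  \<open>A\<close> is iterated from zero.\<close>

lemma packing_run:
  assumes sub: "X \<subseteq> V" "Y \<subseteq> V" "W \<subseteq> V" and s: "card X = s" "card Y = s"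
    and D0: "0 < D0" and r0: "0 < r0"
    and A: "A = 6 * lam * real n ^ 3 / (r0 * real d * D0) + 12 * lam * real n / D0"
  shows "(\<And>t'. t' < t \<Longrightarrow> D0 \<le> real s - p * real s - p * real t' \<and> r0 \<le> real (card W) - real t') \<Longrightarrow>
    \<exists>P T. P \<subseteq> W \<and> card P = t \<and> packing X Y P T \<and> missed X P T + missed Y P T \<le> A * real t * (1 + 3 / D0) ^ t"
proof (induction t)
  case 0
  show ?case by (intro exI[of _ "{}"]) (auto simp: packing_def missed_def)
next
  case (Suc t)
  have fW: "finite W" using sub fin_sub by auto
  obtain P T where P: "P \<subseteq> W" "card P = t" and T: "packing X Y P T"
    and m: "missed X P T + missed Y P T \<le> A * real t * (1 + 3 / D0) ^ t"
    using Suc.IH Suc.prems less_SucI by blast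
  have fP: "finite P" using P fW finite_subset by auto
  have tt: "D0 \<le> real s - p * real s - p * real t" "r0 \<le> real (card W) - real t" using Suc.prems[of t] by auto
  have "card (W - P) = card W - t" using P fP by (simp add: card_Diff_subset)
  then have "r0 \<le> real (card (W - P))" using tt(2) r0 by (simp add: of_nat_diff)
  from packing_step[OF T sub P(1) s refl D0 _ r0 this refl] P(2) tt(1)
  obtain w T' where w: "w \<in> W - P" and T': "packing X Y (insert w P) T'"
    and m': "missed X (insert w P) T' + missed Y (insert w P) T' \<le> (missed X P T + missed Y P T) * (1 + 3 / D0) + A"
    unfolding A by blast
  have A0: "0 \<le> A" unfolding A using lam_nonneg r0 D0 by (intro add_nonneg_nonneg divide_nonneg_pos mult_pos_pos) (use d_pos in auto)
  have q: "1 \<le> (1 + 3 / D0) ^ Suc t" using D0 by (intro one_le_power) auto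
  have "missed X (insert w P) T' + missed Y (insert w P) T' \<le> A * real t * (1 + 3 / D0) ^ t * (1 + 3 / D0) + A"
    using m' mult_right_mono[OF m, of "1 + 3 / D0"] D0 by (smt (verit) divide_nonneg_pos)
  also have "\<dots> = A * real t * (1 + 3 / D0) ^ Suc t + A * 1" by simp
  also have "\<dots> \<le> A * real t * (1 + 3 / D0) ^ Suc t + A * (1 + 3 / D0) ^ Suc t"
    using q A0 by (intro add_left_mono mult_left_mono)
  also have "\<dots> = A * real (Suc t) * (1 + 3 / D0) ^ Suc t"
  proof -
    have "A * x * Q + A * Q = A * (1 + x) * Q" for x Q :: real by (simp add: algebra_simps)
    then show ?thesis by (simp only: of_nat_Suc)
  qed
  finally have "missed X (insert w P) T' + missed Y (insert w P) T' \<le> A * real (Suc t) * (1 + 3 / D0) ^ Suc t" .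
  then show ?case using w T' P fP by (intro exI[of _ "insert w P"] exI[of _ T']) auto
qed

text \<open>Hubs are consumed until the ideal residual degree is about \<open>D0\<close>; then each
  \<open>x\<close> has about \<open>D0\<close> unserved partners, up to the accumulated
  irregularity. As at most \<open>n\<close> hubs are used, the Gronwall factor is bounded by the
  exponential.\<close>

lemma packing_exists:
  assumes sub: "X \<subseteq> V" "Y \<subseteq> V" "W \<subseteq> V" and s: "card X = s" "card Y = s"
    and D0: "2 \<le> D0" and size: "real s * (1 - p) \<le> p * real (card W) + 1"
  shows "\<exists>T. packing X Y W T \<and> real (card {(x, y). x \<in> X \<and> y \<in> Y \<and> y \<notin> N x}) - real (card T) \<le>
    real s * D0 + 2 * lam * real n + (12 * lam * (real n)\<^sup>2 / D0\<^sup>2 + 12 * lam * real n / D0) * real (n + 1) * exp (3 * real (n + 1) / D0)"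
proof -
  \<comment> \<open>Chosen so that \<open>p * r0 = D0 / 2\<close>. If the run stops for want of
    hubs, \<open>size\<close> gives a residual degree of at most \<open>D0 / 2 + 1\<close>, and this
    is at most \<open>D0\<close> because \<open>2 \<le> D0\<close>.\<close>
  define r0 where "r0 = D0 * real n / (2 * real d)"
  have r0: "0 < r0" using D0 n_pos d_pos by (simp add: r0_def)
  have ppos: "0 < p" using d_pos n_pos by simp
  have pr0: "p * r0 = D0 / 2" using n_pos d_pos by (simp add: r0_def)
  define Dt where "Dt t = real s - p * real s - p * real t" for t :: nat
  define A where "A = 6 * lam * real n ^ 3 / (r0 * real d * D0) + 12 * lam * real n / D0"
  have A_eq: "A = 12 * lam * (real n)\<^sup>2 / D0\<^sup>2 + 12 * lam * real n / D0"
    using n_pos d_pos D0 by (simp add: A_def r0_def power2_eq_square power3_eq_cube field_simps)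
  have A0: "0 \<le> A" unfolding A_eq using lam_nonneg D0 by (intro add_nonneg_nonneg divide_nonneg_pos) auto
  define stop where "stop t \<longleftrightarrow> Dt t < D0 \<or> real (card W) - real t < r0" for t
  have ex: "stop (card W)" using r0 by (simp add: stop_def)
  define t where "t = (LEAST t. stop t)"
  have t: "stop t" "t \<le> card W" "\<And>t'. t' < t \<Longrightarrow> \<not> stop t'"
    unfolding t_def using LeastI[of stop, OF ex] Least_le[of stop, OF ex] not_less_Least by auto
  have "\<exists>P T. P \<subseteq> W \<and> card P = t \<and> packing X Y P T \<and> missed X P T + missed Y P T \<le> A * real t * (1 + 3 / D0) ^ t"
    by (rule packing_run[OF sub s _ r0 A_def]) (use D0 t(3) in \<open>auto simp: stop_def Dt_def not_less\<close>)
  then obtain P T where P: "P \<subseteq> W" "card P = t" and T: "packing X Y P T"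
    and m: "missed X P T + missed Y P T \<le> A * real t * (1 + 3 / D0) ^ t" by blast
  have PV: "P \<subseteq> V" using P sub by auto
  have Dle: "Dt t \<le> D0"
  proof (cases "Dt t < D0")
    case False
    then have "real (card W) - real t < r0" using t(1) by (simp add: stop_def)
    then have "p * (real (card W) - real t) \<le> p * r0" using ppos by (intro mult_left_mono) auto
    then have "p * real (card W) - p * real t \<le> D0 / 2" using pr0 unfolding right_diff_distrib by linarith
    moreover have "Dt t = real s * (1 - p) - p * real t" by (simp add: Dt_def right_diff_distrib)
    ultimately show ?thesis using size D0 by linarith
  qed simp
  have tn: "t \<le> n" using t(2) card_sub[OF sub(3)] by simp
  have "missed X P T \<le> A * real t * (1 + 3 / D0) ^ t"
    using m unserved_deviation(2)[OF packing_swap[OF T] sub(2,1) PV refl] by (simp add: missed_def)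
  also have "\<dots> \<le> A * real (n + 1) * exp (3 * real (n + 1) / D0)"
  proof (intro mult_mono mult_left_mono)
    have "(1 + 3 / D0) ^ t \<le> exp (3 / D0) ^ t"
      using D0 exp_ge_add_one_self[of "3 / D0"] by (intro power_mono) auto
    also have "\<dots> = exp (real t * (3 / D0))" by (simp only: exp_of_nat_mult)
    also have "\<dots> \<le> exp (3 * real (n + 1) / D0)"
      using tn D0 by (simp add: divide_right_mono)
    finally show "(1 + 3 / D0) ^ t \<le> exp (3 * real (n + 1) / D0)" .
  qed (use tn A0 D0 in auto)
  finally have miss: "missed X P T \<le> A * real (n + 1) * exp (3 * real (n + 1) / D0)" .
  have fX: "finite X" using sub fin_sub by auto
  have fY: "finite Y" using sub fin_sub by auto
  define F where "F = {(x, y). x \<in> X \<and> y \<in> Y \<and> y \<notin> N x}"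
  have "F = (SIGMA x : X. Y - N x)" by (auto simp: F_def)
  then have cF: "real (card F) = (\<Sum>x\<in>X. real (card (Y - N x)))" using fX fY by (simp add: card_SigmaI)
  have "real (card F) - real (card T) = (\<Sum>x\<in>X. real (card (unserved Y T x)))"
  proof -
    have "real (card (unserved Y T x)) = real (card (Y - N x)) - real (card {e \<in> T. fst e = x})" if "x \<in> X" for x
    proof -
      have "card (Y - N x) = card Y - card (N x \<inter> Y)" "card (N x \<inter> Y) \<le> card Y"
        using fY card_mono[of Y "N x \<inter> Y"] by (simp_all add: card_Diff_subset_Int Int_commute)
      then show ?thesis using card_unserved[OF T sub(1,2) PV that] by linarith
    qed
    then have "(\<Sum>x\<in>X. real (card (unserved Y T x))) = (\<Sum>x\<in>X. real (card (Y - N x)) - real (card {e \<in> T. fst e = x}))"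
      by (intro sum.cong) auto
    then show ?thesis unfolding cF card_packing_sum[OF T fX] by (simp add: sum_subtractf)
  qed
  also have "\<dots> \<le> (\<Sum>x\<in>X. D0 + \<bar>real (card (unserved Y T x)) - Dt t\<bar>)"
    by (rule sum_mono) (use Dle in linarith)
  also have "\<dots> = real s * D0 + (\<Sum>x\<in>X. \<bar>real (card (unserved Y T x)) - Dt t\<bar>)"
    using s by (simp add: sum.distrib)
  also have "(\<Sum>x\<in>X. \<bar>real (card (unserved Y T x)) - Dt t\<bar>) \<le> 2 * lam * real n + missed X P T"
    by (rule unserved_deviation(1)[OF T sub(1,2) PV]) (use s P in \<open>simp add: Dt_def\<close>)
  finally have fin: "real (card F) - real (card T) \<le> real s * D0 + 2 * lam * real n + A * real (n + 1) * exp (3 * real (n + 1) / D0)"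
    using miss by linarith
  have "packing X Y W T" using T P(1) unfolding packing_def by blast
  then show ?thesis using fin unfolding F_def A_eq by blast
qed

end

section \<open>Combining the blocks of branch vertices\<close>

lemma mod_eq_cancel:
  fixes i j j' q :: nat
  assumes "(i + j) mod q = (i + j') mod q" "j < q" "j' < q"
  shows "j = j'"
proof -
  have le: "j = j'" if "(i + j) mod q = (i + j') mod q" "j \<le> j'" "j' < q" for j j' :: nat
  proof -
    have "q dvd (i + j') - (i + j)" using that by (intro mod_eq_dvd_iff_nat[THEN iffD1]) auto
    then have "q dvd j' - j" by simp
    moreover have "j' - j < q" using that by simp
    ultimately have "j' - j = 0" by (metis dvd_imp_le not_le not_gr_zero)
    then show ?thesis using that by simp
  qed
  show ?thesis using le[of j j'] le[of j' j] assms by (cases "j \<le> j'") auto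
qed

context quasirandom
begin

text \<open>Unlike in \<open>packing\<close>, both ends come from the same set, and a vertex may be
  first in one triple and second in another. The matching condition therefore compares unordered
  ends.\<close>

definition hub_split :: "nat set \<Rightarrow> (nat \<times> nat \<times> nat) set \<Rightarrow> bool" where
  "hub_split B T \<longleftrightarrow>
     (\<forall>x y w. (x, y, w) \<in> T \<longrightarrow> x \<in> B \<and> y \<in> B \<and> x < y \<and> w \<in> V - B \<and> w \<in> N x \<and> w \<in> N y \<and> y \<notin> N x) \<and>
     (\<forall>x y w w'. (x, y, w) \<in> T \<longrightarrow> (x, y, w') \<in> T \<longrightarrow> w = w') \<and>
     (\<forall>e\<in>T. \<forall>e'\<in>T. \<forall>w u. e \<noteq> e' \<longrightarrow> snd (snd e) = w \<longrightarrow> snd (snd e') = w \<longrightarrow>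
        u \<in> {fst e, fst (snd e)} \<longrightarrow> u \<notin> {fst e', fst (snd e')})"

text \<open>The set \<open>{..<q * s}\<close> is cut into \<open>q\<close> blocks of size \<open>s\<close> and the remaining vertices into \<open>q\<close>
  hub classes. Blocks \<open>i\<close> and \<open>j\<close> are served by class \<open>(i + j) mod q\<close>, so that a hub class serves
  every block for at most one partner block.\<close>

lemma hub_split_exists:
  assumes q: "0 < q" and qs: "q * s \<le> d" and D0: "2 \<le> D0"
    and bound: "real s * D0 + 2 * lam * real n + (12 * lam * (real n)\<^sup>2 / D0\<^sup>2 + 12 * lam * real n / D0) * real (n + 1) * exp (3 * real (n + 1) / D0) \<le> \<beta>"
  shows "\<exists>T. hub_split {..<q * s} T \<and>
    real (card {(x, y). x < y \<and> y < q * s \<and> y \<notin> N x \<and> (\<forall>w. (x, y, w) \<notin> T)}) \<le> real q * (real s)\<^sup>2 + (real q)\<^sup>2 * \<beta>"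
proof -
  \<comment> \<open>Rounding costs each hub class less than one hub, hence at most
    \<open>p \<le> 1\<close> of its capacity, which the summand 1 in the hypothesis
    \<open>size\<close> of \<open>packing_exists\<close> absorbs.\<close>
  define \<mu> where "\<mu> = (n - q * s) div q"
  define part where "part i = {i * s..<i * s + s}" for i
  define W where "W i = {q * s + i * \<mu>..<q * s + i * \<mu> + \<mu>}" for i
  have dn: "d < n" by (rule d_less_n)
  have part_lt: "i * s + s \<le> q * s" if "i < q" for i
  proof -
    have "Suc i * s \<le> q * s" using that by (intro mult_right_mono) auto
    then show ?thesis by simp
  qed
  have partB: "part i \<subseteq> {..<q * s}" if "i < q" for i using part_lt[OF that] by (auto simp: part_def)
  have partV: "part i \<subseteq> V" if "i < q" for i using partB[OF that] qs dn by fastforce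
  have WV: "W i \<subseteq> V - {..<q * s}" if "i < q" for i
  proof -
    have "Suc i * \<mu> \<le> q * \<mu>" using that by (intro mult_right_mono) auto
    moreover have "q * \<mu> \<le> n - q * s" unfolding \<mu>_def by simp
    ultimately have "i * \<mu> + \<mu> \<le> n - q * s" by simp
    then have "q * s + i * \<mu> + \<mu> \<le> n" using qs dn by linarith
    then show ?thesis by (auto simp: W_def)
  qed
  have block_unique: "i = i'" if "x \<in> {i * s'..<i * s' + s'}" "x \<in> {i' * s'..<i' * s' + s'}" for i i' x s' :: nat
  proof -
    have *: "x div s' = i" if "x \<in> {i * s'..<i * s' + s'}" for i
    proof (rule div_nat_eqI)
      show "s' * i \<le> x" "x < s' * Suc i" using that by (auto simp: mult.commute)
    qed
    show ?thesis using *[OF that(1)] *[OF that(2)] by simp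
  qed
  have part_unique: "i = i'" if "x \<in> part i" "x \<in> part i'" for i i' x
    using block_unique[of x i s i'] that by (simp add: part_def)
  have W_unique: "i = i'" if "x \<in> W i" "x \<in> W i'" for i i' x
  proof (rule block_unique[of "x - q * s" i \<mu> i'])
    show "x - q * s \<in> {i * \<mu>..<i * \<mu> + \<mu>}" "x - q * s \<in> {i' * \<mu>..<i' * \<mu> + \<mu>}"
      using that by (auto simp: W_def)
  qed
  have "\<exists>T. packing (part i) (part j) (W ((i + j) mod q)) T \<and>
      real (card {(x, y). x \<in> part i \<and> y \<in> part j \<and> y \<notin> N x}) - real (card T) \<le> \<beta>" if ij: "i < j" "j < q" for i j
  proof -
    have "\<exists>T. packing (part i) (part j) (W ((i + j) mod q)) T \<and>
      real (card {(x, y). x \<in> part i \<and> y \<in> part j \<and> y \<notin> N x}) - real (card T) \<le>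
      real s * D0 + 2 * lam * real n + (12 * lam * (real n)\<^sup>2 / D0\<^sup>2 + 12 * lam * real n / D0) * real (n + 1) * exp (3 * real (n + 1) / D0)"
    proof (rule packing_exists)
      show "part i \<subseteq> V" "part j \<subseteq> V" using partV ij by auto
      show "W ((i + j) mod q) \<subseteq> V" using WV[of "(i + j) mod q"] q by auto
      show "card (part i) = s" "card (part j) = s" by (simp_all add: part_def)
      show "2 \<le> D0" by (rule D0)
      have cW: "card (W ((i + j) mod q)) = \<mu>" by (simp add: W_def)
      have mu: "real (n - q * s) \<le> real q * real \<mu> + real q"
      proof -
        have "n - q * s = q * \<mu> + (n - q * s) mod q" unfolding \<mu>_def by simp
        moreover have "(n - q * s) mod q < q" using q by simp
        ultimately have "n - q * s \<le> q * \<mu> + q" by linarith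
        then have "real (n - q * s) \<le> real (q * \<mu> + q)" unfolding of_nat_le_iff .
        then show ?thesis by simp
      qed
      have nn: "real (n - q * s) = real n - real q * real s" using qs dn by (simp add: of_nat_diff)
      have q0: "0 < real q" and n0: "0 < real n" using q n_pos by auto
      have qsr: "real q * real s \<le> real d"
      proof -
        have "real (q * s) \<le> real d" unfolding of_nat_le_iff by (rule qs)
        then show ?thesis by simp
      qed
      have d_le: "real d \<le> real n" using dn by simp
      \<comment> \<open>Because \<open>q * s \<le> d\<close>, the quantity
        \<open>q * s * (n - d)\<close> is at most \<open>d * (n - q * s)\<close>; up to rounding
        this says that one class has enough hub edges for a pair of blocks.\<close>
      have "real q * (real s * (real n - real d)) = real n * (real q * real s) - real d * (real q * real s)"
        by (simp add: algebra_simps)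
      also have "\<dots> \<le> real n * real d - real d * (real q * real s)"
        using qsr by (intro diff_right_mono mult_left_mono) auto
      also have "\<dots> = real d * (real n - real q * real s)" by (simp add: algebra_simps)
      also have "\<dots> \<le> real d * (real q * real \<mu> + real q)" using mu nn by (intro mult_left_mono) auto
      also have "\<dots> = real q * (real d * real \<mu> + real d)" by (simp add: algebra_simps)
      also have "\<dots> \<le> real q * (real d * real \<mu> + real n)" using d_le by (intro mult_left_mono) auto
      finally have "real s * (real n - real d) \<le> real d * real \<mu> + real n" using q0 by simp
      then have "real s * (real n - real d) / real n \<le> (real d * real \<mu> + real n) / real n"
        using n0 by (intro divide_right_mono) auto
      moreover have "real s * (real n - real d) / real n = real s * (1 - p)" using n0 by (simp add: field_simps)
      moreover have "(real d * real \<mu> + real n) / real n = p * real \<mu> + 1" using n0 by (simp add: field_simps)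
      ultimately show "real s * (1 - p) \<le> p * real (card (W ((i + j) mod q))) + 1" unfolding cW by simp
    qed
    then show ?thesis using bound order_trans by blast
  qed
  note class_packing = this
  define I where "I = {ij :: nat \<times> nat. fst ij < snd ij \<and> snd ij < q}"
  define good where "good ij T \<longleftrightarrow> packing (part (fst ij)) (part (snd ij)) (W ((fst ij + snd ij) mod q)) T \<and>
      real (card {(x, y). x \<in> part (fst ij) \<and> y \<in> part (snd ij) \<and> y \<notin> N x}) - real (card T) \<le> \<beta>" for ij T
  have "\<forall>ij\<in>I. \<exists>T. good ij T" unfolding good_def by (rule ballI, rule class_packing) (auto simp: I_def)
  from bchoice[OF this] obtain T0 where T0g: "\<forall>ij\<in>I. good ij (T0 ij)" by blast
  have T0: "packing (part (fst ij)) (part (snd ij)) (W ((fst ij + snd ij) mod q)) (T0 ij)"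
    "real (card {(x, y). x \<in> part (fst ij) \<and> y \<in> part (snd ij) \<and> y \<notin> N x}) - real (card (T0 ij)) \<le> \<beta>"
    if "ij \<in> I" for ij
    using bspec[OF T0g that] unfolding good_def by blast+
  define T where "T = (\<Union>ij\<in>I. T0 ij)"
  have pk: "packing (part i) (part j) (W ((i + j) mod q)) (T0 (i, j))" if "(i, j) \<in> I" for i j
    using T0(1)[OF that] by simp
  have mem: "x \<in> part i \<and> y \<in> part j \<and> w \<in> W ((i + j) mod q) \<and> w \<in> N x \<and> w \<in> N y \<and> y \<notin> N x"
    if "(x, y, w) \<in> T0 (i, j)" "(i, j) \<in> I" for x y w i j
    using pk[OF that(2)] that(1) unfolding packing_def by blast
  have getI: "\<exists>i j. (i, j) \<in> I \<and> e \<in> T0 (i, j)" if "e \<in> T" for e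
    using that by (auto simp: T_def)
  have lt: "x < y" if "x \<in> part i" "y \<in> part j" "i < j" for x y i j
  proof -
    have "Suc i * s \<le> j * s" using that by (intro mult_right_mono) auto
    then show ?thesis using that by (auto simp: part_def)
  qed
  have split: "hub_split {..<q * s} T"
    unfolding hub_split_def
  proof (intro conjI allI impI ballI)
    fix x y w assume "(x, y, w) \<in> T"
    then obtain i j where ij: "(i, j) \<in> I" "(x, y, w) \<in> T0 (i, j)" using getI by blast
    have iq: "i < j" "j < q" "i < q" using ij(1) by (auto simp: I_def)
    note m = mem[OF ij(2,1)]
    show "x \<in> {..<q * s}" using m partB[OF iq(3)] by blast
    show "y \<in> {..<q * s}" using m partB[OF iq(2)] by blast
    show "x < y" using m lt iq by blast
    show "w \<in> V - {..<q * s}" using m WV[of "(i + j) mod q"] q by auto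
    show "w \<in> N x" "w \<in> N y" "y \<notin> N x" using m by blast+
  next
    fix x y w w' assume "(x, y, w) \<in> T" "(x, y, w') \<in> T"
    then obtain i j i' j' where ij: "(i, j) \<in> I" "(x, y, w) \<in> T0 (i, j)" "(i', j') \<in> I" "(x, y, w') \<in> T0 (i', j')"
      using getI[of "(x, y, w)"] getI[of "(x, y, w')"] by blast
    have "i' = i" "j' = j" using mem[OF ij(2,1)] mem[OF ij(4,3)] part_unique by blast+
    then have "(x, y, w') \<in> T0 (i, j)" using ij(4) by simp
    then show "w = w'" using pk[OF ij(1)] ij(2) unfolding packing_def by blast
  next
    fix e e' w u assume e: "e \<in> T" "e' \<in> T" "e \<noteq> e'" "snd (snd e) = w" "snd (snd e') = w" "u \<in> {fst e, fst (snd e)}"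
    obtain x y x' y' where xy: "e = (x, y, w)" "e' = (x', y', w)" using e(4,5) by (metis prod.collapse)
    obtain i j where ij: "(i, j) \<in> I" "(x, y, w) \<in> T0 (i, j)" using getI[OF e(1)] xy(1) by blast
    obtain i' j' where ij': "(i', j') \<in> I" "(x', y', w) \<in> T0 (i', j')" using getI[OF e(2)] xy(2) by blast
    note m = mem[OF ij(2,1)] and m' = mem[OF ij'(2,1)]
    have iq: "i < j" "j < q" "i < q" "i' < j'" "j' < q" "i' < q" using ij(1) ij'(1) by (auto simp: I_def)
    have r: "(i + j) mod q = (i' + j') mod q" using m m' W_unique by blast
    show "u \<notin> {fst e', fst (snd e')}"
    proof
      assume u': "u \<in> {fst e', fst (snd e')}"
      \<comment> \<open>A class determines the partner of a block, so a shared end forces the same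
        pair of blocks. The crossed cases would give \<open>i < j = i' < j' = i\<close>.\<close>
      have "(i = i' \<and> j = j') \<and> (u = x \<and> u = x' \<or> u = y \<and> u = y')"
      proof -
        consider "u = x" "u = x'" | "u = x" "u = y'" | "u = y" "u = x'" | "u = y" "u = y'"
          using e(6) u' xy by auto
        then show ?thesis
        proof cases
          case 1
          then have "i = i'" using m m' part_unique by blast
          then have "j = j'" using mod_eq_cancel[of i j q j'] r iq by simp
          then show ?thesis using 1 \<open>i = i'\<close> by blast
        next
          case 2
          then have "i = j'" using m m' part_unique by blast
          then have "j = i'" using mod_eq_cancel[of i j q i'] r iq by (simp add: add.commute)
          then show ?thesis using \<open>i = j'\<close> iq by simp
        next
          case 3
          then have "j = i'" using m m' part_unique by blast
          then have "i = j'" using mod_eq_cancel[of j i q j'] r iq by (simp add: add.commute)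
          then show ?thesis using \<open>j = i'\<close> iq by simp
        next
          case 4
          then have "j = j'" using m m' part_unique by blast
          then have "i = i'" using mod_eq_cancel[of j i q i'] r iq by (simp add: add.commute)
          then show ?thesis using 4 \<open>j = j'\<close> by blast
        qed
      qed
      then have "(x', y', w) \<in> T0 (i, j)" "x = x' \<or> y = y'" using ij'(2) by auto
      then have "x = x' \<and> y = y'" using pk[OF ij(1)] ij(2) unfolding packing_def by blast
      then show False using e(3) xy by simp
    qed
  qed
  define Lf where "Lf = {(x, y). x < y \<and> y < q * s \<and> y \<notin> N x \<and> (\<forall>w. (x, y, w) \<notin> T)}"
  define M where "M ij = {(x, y). x \<in> part (fst ij) \<and> y \<in> part (snd ij) \<and> y \<notin> N x}" for ij
  define prj where "prj e = (fst e, fst (snd e))" for e :: "nat \<times> nat \<times> nat"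
  have finp: "finite (part i)" for i by (simp add: part_def)
  have finM: "finite (M ij)" for ij
    by (rule finite_subset[of _ "part (fst ij) \<times> part (snd ij)"]) (auto simp: M_def finp)
  have finI: "finite I" by (rule finite_subset[of _ "{..<q} \<times> {..<q}"]) (auto simp: I_def)
  have cI: "card I \<le> q * q"
  proof -
    have "card I \<le> card ({..<q} \<times> {..<q})" by (rule card_mono) (auto simp: I_def)
    then show ?thesis by (simp add: card_cartesian_product)
  qed
  \<comment> \<open>Unserved pairs lie inside one block, at most \<open>q * s\<^sup>2\<close>
    altogether, or between two blocks, where the packing leaves at most
    \<open>\<beta>\<close>.\<close>
  have cover: "Lf \<subseteq> (\<Union>i<q. part i \<times> part i) \<union> (\<Union>ij\<in>I. M ij - prj ` T0 ij)"
  proof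
    fix z assume z: "z \<in> Lf"
    then obtain x y where xy: "z = (x, y)" "x < y" "y < q * s" "y \<notin> N x" "\<And>w. (x, y, w) \<notin> T" by (auto simp: Lf_def)
    have s0: "0 < s" using xy(3) by (cases s) auto
    have ex: "\<exists>i<q. v \<in> part i" if "v < q * s" for v
    proof (intro exI[of _ "v div s"] conjI)
      show "v div s < q" using that s0 by (simp add: less_mult_imp_div_less)
      have "v = v div s * s + v mod s" by simp
      moreover have "v mod s < s" using s0 by simp
      ultimately show "v \<in> part (v div s)" unfolding part_def by (metis atLeastLessThan_iff le_add1 nat_add_left_cancel_less)
    qed
    obtain i where i: "i < q" "x \<in> part i" using ex[of x] xy by auto
    obtain j where j: "j < q" "y \<in> part j" using ex[of y] xy by auto
    have "\<not> j < i" using lt[OF j(2) i(2)] xy(2) by auto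
    then have "i = j \<or> i < j" by linarith
    then have "i = j \<or> (i, j) \<in> I" using j(1) by (auto simp: I_def)
    then consider "i = j" | "(i, j) \<in> I" by blast
    then show "z \<in> (\<Union>i<q. part i \<times> part i) \<union> (\<Union>ij\<in>I. M ij - prj ` T0 ij)"
    proof cases
      case 1
      then show ?thesis using i j xy(1) by blast
    next
      case 2
      have "(x, y) \<in> M (i, j)" using i j xy by (simp add: M_def)
      moreover have "(x, y) \<notin> prj ` T0 (i, j)"
      proof
        assume "(x, y) \<in> prj ` T0 (i, j)"
        then obtain e where "e \<in> T0 (i, j)" "(x, y) = prj e" by blast
        then have "(x, y, snd (snd e)) \<in> T" using 2 by (auto simp: T_def prj_def)
        then show False using xy(5) by blast
      qed
      ultimately show ?thesis using 2 xy(1) by blast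
    qed
  qed
  have cM: "real (card (M ij - prj ` T0 ij)) \<le> \<beta>" if "ij \<in> I" for ij
  proof -
    obtain i j where ij: "ij = (i, j)" by (cases ij)
    have p0: "packing (part i) (part j) (W ((i + j) mod q)) (T0 ij)" using pk that ij by simp
    have "inj_on prj (T0 ij)"
    proof (rule inj_onI)
      fix e e' assume *: "e \<in> T0 ij" "e' \<in> T0 ij" "prj e = prj e'"
      obtain x y w x' y' w' where "e = (x, y, w)" "e' = (x', y', w')" by (metis prod.collapse)
      then show "e = e'" using * p0 unfolding packing_def prj_def by auto
    qed
    then have "card (prj ` T0 ij) = card (T0 ij)" by (rule card_image)
    moreover have "prj ` T0 ij \<subseteq> M ij"
      using p0 ij unfolding packing_def M_def prj_def by fastforce
    ultimately have "card (M ij - prj ` T0 ij) = card (M ij) - card (T0 ij)" "card (T0 ij) \<le> card (M ij)"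
      using finM[of ij] by (metis card_Diff_subset finite_subset, metis card_mono)
    moreover have "real (card (M ij)) - real (card (T0 ij)) \<le> \<beta>"
      using T0(2)[OF that] by (simp add: M_def)
    ultimately show ?thesis by (simp add: of_nat_diff)
  qed
  have "card Lf \<le> card ((\<Union>i<q. part i \<times> part i) \<union> (\<Union>ij\<in>I. M ij - prj ` T0 ij))"
    using finp finM finI by (intro card_mono cover) auto
  also have "\<dots> \<le> card (\<Union>i<q. part i \<times> part i) + card (\<Union>ij\<in>I. M ij - prj ` T0 ij)" by (rule card_Un_le)
  also have "\<dots> \<le> (\<Sum>i<q. card (part i \<times> part i)) + (\<Sum>ij\<in>I. card (M ij - prj ` T0 ij))"
    using finI by (intro add_mono card_UN_le) auto
  finally have "real (card Lf) \<le> real ((\<Sum>i<q. card (part i \<times> part i)) + (\<Sum>ij\<in>I. card (M ij - prj ` T0 ij)))"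
    unfolding of_nat_le_iff .
  also have "\<dots> = (\<Sum>i<q. (real s)\<^sup>2) + (\<Sum>ij\<in>I. real (card (M ij - prj ` T0 ij)))"
    by (simp add: card_cartesian_product part_def power2_eq_square)
  also have "\<dots> \<le> real q * (real s)\<^sup>2 + (\<Sum>ij\<in>I. \<beta>)"
    using cM by (intro add_mono sum_mono) auto
  also have "\<dots> \<le> real q * (real s)\<^sup>2 + (real q)\<^sup>2 * \<beta>"
  proof -
    have "0 \<le> \<beta>"
    proof -
      have "0 \<le> real s * D0 + 2 * lam * real n + (12 * lam * (real n)\<^sup>2 / D0\<^sup>2 + 12 * lam * real n / D0) * real (n + 1) * exp (3 * real (n + 1) / D0)"
        using D0 lam_nonneg by (intro add_nonneg_nonneg mult_nonneg_nonneg divide_nonneg_nonneg) auto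
      then show ?thesis using bound by linarith
    qed
    moreover have "real (card I) \<le> real (q * q)" unfolding of_nat_le_iff by (rule cI)
    ultimately have "real (card I) * \<beta> \<le> real (q * q) * \<beta>" by (intro mult_right_mono)
    then show ?thesis by (simp add: power2_eq_square)
  qed
  finally show ?thesis using split unfolding Lf_def by blast
qed


text \<open>Adjacent pairs use their edge, served pairs their hub, and the at most
  \<open>\<epsilon> * d\<^sup>2\<close> others are routed. The three kinds cannot collide, as their
  edges lie in disjoint classes: \<open>EB\<close> inside \<open>B\<close>, \<open>ET\<close> from
  \<open>B\<close> to used hubs, \<open>ER\<close> for the routing.\<close>

lemma dense_immersion:
  assumes q: "0 < q" and qs: "q * s \<le> d" and g: "0 < g" and qs_g: "real (q * s) \<le> (1 - g) * real d"
    and \<omega>: "0 < \<omega>" "\<omega> * real n \<le> real n - real (q * s)" and D0: "2 \<le> D0"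
    and bound: "real s * D0 + 2 * lam * real n + (12 * lam * (real n)\<^sup>2 / D0\<^sup>2 + 12 * lam * real n / D0) * real (n + 1) * exp (3 * real (n + 1) / D0) \<le> \<beta> * (real d)\<^sup>2"
    and \<epsilon>: "1 / real q + (real q)\<^sup>2 * \<beta> \<le> \<epsilon>"
    and K1: "2 \<le> (\<omega> / 8 * K / 2)\<^sup>2" and K2: "32 \<le> K\<^sup>2 * (\<omega> / 8) ^ 3" and k: "n \<le> 2 ^ k * d"
    and \<gamma>: "4 * 2 ^ k / (\<omega>\<^sup>2 * K\<^sup>2) + 16 * \<epsilon> * real (2 * k + 4) / \<omega> \<le> \<gamma> / 2" "\<gamma> \<le> g\<^sup>2"
      "\<gamma> * real d + 1 \<le> \<omega> * real d / 16" "\<epsilon> * real (2 * k + 4) < \<omega>\<^sup>2 / 512"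
    and m: "real m \<le> real (q * s) - g * real d"
  shows "has_complete_immersion n E m"
proof -
  define B where "B = {..<q * s}"
  have dn: "d < n" by (rule d_less_n)
  have d0: "0 < real d" using d_pos by simp
  have BV: "B \<subseteq> V" using qs dn by (auto simp: B_def)
  have fB: "finite B" by (simp add: B_def)
  obtain T where T: "hub_split B T" and Lb:
    "real (card {(x, y). x < y \<and> y < q * s \<and> y \<notin> N x \<and> (\<forall>w. (x, y, w) \<notin> T)}) \<le> real q * (real s)\<^sup>2 + (real q)\<^sup>2 * (\<beta> * (real d)\<^sup>2)"
    using hub_split_exists[OF q qs D0 bound] unfolding B_def by blast
  define L where "L = {(x, y). x < y \<and> y < q * s \<and> y \<notin> N x \<and> (\<forall>w. (x, y, w) \<notin> T)}"
  have LB: "L \<subseteq> B \<times> B" by (auto simp: L_def B_def)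
  have cL: "real (card L) \<le> \<epsilon> * (real d)\<^sup>2"
  proof -
    have qsr: "real q * real s \<le> real d"
    proof -
      have "real (q * s) \<le> real d" unfolding of_nat_le_iff by (rule qs)
      then show ?thesis by simp
    qed
    have "real q * (real s)\<^sup>2 = (real q * real s)\<^sup>2 / real q" using q by (simp add: power2_eq_square)
    also have "\<dots> \<le> (real d)\<^sup>2 / real q" using qsr by (intro divide_right_mono power_mono) auto
    finally have "real (card L) \<le> (real d)\<^sup>2 / real q + (real q)\<^sup>2 * (\<beta> * (real d)\<^sup>2)"
      using Lb unfolding L_def by linarith
    also have "\<dots> = (1 / real q + (real q)\<^sup>2 * \<beta>) * (real d)\<^sup>2" by (simp add: distrib_right)
    also have "\<dots> \<le> \<epsilon> * (real d)\<^sup>2" using \<epsilon> by (intro mult_right_mono) auto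
    finally show ?thesis .
  qed
  have T0: "x \<in> B \<and> y \<in> B \<and> x < y \<and> w \<in> V - B \<and> w \<in> N x \<and> w \<in> N y \<and> y \<notin> N x" if "(x, y, w) \<in> T" for x y w
    using T that unfolding hub_split_def by blast
  have T1: "w = w'" if "(x, y, w) \<in> T" "(x, y, w') \<in> T" for x y w w'
    using T that unfolding hub_split_def by blast
  have T2: "u \<notin> {fst e', fst (snd e')}" if "e \<in> T" "e' \<in> T" "e \<noteq> e'" "snd (snd e) = w" "snd (snd e') = w" "u \<in> {fst e, fst (snd e)}" for e e' w u
    using T that unfolding hub_split_def by blast
  define served where "served u v w \<longleftrightarrow> (u, v, w) \<in> T \<or> (v, u, w) \<in> T" for u v w
  have served1: "w = w'" if "served u v w" "served u v w'" for u v w w'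
  proof -
    have "\<not> ((u, v, a) \<in> T \<and> (v, u, b) \<in> T)" for a b using T0[of u v a] T0[of v u b] by auto
    then show ?thesis using that T1 unfolding served_def by blast
  qed
  define used where "used u = {w. \<exists>v. served u v w}" for u
  define S where "S u = N u - B - used u" for u
  have used_sub: "used u \<subseteq> N u - B" for u
    using T0 unfolding used_def served_def by blast
  \<comment> \<open>Partners of \<open>u\<close> that are adjacent, served or in \<open>L\<close>
    form disjoint subsets of \<open>B\<close>, and those of the first two kinds take one edge at
    \<open>u\<close> each. As \<open>B\<close> has at most \<open>(1 - g) * d\<close> elements, the
    free edges exceed the pairs in \<open>L\<close> by \<open>g * d\<close>.\<close>
  have Sbig: "real (card {e \<in> L. fst e = u \<or> snd e = u}) + g * real d \<le> real (card (S u))" if u: "u \<in> B" for u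
  proof -
    define A1 where "A1 = {v. (u, v) \<in> L \<or> (v, u) \<in> L}"
    define A2 where "A2 = {v. \<exists>w. served u v w}"
    define A3 where "A3 = N u \<inter> B"
    have sub: "A1 \<subseteq> B" "A2 \<subseteq> B" "A3 \<subseteq> B"
      using LB T0 unfolding A1_def A2_def A3_def served_def by blast+
    then have fin: "finite A1" "finite A2" "finite A3" using finite_subset[OF _ fB] by blast+
    have dj: "A1 \<inter> A2 = {}" "(A1 \<union> A2) \<inter> A3 = {}"
    proof -
      show "A1 \<inter> A2 = {}"
      proof (rule ccontr)
        assume "A1 \<inter> A2 \<noteq> {}"
        then obtain v w where v: "(u, v) \<in> L \<or> (v, u) \<in> L" "(u, v, w) \<in> T \<or> (v, u, w) \<in> T"
          unfolding A1_def A2_def served_def by blast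
        have "(u, v) \<in> L \<Longrightarrow> u < v \<and> (u, v, w) \<notin> T" "(v, u) \<in> L \<Longrightarrow> v < u \<and> (v, u, w) \<notin> T" by (auto simp: L_def)
        then show False using v T0[of u v w] T0[of v u w] by auto
      qed
      have "v \<notin> N u" if "(u, v) \<in> L \<or> (v, u) \<in> L" for v using that N_sym[of v u] by (auto simp: L_def)
      moreover have "v \<notin> N u" if "served u v w" for v w
        using that T0[of u v w] T0[of v u w] N_sym[of v u] unfolding served_def by blast
      ultimately show "(A1 \<union> A2) \<inter> A3 = {}" unfolding A1_def A2_def A3_def by blast
    qed
    have "card (A1 \<union> A2 \<union> A3) \<le> card B" using sub fB by (intro card_mono) auto
    moreover have "card (A1 \<union> A2 \<union> A3) = card A1 + card A2 + card A3"
      using fin dj by (simp add: card_Un_disjoint)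
    ultimately have total: "card A1 + card A2 + card A3 \<le> q * s" by (simp add: B_def)
    have "card {e \<in> L. fst e = u \<or> snd e = u} \<le> card A1"
    proof (rule card_inj_on_le[of "\<lambda>e. if fst e = u then snd e else fst e"])
      show "inj_on (\<lambda>e. if fst e = u then snd e else fst e) {e \<in> L. fst e = u \<or> snd e = u}"
        by (auto simp: inj_on_def L_def)
      show "(\<lambda>e. if fst e = u then snd e else fst e) ` {e \<in> L. fst e = u \<or> snd e = u} \<subseteq> A1"
        by (auto simp: A1_def)
    qed (rule fin)
    moreover have "card (used u) \<le> card A2"
    proof (rule surj_card_le[OF fin(2)])
      show "used u \<subseteq> (\<lambda>v. SOME w. served u v w) ` A2"
      proof
        fix w assume "w \<in> used u"
        then obtain v where v: "served u v w" by (auto simp: used_def)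
        have "w = (SOME w. served u v w)" using v by (intro served1[OF v] someI)
        then show "w \<in> (\<lambda>v. SOME w. served u v w) ` A2" using v by (intro image_eqI[of _ _ v]) (auto simp: A2_def)
      qed
    qed
    moreover have "card (N u) = card A3 + card (N u - B)" unfolding A3_def using card_Int_Diff[OF fin_N] .
    moreover have "card (N u) = d" using card_N u BV by blast
    moreover have "card (S u) = card (N u - B) - card (used u)" "card (used u) \<le> card (N u - B)"
    proof -
      have "finite (used u)" by (rule finite_subset[OF used_sub]) simp
      then show "card (S u) = card (N u - B) - card (used u)"
        unfolding S_def using used_sub by (rule card_Diff_subset)
      show "card (used u) \<le> card (N u - B)" using used_sub by (intro card_mono) simp
    qed
    ultimately have "card {e \<in> L. fst e = u \<or> snd e = u} + d \<le> card (S u) + q * s" using total by linarith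
    then have "real (card {e \<in> L. fst e = u \<or> snd e = u} + d) \<le> real (card (S u) + q * s)" unfolding of_nat_le_iff .
    moreover have "(1 - g) * real d = real d - g * real d" by (simp add: left_diff_distrib)
    ultimately show ?thesis using qs_g unfolding of_nat_add by linarith
  qed
  define qb where "qb = 4 * 2 ^ k / (\<omega>\<^sup>2 * K\<^sup>2) * real d"
  define zb where "zb = qb + 16 * real (card L) * real (2 * k + 4) / (\<omega> * real d)"
  have zb_le: "2 * zb \<le> \<gamma> * real d"
  proof -
    have "16 * real (card L) * real (2 * k + 4) / (\<omega> * real d) \<le> 16 * (\<epsilon> * (real d)\<^sup>2) * real (2 * k + 4) / (\<omega> * real d)"
      using cL \<omega>(1) d0 by (intro divide_right_mono mult_right_mono mult_left_mono) auto
    also have "\<dots> = 16 * \<epsilon> * real (2 * k + 4) / \<omega> * real d" using d0 \<omega>(1) by (simp add: power2_eq_square)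
    finally have "zb \<le> (4 * 2 ^ k / (\<omega>\<^sup>2 * K\<^sup>2) + 16 * \<epsilon> * real (2 * k + 4) / \<omega>) * real d"
      unfolding zb_def qb_def distrib_right by linarith
    also have "\<dots> \<le> \<gamma> / 2 * real d" using \<gamma>(1) by (intro mult_right_mono) auto
    finally show ?thesis by simp
  qed
  \<comment> \<open>The trivial load \<open>t = d\<close> is affordable, because the avoided set has
    at most \<open>\<gamma> * d \<le> g\<^sup>2 * d\<close> vertices and so makes at most
    \<open>g * d\<close> branch vertices stuck.\<close>
  have "\<exists>B' P. B' \<subseteq> B \<and> real (card (B - B')) * (g * real d) \<le> real d * (2 * zb) \<and>
    (\<forall>e\<in>L \<inter> B' \<times> B'. is_path E (P e) (fst e) (snd e) \<and>
      path_edges (P e) \<subseteq> {{u, x} | u x. u \<in> B \<and> x \<in> S u} \<union> {{x, y} | x y. x \<in> V - B \<and> y \<in> V - B}) \<and>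
    (\<forall>e\<in>L \<inter> B' \<times> B'. \<forall>e'\<in>L \<inter> B' \<times> B'. e \<noteq> e' \<longrightarrow> path_edges (P e) \<inter> path_edges (P e') = {})"
  proof (rule routing[OF BV \<omega>(1) g K1 K2 LB _ _ Sbig _ _ k zb_def])
    show "u \<noteq> v" if "(u, v) \<in> L" for u v using that by (auto simp: L_def)
    show "S u \<subseteq> N u - B" if "u \<in> B" for u by (auto simp: S_def)
    show "card {u \<in> B. w \<in> S u} \<le> d" if "w \<in> V - B" for w
    proof -
      have "card {u \<in> B. w \<in> S u} \<le> card B" using fB by (intro card_mono) auto
      then show ?thesis using qs by (simp add: B_def)
    qed
    show "real (card {w \<in> V - B. real (card (N w - B)) < \<omega> / 2 * real d}) \<le> qb"
    proof -
      define Q where "Q = {w \<in> V - B. real (card (N w - B)) < \<omega> / 2 * real d}"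
      have QV: "Q \<subseteq> V" by (auto simp: Q_def)
      have "real (card Q) * (\<omega> * K / 2)\<^sup>2 \<le> real n"
      proof (rule few_poor[OF QV _ \<omega>(1), of "V - B"])
        have "card (V - B) = n - q * s" using BV fB by (simp add: card_Diff_subset B_def)
        then show "\<omega> * real n \<le> real (card (V - B))" using \<omega>(2) qs dn by (simp add: of_nat_diff)
        fix w assume w: "w \<in> Q"
        have "N w \<inter> (V - B) = N w - B" using N_sub by auto
        then show "real (card (N w \<inter> (V - B))) \<le> \<omega> * real d / 2" using w by (simp add: Q_def)
      qed auto
      also have "real n \<le> real (2 ^ k * d)" unfolding of_nat_le_iff by (rule k)
      finally have le: "real (card Q) * (\<omega> * K / 2)\<^sup>2 \<le> 2 ^ k * real d" by simp
      have pos: "0 < (\<omega> * K / 2)\<^sup>2" using \<omega>(1) K_pos by simp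
      have "real (card Q) \<le> 2 ^ k * real d / (\<omega> * K / 2)\<^sup>2" using le unfolding pos_le_divide_eq[OF pos] .
      also have "\<dots> = qb" by (simp add: qb_def power_mult_distrib power_divide)
      finally show ?thesis by (simp add: Q_def)
    qed
    have nd: "real d \<le> real n" using dn by simp
    show "2 * zb + 1 \<le> \<omega> / 8 * real n / 2"
    proof -
      have "\<omega> * real d \<le> \<omega> * real n" using nd \<omega>(1) by (intro mult_left_mono) auto
      then show ?thesis using zb_le \<gamma>(3) by simp
    qed
    show "real (card L) * real (2 * k + 4) < (\<omega> / 8)\<^sup>2 * real n * real d / 8"
    proof -
      have "real (card L) * real (2 * k + 4) \<le> \<epsilon> * (real d)\<^sup>2 * real (2 * k + 4)"
        using cL by (intro mult_right_mono) auto
      also have "\<dots> = (\<epsilon> * real (2 * k + 4)) * (real d)\<^sup>2" by simp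
      also have "\<dots> < \<omega>\<^sup>2 / 512 * (real d)\<^sup>2" using \<gamma>(4) d0 by (intro mult_strict_right_mono) auto
      also have "\<dots> = \<omega>\<^sup>2 / 512 * real d * real d" by (simp add: power2_eq_square)
      also have "\<dots> \<le> \<omega>\<^sup>2 / 512 * real n * real d" using nd by (intro mult_right_mono mult_left_mono) auto
      also have "\<dots> = (\<omega> / 8)\<^sup>2 * real n * real d / 8" by (simp add: power_divide)
      finally show ?thesis .
    qed
  qed
  then obtain B' P where B': "B' \<subseteq> B" "real (card (B - B')) * (g * real d) \<le> real d * (2 * zb)"
    and P: "\<forall>e\<in>L \<inter> B' \<times> B'. is_path E (P e) (fst e) (snd e) \<and>
      path_edges (P e) \<subseteq> {{u, x} | u x. u \<in> B \<and> x \<in> S u} \<union> {{x, y} | x y. x \<in> V - B \<and> y \<in> V - B}"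
    and D: "\<forall>e\<in>L \<inter> B' \<times> B'. \<forall>e'\<in>L \<inter> B' \<times> B'. e \<noteq> e' \<longrightarrow> path_edges (P e) \<inter> path_edges (P e') = {}"
    by blast
  have drop: "real (card (B - B')) \<le> g * real d"
  proof -
    have "real d * (2 * zb) \<le> real d * (\<gamma> * real d)" using zb_le by (intro mult_left_mono) auto
    also have "\<dots> \<le> real d * (g\<^sup>2 * real d)" using \<gamma>(2) by (intro mult_left_mono mult_right_mono) auto
    finally have "real (card (B - B')) * (g * real d) \<le> (g * real d) * (g * real d)"
      using B'(2) by (simp add: power2_eq_square mult_ac)
    then show ?thesis using g d_pos by simp
  qed
  define hub where "hub u v = (SOME w. (u, v, w) \<in> T)" for u v
  have hub: "(u, v, hub u v) \<in> T" if "\<exists>w. (u, v, w) \<in> T" for u v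
    unfolding hub_def using that by (rule someI_ex)
  define Q where "Q u v = (if v \<in> N u then [u, v] else if \<exists>w. (u, v, w) \<in> T then [u, hub u v, v] else P (u, v))" for u v
  define EB where "EB = {f :: nat set. f \<subseteq> B}"
  define ET where "ET = {{a, w} | a w. a \<in> B \<and> w \<in> used a}"
  define ER where "ER = {{u, x} | u x. u \<in> B \<and> x \<in> S u} \<union> {{x, y} | x y. x \<in> V - B \<and> y \<in> V - B}"
  have EB_ET: "EB \<inter> ET = {}" using used_sub unfolding EB_def ET_def by blast
  have EB_ER: "EB \<inter> ER = {}" unfolding EB_def ER_def S_def by blast
  have ET_ER: "ET \<inter> ER = {}"
  proof (rule ccontr)
    assume "ET \<inter> ER \<noteq> {}"
    then obtain f where f: "f \<in> ET" "f \<in> ER" by blast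
    then obtain a w where aw: "f = {a, w}" "a \<in> B" "w \<in> used a" unfolding ET_def by blast
    have wB: "w \<notin> B" using aw(3) used_sub[of a] by blast
    have "\<not> f \<subseteq> V - B" using aw by blast
    then obtain u x where ux: "f = {u, x}" "u \<in> B" "x \<in> S u" using f(2) unfolding ER_def by blast
    have xB: "x \<notin> B" using ux(3) by (simp add: S_def)
    have "{a, w} = {u, x}" using aw(1) ux(1) by simp
    then have "a = u \<and> w = x" unfolding doubleton_eq_iff using aw(2) ux(2) wB xB by blast
    then show False using aw(3) ux(3) by (simp add: S_def)
  qed
  have kind: "u \<in> B' \<Longrightarrow> v \<in> B' \<Longrightarrow> u < v \<Longrightarrow>
    v \<in> N u \<and> Q u v = [u, v] \<or> (u, v, hub u v) \<in> T \<and> Q u v = [u, hub u v, v] \<or> (u, v) \<in> L \<inter> B' \<times> B' \<and> Q u v = P (u, v)" for u v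
  proof -
    assume uv: "u \<in> B'" "v \<in> B'" "u < v"
    then have "v < q * s" using B'(1) by (auto simp: B_def)
    then have "v \<in> N u \<or> (\<exists>w. (u, v, w) \<in> T) \<or> (u, v) \<in> L" using uv unfolding L_def by blast
    moreover have "v \<notin> N u" if "(u, v, w) \<in> T" for w using T0[OF that] by blast
    ultimately show ?thesis using hub[of u v] uv unfolding Q_def by auto
  qed
  have hub_edges: "path_edges [u, hub u v, v] = {{u, hub u v}, {v, hub u v}}" for u v
    by (simp add: path_edges_Cons insert_commute)
  have in_ET: "path_edges [u, hub u v, v] \<subseteq> ET" if "(u, v, hub u v) \<in> T" for u v
  proof -
    have "hub u v \<in> used u" "hub u v \<in> used v" using that unfolding used_def served_def by blast+
    then show ?thesis using T0[OF that] unfolding hub_edges ET_def by blast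
  qed
  have in_ER: "path_edges (P e) \<subseteq> ER" if "e \<in> L \<inter> B' \<times> B'" for e
    using bspec[OF P that] unfolding ER_def by blast
  have sub_disj: "C \<inter> C' = {}" if "C \<subseteq> X" "C' \<subseteq> Y" "X \<inter> Y = {}" for C C' X Y :: "nat set set"
    using that by blast
  show ?thesis
  proof (rule complete_immersionI[of B' n m E Q])
    show "B' \<subseteq> {..<n}" using B' BV by auto
    have cB: "card B = card (B - B') + card B'"
      using fB B'(1) by (simp add: card_Diff_subset card_mono finite_subset)
    have "q * s = card B" by (simp add: B_def)
    then have "real (q * s) = real (card (B - B')) + real (card B')" unfolding of_nat_add[symmetric] cB[symmetric] by (rule arg_cong)
    then have "real (q * s) - g * real d \<le> real (card B')" using drop by linarith
    then show "m \<le> card B'" using m by simp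
  next
    fix u v assume uv: "u \<in> B'" "v \<in> B'" "u < v"
    from kind[OF uv] show "is_path E (Q u v) u v"
    proof (elim disjE conjE)
      assume "v \<in> N u" "Q u v = [u, v]"
      then show ?thesis using uv(3) by (simp add: is_path_iff_successively in_N)
    next
      assume t: "(u, v, hub u v) \<in> T" "Q u v = [u, hub u v, v]"
      have h: "hub u v \<in> N u" "hub u v \<in> N v" "hub u v \<notin> B" "u \<in> B" "v \<in> B" using T0[OF t(1)] by blast+
      have "v \<in> N (hub u v)" using h(2) by (subst N_sym)
      moreover have "hub u v \<noteq> u" "hub u v \<noteq> v" using h by metis+
      ultimately show ?thesis using h(1) uv(3) t(2) by (auto simp: is_path_iff_successively in_N)
    next
      assume "(u, v) \<in> L \<inter> B' \<times> B'" "Q u v = P (u, v)"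
      then show ?thesis using bspec[OF P, of "(u, v)"] by simp
    qed
  next
    fix u v u' v' assume uv: "u \<in> B'" "v \<in> B'" "u < v" and uv': "u' \<in> B'" "v' \<in> B'" "u' < v'" and ne: "(u, v) \<noteq> (u', v')"
    have uB: "u \<in> B" "v \<in> B" "u' \<in> B" "v' \<in> B" using uv uv' B'(1) by blast+
    have direct: "path_edges [a, b] \<subseteq> EB" if "a \<in> B" "b \<in> B" for a b
      using that by (simp add: path_edges_Cons EB_def)
    from kind[OF uv] kind[OF uv'] show "path_edges (Q u v) \<inter> path_edges (Q u' v') = {}"
    proof (elim disjE conjE)
      assume "Q u v = [u, v]" "Q u' v' = [u', v']"
      moreover have "{u, v} \<noteq> {u', v'}" unfolding doubleton_eq_iff using uv(3) uv'(3) ne by auto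
      ultimately show ?thesis by (auto simp: path_edges_Cons)
    next
      assume "Q u v = [u, v]" "(u', v', hub u' v') \<in> T" "Q u' v' = [u', hub u' v', v']"
      then show ?thesis using sub_disj[OF direct[OF uB(1,2)] in_ET[of u' v'] EB_ET] by simp
    next
      assume "Q u v = [u, v]" "(u', v') \<in> L \<inter> B' \<times> B'" "Q u' v' = P (u', v')"
      then show ?thesis using sub_disj[OF direct[OF uB(1,2)] in_ER[of "(u', v')"] EB_ER] by simp
    next
      assume "(u, v, hub u v) \<in> T" "Q u v = [u, hub u v, v]" "Q u' v' = [u', v']"
      then show ?thesis using sub_disj[OF in_ET[of u v] direct[OF uB(3,4)] EB_ET[unfolded Int_commute[of EB]]] by simp
    next
      assume t: "(u, v, hub u v) \<in> T" "Q u v = [u, hub u v, v]" "(u', v', hub u' v') \<in> T" "Q u' v' = [u', hub u' v', v']"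
      show ?thesis
      proof (rule ccontr)
        assume "\<not> ?thesis"
        then obtain f where f: "f \<in> path_edges (Q u v)" "f \<in> path_edges (Q u' v')" by blast
        obtain a where a: "f = {a, hub u v}" "a \<in> {u, v}" using f(1) unfolding t(2) hub_edges by blast
        obtain a' where a': "f = {a', hub u' v'}" "a' \<in> {u', v'}" using f(2) unfolding t(4) hub_edges by blast
        have "a \<in> B" "a' \<in> B" using a a' uB by blast+
        moreover have "hub u v \<notin> B" "hub u' v' \<notin> B" using T0[OF t(1)] T0[OF t(3)] by blast+
        moreover have "{a, hub u v} = {a', hub u' v'}" using a(1) a'(1) by simp
        ultimately have eq: "a = a' \<and> hub u v = hub u' v'" unfolding doubleton_eq_iff by blast
        have "(u, v, hub u v) \<noteq> (u', v', hub u' v')" using ne by auto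
        from T2[OF t(1,3) this, of "hub u v" a] eq a(2) a'(2) show False by simp
      qed
    next
      assume "(u, v, hub u v) \<in> T" "Q u v = [u, hub u v, v]" "(u', v') \<in> L \<inter> B' \<times> B'" "Q u' v' = P (u', v')"
      then show ?thesis using sub_disj[OF in_ET[of u v] in_ER[of "(u', v')"] ET_ER] by simp
    next
      assume "(u, v) \<in> L \<inter> B' \<times> B'" "Q u v = P (u, v)" "Q u' v' = [u', v']"
      then show ?thesis using sub_disj[OF in_ER[of "(u, v)"] direct[OF uB(3,4)] EB_ER[unfolded Int_commute[of EB]]] by simp
    next
      assume "(u, v) \<in> L \<inter> B' \<times> B'" "Q u v = P (u, v)" "(u', v', hub u' v') \<in> T" "Q u' v' = [u', hub u' v', v']"
      then show ?thesis using sub_disj[OF in_ER[of "(u, v)"] in_ET[of u' v'] ET_ER[unfolded Int_commute[of ET]]] by simp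
    next
      assume r: "(u, v) \<in> L \<inter> B' \<times> B'" "Q u v = P (u, v)" "(u', v') \<in> L \<inter> B' \<times> B'" "Q u' v' = P (u', v')"
      show ?thesis unfolding r(2,4) using bspec[OF bspec[OF D r(1)] r(3)] ne by blast
    qed
  qed
qed

end

section \<open>Choice of constants\<close>

text \<open>Even the cube of \<open>2 * k + 5\<close> is at most \<open>200 * 2 ^ k\<close>, and its
  surplus factor exceeds \<open>200 * C\<close> for large \<open>k\<close>. The constant 200 makes
  the induction start at \<open>k = 2\<close>.\<close>

lemma square_le_power_two:
  fixes C :: real
  assumes "0 \<le> C"
  shows "\<exists>k0. \<forall>k\<ge>k0. C * (real (2 * k + 5))\<^sup>2 \<le> 2 ^ k"
proof -
  have cube: "real (2 * k + 5) ^ 3 \<le> 200 * 2 ^ k" if "2 \<le> k" for k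
    using that
  proof (induction k rule: nat_induct_at_least)
    case base
    then show ?case by simp
  next
    case (Suc k)
    define x where "x = real (2 * k + 5)"
    have x: "9 \<le> x" using Suc.hyps by (simp add: x_def)
    have x2: "9 * x \<le> x\<^sup>2" using x unfolding power2_eq_square by (intro mult_right_mono) auto
    have x3: "9 * x\<^sup>2 \<le> x ^ 3" using x unfolding power3_eq_cube power2_eq_square
      by (simp only: mult.assoc) (intro mult_right_mono; simp)
    have "real (2 * Suc k + 5) ^ 3 = (x + 2) ^ 3" by (simp add: x_def)
    also have "\<dots> = x ^ 3 + 6 * x\<^sup>2 + 12 * x + 8" by (simp add: power3_eq_cube power2_eq_square algebra_simps)
    also have "\<dots> \<le> 2 * x ^ 3" using x x2 x3 by linarith
    also have "\<dots> \<le> 200 * 2 ^ Suc k" using Suc.IH by (simp add: x_def)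
    finally show ?case .
  qed
  show ?thesis
  proof (intro exI[of _ "nat \<lceil>100 * C\<rceil> + 2"] allI impI)
    fix k assume k: "nat \<lceil>100 * C\<rceil> + 2 \<le> k"
    define x where "x = real (2 * k + 5)"
    have "100 * C \<le> real k" using k by linarith
    then have "200 * C \<le> x" by (simp add: x_def)
    then have "200 * C * x\<^sup>2 \<le> x * x\<^sup>2" by (intro mult_right_mono) auto
    also have "\<dots> = x ^ 3" by (simp add: power3_eq_cube power2_eq_square)
    also have "\<dots> \<le> 200 * 2 ^ k" using cube[of k] k by (simp add: x_def)
    finally show "C * (real (2 * k + 5))\<^sup>2 \<le> 2 ^ k" by (simp add: x_def)
  qed
qed

context quasirandom
begin

text \<open>If \<open>d\<close> is at least of order \<open>l / g\<^sup>2\<close>, some load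
  \<open>t \<ge> 1\<close> is affordable in \<open>middle_immersion\<close>. Otherwise
  \<open>k\<close> is at least of the order of \<open>d\<close>, and \<open>huge_immersion\<close>
  applies.\<close>

lemma sparse_immersion:
  assumes g: "0 < g" "g \<le> 1" and gK: "8 \<le> (g * K / 2)\<^sup>2" "8 \<le> g * (g * K / 2)\<^sup>2" "64 \<le> g\<^sup>2 * K\<^sup>2" and K: "2048 \<le> K"
    and k: "n \<le> 2 ^ k * d" "2 ^ k * d \<le> 2 * n" and kC: "10000 / g ^ 3 * (real (2 * k + 5))\<^sup>2 \<le> 2 ^ k"
    and b: "real b \<le> (1 - 3 * g) * real d" and m: "real m \<le> real b - 2 * g * real d"
  shows "has_complete_immersion n E m"
proof -
  define l where "l = real (2 * k + 5)"
  define X where "X = (2::real) ^ k"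
  have l: "5 \<le> l" "2 * real k \<le> l" by (simp_all add: l_def)
  have X0: "0 < X" by (simp add: X_def)
  have g3: "0 < g ^ 3" using g by simp
  have d1: "1 \<le> real d" using d_pos by simp
  have big2: "10000 * l\<^sup>2 \<le> g ^ 3 * X"
    using kC g3 unfolding l_def[symmetric] X_def[symmetric] by (simp add: field_simps)
  have ll: "l \<le> l\<^sup>2" using l unfolding power2_eq_square by (simp add: mult_le_cancel_right1)
  have big1: "10000 * l \<le> g ^ 3 * X" using big2 ll by linarith
  have g32: "g ^ 3 \<le> g\<^sup>2" using g by (intro power_decreasing) auto
  have g21: "g ^ 3 \<le> 1" using g by (intro power_le_one) auto
  have "g ^ 3 * X \<le> g\<^sup>2 * X" using g32 X0 by (intro mult_right_mono) auto
  then have bigg: "10000 * l \<le> g\<^sup>2 * X" "10000 * l\<^sup>2 \<le> g\<^sup>2 * X" using big1 big2 by linarith+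
  have "g ^ 3 * X \<le> 1 * X" using g21 X0 by (intro mult_right_mono) auto
  then have bigX: "10000 * l \<le> X" using big1 by linarith
  have nX: "X * real d \<le> 2 * real n"
  proof -
    have "real (2 ^ k * d) \<le> real (2 * n)" unfolding of_nat_le_iff by (rule k(2))
    then show ?thesis by (simp add: X_def)
  qed
  show ?thesis
  proof (cases "66 * l \<le> g\<^sup>2 * real d")
    case True
    define y where "y = g\<^sup>2 * real d / (66 * l)"
    \<comment> \<open>The largest load that \<open>middle_immersion\<close> tolerates. It is at
      least \<open>y / 2\<close>, so rounding costs only a factor 2 in \<open>room\<close>.\<close>
    define t where "t = nat \<lfloor>y\<rfloor>"
    have l0: "0 < 66 * l" using l by simp
    have y1: "1 \<le> y" using True l0 by (simp add: y_def)
    then have t_le: "real t \<le> y" unfolding t_def by (intro of_nat_floor) simp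
    have t1: "1 \<le> t" unfolding t_def using y1 by linarith
    have "y < real t + 1" unfolding t_def using y1 by linarith
    then have t2: "y \<le> 2 * real t" using t1 by linarith
    show ?thesis
    proof (rule middle_immersion[OF g gK(1,2) K b k(1) _ _ _ _ m])
      have "8192 * l * real d \<le> X * real d" using bigX l d1 by (intro mult_right_mono) auto
      then have "real (4096 * d * (2 * k + 5)) \<le> real n" using nX unfolding of_nat_mult l_def[symmetric] by (simp add: mult_ac)
      then show "4096 * d * (2 * k + 5) \<le> n" unfolding of_nat_le_iff .
      show "0 < t" using t1 by simp
      have "real t * (66 * l) \<le> g\<^sup>2 * real d" using t_le unfolding y_def pos_le_divide_eq[OF l0] .
      then show "66 * real t * real (2 * k + 5) \<le> g\<^sup>2 * real d" unfolding l_def[symmetric] by (simp add: mult_ac)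
      show "2 * ((real d)\<^sup>2 / real t + real d) \<le> g * real n"
      proof -
        have t0: "0 < real t" using t1 by simp
        have "g\<^sup>2 * real d \<le> 132 * l * real t" using t2 l0 unfolding y_def by (simp add: pos_divide_le_eq mult_ac)
        then have "g\<^sup>2 * real d * real d \<le> 132 * l * real t * real d" by (intro mult_right_mono) auto
        then have a: "g\<^sup>2 * ((real d)\<^sup>2 / real t) \<le> 132 * l * real d"
          using t0 by (simp add: pos_divide_le_eq power2_eq_square mult_ac)
        have "g\<^sup>2 * real d \<le> 1 * real d" using g by (intro mult_right_mono power_le_one) auto
        moreover have "5 * real d \<le> l * real d" using l by (intro mult_right_mono) auto
        ultimately have "g\<^sup>2 * (2 * ((real d)\<^sup>2 / real t + real d)) \<le> 300 * (l * real d)"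
          using a by (simp add: distrib_left mult.left_commute)
        also have "\<dots> \<le> 5000 * (l * real d)" using l by simp
        also have "\<dots> \<le> g ^ 3 * X * real d / 2"
          using mult_right_mono[OF big1, of "real d"] by simp
        also have "\<dots> = g\<^sup>2 * (g * (X * real d / 2))" by (simp add: power3_eq_cube power2_eq_square)
        also have "\<dots> \<le> g\<^sup>2 * (g * real n)" using nX g by (intro mult_left_mono) auto
        finally show ?thesis using g by simp
      qed
    qed
  next
    case False
    \<comment> \<open>Now \<open>d\<close> is at most a multiple of \<open>l\<close>, while
      \<open>X\<close> dominates \<open>l\<^sup>2\<close>. Hence \<open>n\<close>, which is at least
      \<open>X * d / 2\<close>, dominates \<open>l * d\<^sup>2\<close>.\<close>
    then have dl: "g\<^sup>2 * real d \<le> 66 * l" by simp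
    have g2: "0 < g\<^sup>2" using g by simp
    have "g\<^sup>2 * (128 * real d) \<le> g\<^sup>2 * X" using dl bigg(1) l by simp
    then have d128: "128 * real d \<le> X" using g2 by simp
    have "g\<^sup>2 * (8 * real d) \<le> g\<^sup>2 * (g * X)"
      using dl big1 l by (simp add: power3_eq_cube power2_eq_square mult_ac)
    then have d8: "8 * real d \<le> g * X" using g2 by simp
    have "g\<^sup>2 * (32 * (l * real d)) = 32 * l * (g\<^sup>2 * real d)" by simp
    also have "\<dots> \<le> 32 * l * (66 * l)" using dl l by (intro mult_left_mono) auto
    also have "\<dots> = 2112 * l\<^sup>2" by (simp add: power2_eq_square)
    also have "\<dots> \<le> 10000 * l\<^sup>2" by simp
    also have "\<dots> \<le> g\<^sup>2 * X" by (rule bigg(2))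
    finally have d32: "32 * (l * real d) \<le> X" using g2 by simp
    have nd: "128 * real d * real d \<le> 2 * real n" "8 * real d * real d \<le> g * (2 * real n)" "32 * (l * real d) * real d \<le> 2 * real n"
    proof -
      show "128 * real d * real d \<le> 2 * real n" using mult_right_mono[OF d128, of "real d"] nX by simp
      show "32 * (l * real d) * real d \<le> 2 * real n" using mult_right_mono[OF d32, of "real d"] nX by simp
      have "8 * real d * real d \<le> g * X * real d" using d8 by (intro mult_right_mono) auto
      also have "\<dots> = g * (X * real d)" by simp
      also have "\<dots> \<le> g * (2 * real n)" using nX g by (intro mult_left_mono) auto
      finally show "8 * real d * real d \<le> g * (2 * real n)" .
    qed
    have "real (64 * d\<^sup>2) \<le> real n" using nd(1) by (simp add: power2_eq_square)
    then have n64: "64 * d\<^sup>2 \<le> n" unfolding of_nat_le_iff .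
    have dd: "1 \<le> d\<^sup>2" using d_pos by simp
    have ex: "n \<le> 64 * 2 ^ (2 * k)"
    proof -
      have "real d \<le> X" using d128 d1 by linarith
      then have "real d \<le> real (2 ^ k)" by (simp add: X_def)
      then have "d \<le> 2 ^ k" unfolding of_nat_le_iff .
      then have "2 ^ k * d \<le> 2 ^ k * 2 ^ k" by simp
      also have "\<dots> = 2 ^ (2 * k)" by (simp add: mult_2 power_add)
      finally have "n \<le> 2 ^ (2 * k)" using k(1) by linarith
      then show ?thesis by linarith
    qed
    \<comment> \<open>Minimality gives \<open>32 * 2 ^ hh \<le> n\<close>, and
      \<open>d \<le> 2 ^ k\<close> gives \<open>hh \<le> 2 * k\<close>, so the tree depth is at most
      \<open>l\<close>.\<close>
    define hh where "hh = (LEAST h. n \<le> 64 * 2 ^ h)"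
    have hh1: "n \<le> 64 * 2 ^ hh" unfolding hh_def by (rule LeastI[of "\<lambda>h. n \<le> 64 * 2 ^ h", OF ex])
    have hh2: "hh \<le> 2 * k" unfolding hh_def by (rule Least_le[of "\<lambda>h. n \<le> 64 * 2 ^ h", OF ex])
    have hh3: "32 * 2 ^ hh \<le> n"
    proof (cases hh)
      case 0
      then show ?thesis using n64 dd by simp
    next
      case (Suc h')
      then have "\<not> n \<le> 64 * 2 ^ h'" using not_less_Least[of h' "\<lambda>h. n \<le> 64 * 2 ^ h"] unfolding hh_def by simp
      then show ?thesis using Suc by simp
    qed
    show ?thesis
    proof (rule huge_immersion[OF g gK K b n64 _ hh1 hh3 _ m])
      show "4 * (real d)\<^sup>2 \<le> g * real n" using nd(2) by (simp add: power2_eq_square)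
      have "real hh \<le> l" using hh2 l(2) by linarith
      then have "16 * real hh * (real d * real d) \<le> 16 * l * (real d * real d)" by (intro mult_right_mono mult_left_mono) auto
      then have "real (16 * hh * d\<^sup>2) \<le> real n" using nd(3) by (simp add: power2_eq_square)
      then show "16 * hh * d\<^sup>2 \<le> n" unfolding of_nat_le_iff .
    qed
  qed
qed

end

text \<open>With \<open>g = \<eta> / 2\<close> the losses \<open>3 * g\<close> and
  \<open>2 * g\<close> add up to \<open>5 / 2 * \<eta>\<close> in units of \<open>d\<close>; the
  rounding loss of one vertex is covered by \<open>1 \<le> \<eta> * d\<close>.\<close>

lemma sparse_case:
  fixes \<eta> :: real
  assumes \<eta>: "0 < \<eta>" "\<eta> < 1 / 5"
  shows "\<exists>K0 k0. \<forall>K d n lam E k. K0 \<le> K \<longrightarrow> 1 / \<eta> \<le> real d \<longrightarrow> quasirandom n d lam K E \<longrightarrow> k0 \<le> k \<longrightarrow>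
    n \<le> 2 ^ k * d \<longrightarrow> 2 ^ k * d \<le> 2 * n \<longrightarrow> has_complete_immersion n E (nat \<lfloor>(1 - 5 * \<eta>) * real d\<rfloor>)"
proof -
  define g where "g = \<eta> / 2"
  have g: "0 < g" "g \<le> 1" using \<eta> by (auto simp: g_def)
  obtain k0 where k0: "\<And>k. k0 \<le> k \<Longrightarrow> 10000 / g ^ 3 * (real (2 * k + 5))\<^sup>2 \<le> 2 ^ k"
    using square_le_power_two[of "10000 / g ^ 3"] g by auto
  define K0 where "K0 = 2048 + 8 / g + 32 / g ^ 3"
  show ?thesis
  proof (intro exI[of _ K0] exI[of _ k0] allI impI)
    fix K d n lam E k
    assume K: "K0 \<le> K" and d: "1 / \<eta> \<le> real d" and Q: "quasirandom n d lam K E" and k: "k0 \<le> k"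
      "n \<le> 2 ^ k * d" "2 ^ k * d \<le> 2 * n"
    interpret quasirandom n d lam K E by (rule Q)
    have pos: "0 < 8 / g" "0 < 32 / g ^ 3" using g by auto
    have K1: "2048 \<le> K" "8 / g \<le> K" "32 / g ^ 3 \<le> K" using K pos unfolding K0_def by linarith+
    have gK: "8 \<le> g * K" using K1(2) g by (simp add: pos_divide_le_eq mult.commute)
    have a: "4\<^sup>2 \<le> (g * K / 2)\<^sup>2" using gK by (intro power_mono) auto
    have b: "8\<^sup>2 \<le> (g * K)\<^sup>2" using gK by (intro power_mono) auto
    have c: "32 \<le> g ^ 3 * K" using K1(3) g by (simp add: pos_divide_le_eq mult.commute)
    have "1 * K \<le> K * K" using K1(1) by (intro mult_right_mono) auto
    then have "g ^ 3 * K \<le> g ^ 3 * K\<^sup>2" using g by (intro mult_left_mono) (auto simp: power2_eq_square)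
    moreover have "g * (g * K / 2)\<^sup>2 = g ^ 3 * K\<^sup>2 / 4" by (simp add: power2_eq_square power3_eq_cube)
    ultimately have c': "8 \<le> g * (g * K / 2)\<^sup>2" using c by linarith
    define bb where "bb = nat \<lfloor>(1 - 3 * g) * real d\<rfloor>"
    have nn: "0 \<le> (1 - 3 * g) * real d" "0 \<le> (1 - 5 * \<eta>) * real d" using \<eta> by (auto simp: g_def)
    have b1: "real bb \<le> (1 - 3 * g) * real d" unfolding bb_def using nn by (intro of_nat_floor)
    have b2: "(1 - 3 * g) * real d - 1 \<le> real bb" unfolding bb_def using nn by linarith
    have m1: "real (nat \<lfloor>(1 - 5 * \<eta>) * real d\<rfloor>) \<le> (1 - 5 * \<eta>) * real d" using nn by (intro of_nat_floor)
    have \<eta>d: "1 \<le> \<eta> * real d" using d \<eta> by (simp add: pos_divide_le_eq mult.commute)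
    have "(1 - 5 * \<eta>) * real d \<le> (1 - 3 * g) * real d - 1 - 2 * g * real d"
    proof -
      have "(1 - 3 * g) * real d - 1 - 2 * g * real d - (1 - 5 * \<eta>) * real d = 5 / 2 * (\<eta> * real d) - 1"
        by (simp add: g_def algebra_simps)
      then show ?thesis using \<eta>d by linarith
    qed
    then have m: "real (nat \<lfloor>(1 - 5 * \<eta>) * real d\<rfloor>) \<le> real bb - 2 * g * real d" using m1 b2 by linarith
    show "has_complete_immersion n E (nat \<lfloor>(1 - 5 * \<eta>) * real d\<rfloor>)"
    proof (rule sparse_immersion[OF g _ c' _ K1(1) k(2,3) k0[OF k(1)] b1 m])
      show "8 \<le> (g * K / 2)\<^sup>2" using a by simp
      show "64 \<le> g\<^sup>2 * K\<^sup>2" using b by (simp add: power_mult_distrib)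
    qed
  qed
qed

text \<open>The constants are fixed in order of dependence. \<open>\<epsilon>\<close> is small
  enough for the final routing; \<open>q\<close> makes the pairs inside blocks, and
  \<open>\<beta>\<close> those between blocks, cost at most \<open>\<epsilon> / 2\<close>. Last,
  \<open>K\<close> beats the Gronwall factor \<open>exp (12 * C / \<beta>)\<close>.\<close>

lemma dense_case:
  fixes \<eta> :: real and k :: nat
  assumes \<eta>: "0 < \<eta>" "\<eta> < 1 / 5"
  shows "\<exists>K0 d0. \<forall>K d n lam E. K0 \<le> K \<longrightarrow> d0 \<le> real d \<longrightarrow> quasirandom n d lam K E \<longrightarrow>
    n \<le> 2 ^ k * d \<longrightarrow> has_complete_immersion n E (nat \<lfloor>(1 - 5 * \<eta>) * real d\<rfloor>)"
proof -
  define C where "C = (2::real) ^ k"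
  define l where "l = real (2 * k + 4)"
  \<comment> \<open>Since \<open>n \<le> C * d\<close>, this gives
    \<open>\<omega> * n \<le> 2 * \<eta> * d\<close>, which is at most the number
    \<open>n - q * s\<close> of vertices outside the branch set.\<close>
  define \<omega> where "\<omega> = 2 * \<eta> / C"
  define \<gamma> where "\<gamma> = min (\<eta>\<^sup>2) (\<omega> / 32)"
  define \<epsilon> where "\<epsilon> = \<gamma> * \<omega> / (64 * l)"
  define q where "q = nat \<lceil>2 / \<epsilon>\<rceil>"
  define \<beta> where "\<beta> = \<epsilon> / (2 * (real q)\<^sup>2)"
  \<comment> \<open>Bounds the error terms of \<open>packing_exists\<close> other than
    \<open>s * D0\<close>, in units of \<open>d\<^sup>2 / K\<close> and with
    \<open>D0 = \<beta> * d / 2\<close>.\<close>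
  define Zc where "Zc = 2 * C + (48 * C\<^sup>2 / \<beta>\<^sup>2 + 24 * C / \<beta>) * (2 * C) * exp (12 * C / \<beta>)"
  define K0 where "K0 = 2048 + 32 / \<omega> + 16384 / \<omega> ^ 3 + 16 * C / (\<omega>\<^sup>2 * \<gamma>) + 2 * Zc / \<beta>"
  \<comment> \<open>The summands ensure, in turn,
    \<open>\<gamma> * d + 1 \<le> \<omega> * d / 16\<close>, \<open>2 \<le> D0\<close>, and a loss
    of at most \<open>\<eta> * d\<close> from rounding the block size.\<close>
  define d0 where "d0 = 32 / \<omega> + 4 / \<beta> + real q / \<eta>"
  have C1: "1 \<le> C" by (simp add: C_def)
  have l0: "0 < l" by (simp add: l_def)
  have \<omega>0: "0 < \<omega>" using \<eta> C1 by (simp add: \<omega>_def)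
  have \<gamma>0: "0 < \<gamma>" using \<eta> \<omega>0 by (simp add: \<gamma>_def)
  have \<epsilon>0: "0 < \<epsilon>" using \<gamma>0 \<omega>0 l0 by (simp add: \<epsilon>_def)
  have q2: "2 / \<epsilon> \<le> real q" unfolding q_def by linarith
  have "0 < 2 / \<epsilon>" using \<epsilon>0 by simp
  then have q0: "0 < real q" using q2 by linarith
  have \<beta>0: "0 < \<beta>" using \<epsilon>0 q0 by (simp add: \<beta>_def)
  have Zc0: "0 < Zc" unfolding Zc_def using C1 \<beta>0 by (intro add_pos_nonneg mult_nonneg_nonneg add_nonneg_nonneg divide_nonneg_pos) auto
  have eps: "1 / real q + (real q)\<^sup>2 * \<beta> \<le> \<epsilon>"
  proof -
    have "1 / real q \<le> \<epsilon> / 2" using q2 q0 \<epsilon>0 by (simp add: field_simps)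
    moreover have "(real q)\<^sup>2 * \<beta> = \<epsilon> / 2" using q0 by (simp add: \<beta>_def)
    ultimately show ?thesis by linarith
  qed
  show ?thesis
  proof (rule exI[of _ K0], rule exI[of _ d0], intro allI impI)
    fix K d n lam E
    assume K: "K0 \<le> K" and d: "d0 \<le> real d" and Q: "quasirandom n d lam K E" and k: "n \<le> 2 ^ k * d"
    interpret quasirandom n d lam K E by (rule Q)
    have pos: "0 < 32 / \<omega>" "0 < 16384 / \<omega> ^ 3" "0 < 16 * C / (\<omega>\<^sup>2 * \<gamma>)" "0 < 2 * Zc / \<beta>" "0 < 4 / \<beta>" "0 < real q / \<eta>"
      using \<omega>0 C1 \<gamma>0 Zc0 \<beta>0 q0 \<eta> by auto
    have K1: "2048 \<le> K" "32 / \<omega> \<le> K" "16384 / \<omega> ^ 3 \<le> K" "16 * C / (\<omega>\<^sup>2 * \<gamma>) \<le> K" "2 * Zc / \<beta> \<le> K"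
      using K pos unfolding K0_def by linarith+
    have d1: "32 / \<omega> \<le> real d" "4 / \<beta> \<le> real d" "real q / \<eta> \<le> real d" using d pos unfolding d0_def by linarith+
    have dr: "0 < real d" using d_pos by simp
    have dn: "real d \<le> real n" "1 \<le> real d" using d_less_n d_pos by auto
    have nC: "real n \<le> C * real d"
    proof -
      have "real n \<le> real (2 ^ k * d)" unfolding of_nat_le_iff by (rule k)
      then show ?thesis by (simp add: C_def)
    qed
    define s where "s = nat \<lfloor>(1 - 2 * \<eta>) * real d / real q\<rfloor>"
    have nn: "0 \<le> (1 - 2 * \<eta>) * real d / real q" "0 \<le> (1 - 5 * \<eta>) * real d" using \<eta> q0 by auto
    have "real s \<le> (1 - 2 * \<eta>) * real d / real q" unfolding s_def using nn by (intro of_nat_floor)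
    then have s1: "real (q * s) \<le> (1 - 2 * \<eta>) * real d" using q0 by (simp add: pos_le_divide_eq mult.commute)
    have "(1 - 2 * \<eta>) * real d / real q < real s + 1" unfolding s_def using nn by linarith
    then have s2: "(1 - 2 * \<eta>) * real d \<le> real (q * s) + real q"
      using q0 by (simp add: pos_divide_less_eq algebra_simps)
    have \<eta>d: "0 \<le> \<eta> * real d" using \<eta> by simp
    have ex: "(1 - c * \<eta>) * real d = real d - c * (\<eta> * real d)" for c by (simp add: algebra_simps)
    have qs: "q * s \<le> d"
    proof -
      have "real (q * s) \<le> real d" using s1 \<eta>d unfolding ex by linarith
      then show ?thesis unfolding of_nat_le_iff .
    qed
    define D0 where "D0 = \<beta> * real d / 2"
    have D02: "2 \<le> D0" using d1(2) \<beta>0 by (simp add: D0_def pos_divide_le_eq mult.commute)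
    have KK: "K \<le> K\<^sup>2" using K1(1) unfolding power2_eq_square by (simp add: mult_le_cancel_right1)
    show "has_complete_immersion n E (nat \<lfloor>(1 - 5 * \<eta>) * real d\<rfloor>)"
    proof (rule dense_immersion[where g = \<eta> and \<omega> = \<omega> and \<gamma> = \<gamma> and \<epsilon> = \<epsilon> and \<beta> = \<beta> and q = q and s = s and k = k and ?D0.0 = D0])
      show "0 < q" using q0 by simp
      show "q * s \<le> d" by (rule qs)
      show "0 < \<eta>" by (rule \<eta>)
      have "(1 - 2 * \<eta>) * real d \<le> (1 - \<eta>) * real d" using \<eta> by (intro mult_right_mono) auto
      with s1 show "real (q * s) \<le> (1 - \<eta>) * real d" by (rule order_trans)
      show "0 < \<omega>" by (rule \<omega>0)
      have "\<omega> * real n \<le> \<omega> * (C * real d)" using nC \<omega>0 by (intro mult_left_mono) auto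
      also have "\<dots> = 2 * (\<eta> * real d)" using C1 by (simp add: \<omega>_def)
      finally show "\<omega> * real n \<le> real n - real (q * s)" using s1 dn ex[of 2] by linarith
      show "2 \<le> D0" by (rule D02)
      show "real s * D0 + 2 * lam * real n + (12 * lam * (real n)\<^sup>2 / D0\<^sup>2 + 12 * lam * real n / D0) * real (n + 1) * exp (3 * real (n + 1) / D0)
        \<le> \<beta> * (real d)\<^sup>2"
      proof -
        have D0p: "0 < D0" using D02 by simp
        have K0p: "0 < K" using K1(1) by simp
        have lamK: "lam \<le> real d / K" using lam_le K0p by (simp add: pos_le_divide_eq mult.commute)
        have n1: "real (n + 1) \<le> 2 * C * real d"
        proof -
          have "1 \<le> C * real d" using nC dn by linarith
          then show ?thesis using nC by simp
        qed
        have "s \<le> q * s" using q0 by simp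
        then have "s \<le> d" using qs by linarith
        then have "real s * D0 \<le> real d * D0" using D0p by (intro mult_right_mono) auto
        then have t1: "real s * D0 \<le> \<beta> * (real d)\<^sup>2 / 2" by (simp add: D0_def power2_eq_square mult_ac)
        have t2: "2 * lam * real n \<le> 2 * (real d / K) * (C * real d)"
          using lamK nC lam_nonneg by (intro mult_mono) auto
        have t3: "12 * lam * (real n)\<^sup>2 / D0\<^sup>2 \<le> 12 * (real d / K) * (C * real d)\<^sup>2 / D0\<^sup>2"
          using lamK nC lam_nonneg by (intro divide_right_mono mult_mono power_mono) auto
        have t4: "12 * lam * real n / D0 \<le> 12 * (real d / K) * (C * real d) / D0"
          using lamK nC lam_nonneg D0p by (intro divide_right_mono mult_mono) auto
        have t5: "exp (3 * real (n + 1) / D0) \<le> exp (12 * C / \<beta>)"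
        proof -
          have "3 * real (n + 1) / D0 \<le> 3 * (2 * C * real d) / D0" using n1 D0p by (intro divide_right_mono) auto
          also have "\<dots> = 12 * C / \<beta>" using dr \<beta>0 by (simp add: D0_def)
          finally show ?thesis by simp
        qed
        have e3: "12 * (real d / K) * (C * real d)\<^sup>2 / D0\<^sup>2 = real d / K * (48 * C\<^sup>2 / \<beta>\<^sup>2)"
          using dr \<beta>0 by (simp add: D0_def power_mult_distrib power_divide)
        have e4: "12 * (real d / K) * (C * real d) / D0 = real d / K * (24 * C / \<beta>)"
          using dr \<beta>0 by (simp add: D0_def)
        have "(12 * lam * (real n)\<^sup>2 / D0\<^sup>2 + 12 * lam * real n / D0) * real (n + 1) * exp (3 * real (n + 1) / D0)
          \<le> (real d / K * (48 * C\<^sup>2 / \<beta>\<^sup>2) + real d / K * (24 * C / \<beta>)) * (2 * C * real d) * exp (12 * C / \<beta>)"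
          unfolding e3[symmetric] e4[symmetric]
          using t3 t4 t5 n1 lam_nonneg D0p K0p C1 dr
          by (intro mult_mono add_mono mult_nonneg_nonneg add_nonneg_nonneg divide_nonneg_nonneg) auto
        also have "\<dots> = (real d)\<^sup>2 / K * ((48 * C\<^sup>2 / \<beta>\<^sup>2 + 24 * C / \<beta>) * (2 * C) * exp (12 * C / \<beta>))"
          by (simp add: power2_eq_square algebra_simps)
        also have "\<dots> = (real d)\<^sup>2 / K * (Zc - 2 * C)" by (simp add: Zc_def)
        finally have t6: "(12 * lam * (real n)\<^sup>2 / D0\<^sup>2 + 12 * lam * real n / D0) * real (n + 1) * exp (3 * real (n + 1) / D0)
          \<le> (real d)\<^sup>2 / K * (Zc - 2 * C)" .
        have e2: "2 * (real d / K) * (C * real d) = (real d)\<^sup>2 / K * (2 * C)" by (simp add: power2_eq_square)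
        have "2 * lam * real n + (12 * lam * (real n)\<^sup>2 / D0\<^sup>2 + 12 * lam * real n / D0) * real (n + 1) * exp (3 * real (n + 1) / D0)
          \<le> (real d)\<^sup>2 / K * Zc"
          using t2 t6 unfolding e2 right_diff_distrib by linarith
        also have "\<dots> \<le> (real d)\<^sup>2 * (\<beta> / 2)"
        proof -
          have "2 * Zc \<le> K * \<beta>" using K1(5) \<beta>0 by (simp add: pos_divide_le_eq)
          then have "Zc / K \<le> \<beta> / 2" using K0p by (simp add: field_simps)
          then have "(real d)\<^sup>2 * (Zc / K) \<le> (real d)\<^sup>2 * (\<beta> / 2)" by (intro mult_left_mono) auto
          then show ?thesis by simp
        qed
        also have "\<dots> = \<beta> * (real d)\<^sup>2 / 2" by simp
        finally show ?thesis using t1 by linarith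
      qed
      show "1 / real q + (real q)\<^sup>2 * \<beta> \<le> \<epsilon>" by (rule eps)
      have \<omega>K: "32 \<le> \<omega> * K" using K1(2) \<omega>0 by (simp add: pos_divide_le_eq mult.commute)
      then have "2\<^sup>2 \<le> (\<omega> / 8 * K / 2)\<^sup>2" by (intro power_mono) auto
      then show "2 \<le> (\<omega> / 8 * K / 2)\<^sup>2" by simp
      have "16384 \<le> K * \<omega> ^ 3" using K1(3) \<omega>0 by (simp add: pos_divide_le_eq)
      also have "\<dots> \<le> K\<^sup>2 * \<omega> ^ 3" using KK \<omega>0 by (intro mult_right_mono) auto
      finally show "32 \<le> K\<^sup>2 * (\<omega> / 8) ^ 3" by (simp add: power_divide)
      show "n \<le> 2 ^ k * d" by (rule k)
      show "4 * 2 ^ k / (\<omega>\<^sup>2 * K\<^sup>2) + 16 * \<epsilon> * real (2 * k + 4) / \<omega> \<le> \<gamma> / 2"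
      proof -
        have "16 * C \<le> K * (\<omega>\<^sup>2 * \<gamma>)" using K1(4) \<omega>0 \<gamma>0 by (simp add: pos_divide_le_eq)
        also have "\<dots> \<le> K\<^sup>2 * (\<omega>\<^sup>2 * \<gamma>)" using KK \<gamma>0 by (intro mult_right_mono) auto
        finally have "4 * C \<le> \<gamma> / 4 * (\<omega>\<^sup>2 * K\<^sup>2)" by (simp add: mult_ac)
        moreover have "0 < \<omega>\<^sup>2 * K\<^sup>2" using \<omega>0 K1(1) by simp
        ultimately have "4 * C / (\<omega>\<^sup>2 * K\<^sup>2) \<le> \<gamma> / 4" by (simp only: pos_divide_le_eq)
        moreover have "16 * \<epsilon> * l / \<omega> = \<gamma> / 4" using l0 \<omega>0 by (simp add: \<epsilon>_def)
        ultimately show ?thesis unfolding C_def[symmetric] l_def[symmetric] by linarith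
      qed
      show "\<gamma> \<le> \<eta>\<^sup>2" by (simp add: \<gamma>_def)
      show "\<gamma> * real d + 1 \<le> \<omega> * real d / 16"
      proof -
        have "\<gamma> * real d \<le> \<omega> / 32 * real d" by (intro mult_right_mono) (simp_all add: \<gamma>_def)
        moreover have "32 \<le> \<omega> * real d" using d1(1) \<omega>0 by (simp add: pos_divide_le_eq mult.commute)
        ultimately show ?thesis by simp
      qed
      show "\<epsilon> * real (2 * k + 4) < \<omega>\<^sup>2 / 512"
      proof -
        have "\<epsilon> * l = \<gamma> * \<omega> / 64" using l0 by (simp add: \<epsilon>_def)
        also have "\<dots> \<le> \<omega> / 32 * \<omega> / 64" using \<omega>0 by (intro divide_right_mono mult_right_mono) (simp_all add: \<gamma>_def)
        also have "\<dots> < \<omega>\<^sup>2 / 512" using \<omega>0 by (simp add: power2_eq_square)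
        finally show ?thesis by (simp add: l_def)
      qed
      have "real q \<le> \<eta> * real d" using d1(3) \<eta> by (simp add: pos_divide_le_eq mult.commute)
      then have "(1 - 5 * \<eta>) * real d \<le> real (q * s) - \<eta> * real d" using s2 \<eta>d unfolding ex by linarith
      moreover have "real (nat \<lfloor>(1 - 5 * \<eta>) * real d\<rfloor>) \<le> (1 - 5 * \<eta>) * real d" using nn by (intro of_nat_floor)
      ultimately show "real (nat \<lfloor>(1 - 5 * \<eta>) * real d\<rfloor>) \<le> real (q * s) - \<eta> * real d" by linarith
    qed
  qed
qed

theorem theorem2:
  fixes \<eta> :: real
  assumes "0 < \<eta>" and "\<eta> < 1/2"
  shows "\<exists>K::real. K > 0 \<and> (\<exists>d0::nat. \<forall>d \<ge> d0. \<forall>(n::nat) (lam::real) E.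
           ndl_graph n d lam E \<and> real d \<ge> K * lam \<longrightarrow>
           has_complete_immersion n E (nat \<lfloor>(1 - 5 * \<eta>) * real d\<rfloor>))"
proof (cases "\<eta> < 1 / 5")
  \<comment> \<open>Here \<open>(1 - 5 * \<eta>) * d\<close> is nonpositive and \<open>nat\<close>
    sends its floor to 0, so the empty immersion suffices.\<close>
  case False
  have "has_complete_immersion n E (nat \<lfloor>(1 - 5 * \<eta>) * real d\<rfloor>)" for n d E
  proof -
    have "(1 - 5 * \<eta>) * real d \<le> 0" using False by (intro mult_nonpos_nonneg) auto
    then have "nat \<lfloor>(1 - 5 * \<eta>) * real d\<rfloor> = 0" by (simp add: floor_le_iff)
    then show ?thesis by (intro complete_immersionI[of "{}"]) auto
  qed
  then show ?thesis by (intro exI[of _ 1]) auto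
next
  case True
  obtain K1 k0 where sparse: "\<And>K d n lam E k. K1 \<le> K \<Longrightarrow> 1 / \<eta> \<le> real d \<Longrightarrow> quasirandom n d lam K E \<Longrightarrow> k0 \<le> k \<Longrightarrow>
    n \<le> 2 ^ k * d \<Longrightarrow> 2 ^ k * d \<le> 2 * n \<Longrightarrow> has_complete_immersion n E (nat \<lfloor>(1 - 5 * \<eta>) * real d\<rfloor>)"
    using sparse_case[OF assms(1) True] by blast
  obtain K2 d2 where dense: "\<And>K d n lam E. K2 \<le> K \<Longrightarrow> d2 \<le> real d \<Longrightarrow> quasirandom n d lam K E \<Longrightarrow>
    n \<le> 2 ^ k0 * d \<Longrightarrow> has_complete_immersion n E (nat \<lfloor>(1 - 5 * \<eta>) * real d\<rfloor>)"
    using dense_case[OF assms(1) True, of k0] by blast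
  \<comment> \<open>There is no circularity: \<open>K2\<close> depends on \<open>k0\<close>, whereas
    \<open>k0\<close> was obtained before \<open>K\<close>. The 2 secures
    \<open>1 < K\<close>.\<close>
  define K where "K = max 2 (max K1 K2)"
  define d0 where "d0 = nat \<lceil>max d2 (1 / \<eta>)\<rceil> + 1"
  show ?thesis
  proof (intro exI[of _ K] conjI exI[of _ d0] allI impI)
    show "0 < K" by (simp add: K_def)
    fix d n lam E assume d: "d0 \<le> d" and "ndl_graph n d lam E \<and> K * lam \<le> real d"
    then have G: "ndl_graph n d lam E" "K * lam \<le> real d" by auto
    have d_pos: "0 < d" using d by (simp add: d0_def)
    have "max d2 (1 / \<eta>) \<le> real d" using d unfolding d0_def by linarith
    then have d12: "d2 \<le> real d" "1 / \<eta> \<le> real d" by auto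
    have QR: "quasirandom n d lam K E" by (rule ndl_quasirandom[OF G(1) d_pos _ G(2)]) (simp add: K_def)
    have ex: "n \<le> 2 ^ n * d"
    proof -
      have "n \<le> 2 ^ n" by (rule less_imp_le[OF less_exp])
      also have "\<dots> \<le> 2 ^ n * d" using d_pos by simp
      finally show ?thesis .
    qed
    \<comment> \<open>Minimality makes \<open>2 ^ k\<close> agree with \<open>n / d\<close> up to a
      factor 2 when \<open>k\<close> is positive, as the sparse case requires.\<close>
    define k where "k = (LEAST k. n \<le> 2 ^ k * d)"
    have k: "n \<le> 2 ^ k * d" unfolding k_def by (rule LeastI[of "\<lambda>k. n \<le> 2 ^ k * d", OF ex])
    show "has_complete_immersion n E (nat \<lfloor>(1 - 5 * \<eta>) * real d\<rfloor>)"
    proof (cases "k \<le> k0")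
      case True
      have "2 ^ k * d \<le> 2 ^ k0 * d" using True by (intro mult_right_mono power_increasing) auto
      then have "n \<le> 2 ^ k0 * d" using k by linarith
      then show ?thesis by (intro dense[OF _ d12(1) QR]) (simp_all add: K_def)
    next
      case False
      then obtain k' where k': "k = Suc k'" by (cases k) auto
      have "\<not> n \<le> 2 ^ k' * d" using not_less_Least[of k' "\<lambda>k. n \<le> 2 ^ k * d"] k' unfolding k_def by simp
      then have "2 ^ k * d \<le> 2 * n" using k' by simp
      then show ?thesis using False k by (intro sparse[OF _ d12(2) QR _ k]) (simp_all add: K_def)
    qed
  qed
qed

end
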